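(* Let $d\in\mathbb N$ be fixed. For each integer $n\geq d$ let $\mathcal T_n$ be the Toeplitz algebra on the generalized Bergman space $\mathcal H_n$ on the unit ball of $\mathbb C^d$, let $(e_j)_{j\ge 1}$ be an enumeration of the monomial orthonormal basis of $\mathcal H_n$, fix a positive linear splitting $\sigma: C(S^{2d-1})\to\mathcal T_n$ of the symbol map $\pi:\mathcal T_n\to C(S^{2d-1})$, and let $(Lip(\mathcal T_n),L_n)$ be the associated compact quantum metric space (all as defined in the context). Then the sequence of compact quantum metric spaces $(Lip(\mathcal T_n), L_n)$ converges, as $n\to\infty$, to $C(S^{2d-1})$ in the quantum Gromov-Hausdorff distance, where $C(S^{2d-1})$ carries the compact quantum metric space structure given by the real valued Lipschitz functions on $S^{2d-1}$ with the Lipschitz seminorm $L$.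
   Context: **Compact quantum metric spaces.** An order-unit space $A$ is a real partially ordered vector space with an Archimedean order unit $e_A$, normed by $\|a\|=\inf\{r\ge 0:-re_A\le a\le re_A\}$. Its state space $\mathcal S(A)$ is the set of bounded real linear functionals $\mu$ on $A$ with $\mu(e_A)=1=\|\mu\|$. A seminorm $L$ on $A$ taking finite values is a Lip-norm if $L(e_A)=0$ and the topology on $\mathcal S(A)$ induced by the metric $\rho_L(\mu,\nu)=\sup\{|\mu(a)-\nu(a)|:L(a)\le 1\}$ coincides with the weak$^*$ topology. A compact quantum metric space is a pair $(A,L)$ of an order-unit space and a Lip-norm on it. **Quantum Gromov-Hausdorff distance.** For compact quantum metric spaces $(A,L_A)$, $(B,L_B)$, let $\mathcal M(L_A,L_B)$ be the set of Lip-norms $L$ on $A\oplus B$ (componentwise order, order unit $(e_A,e_B)$) that induce $L_A$ and $L_B$ on $A$ and $B$ as quotient seminorms, i.e. $L_A(a)=\inf_{b}L(a,b)$ and $L_B(b)=\inf_{a}L(a,b)$. The spaces $\mathcal S(A)$, $\mathcal S(B)$ are regarded as subsets of $\mathcal S(A\oplus B)$ via composition with the coordinate projections. Then $$\mathrm{dist}_q(A,B)=\inf\{\mathrm{dist}_{\rho_L}(\mathcal S(A),\mathcal S(B)):L\in\mathcal M(L_A,L_B)\},$$ where $\mathrm{dist}_{\rho_L}$ is the Hausdorff distance between compact subsets of $(\mathcal S(A\oplus B),\rho_L)$. **Toeplitz algebras.** $B^{2d}$ and $\bar B^{2d}$ are the open and closed unit balls of $\mathbb C^d$, and $S^{2d-1}$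 is the unit sphere. For an integer $n\ge d$, $dV_n=c_n(1-|z|^2)^{n-d}\,dV$ with $dV$ Lebesgue measure and $c_n=\frac{n!}{(n-d)!\,\pi^d}$, a probability measure on $B^{2d}$. $\mathcal H_n$ is the Hilbert space of analytic $f:B^{2d}\to\mathbb C$ with $\int|f|^2dV_n<\infty$ and inner product $\langle f|g\rangle_{\mathcal H_n}=\int f\bar g\,dV_n$. An orthonormal basis of $\mathcal H_n$ is given by the monomials $e_{k,n}=\left(\frac{(|k|+n)!}{k!\,n!}\right)^{1/2}z^k$, $k\in\mathbb Z_{\ge0}^d$ (multi-index notation). For $\phi\in C(\bar B^{2d})$, $T_{\phi,n}f=P_n(\phi f)$ where $P_n:L^2(B^{2d},dV_n)\to\mathcal H_n$ is the orthogonal projection. $\mathcal T_n$ is the $C^*$-algebra of operators on $\mathcal H_n$ generated by all $T_{\phi,n}$, $\phi\in C(\bar B^{2d})$, and $\mathscr K(\mathcal H_n)$ is the algebra of compact operators. One has $\mathcal T_n=\{T_{\phi,n}+K:\phi\in C(\bar B^{2d}),K\in\mathscr K(\mathcal H_n)\}$, and $\pi(T_{\phi,n}+K)=\phi|_{S^{2d-1}}$ defines a surjective $*$-homomorphism $\pi:\mathcal T_n\to C(S^{2d-1})$ with kernel $\mathscr K(\mathcal H_n)$. **Splitting.** For each $n$, $\sigma:C(S^{2d-1})\to\mathcal T_n$ is a fixed positive linear map with $\pi\circ\sigma=\mathrm{id}$; for example $f\mapsto T_{\tilde f,n}$, with $\tilde f$ the unique solution of the Dirichlet problem on the ball with boundary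 values $f$. **Lip-norms.** $Lip(\mathscr K(\mathcal H_n))$ is the set of self-adjoint $T\in\mathscr K(\mathcal H_n)$ with $\langle Te_i|e_j\rangle_{\mathcal H_n}\in\mathbb R$ for all $i,j\ge1$ and $\tilde L_n(T):=\sup_{i,j\ge1}(i+j)^{n+2}|\langle Te_i|e_j\rangle_{\mathcal H_n}|<\infty$. Further, $$Lip(\mathcal T_n)=Lip(\mathscr K(\mathcal H_n))\oplus\{\sigma(f):f\text{ a real valued Lipschitz function on }S^{2d-1}\},$$ and $L_n(\sigma(f)+K)=\tilde L_n(K)+L(f)$, where $L(f)$ is the Lipschitz seminorm (Lipschitz constant) of $f$ with respect to the metric of $S^{2d-1}$.
   Formalization: The splitting σ is additionally assumed unital, σ(1)=I for every n; otherwise the identity, the order unit, is not in Lip(T_n) or has L_n(I)≠0, so (Lip(T_n),L_n) is not a compact quantum metric space. *)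

theory Defs
  imports "HOL-Analysis.Analysis" "HOL-Library.Function_Algebras"
begin

text \<open>
  Pointwise real vector space structure on functions.  Operators (functions from functions to
  functions) and real valued functions are thereby elements of an ambient real vector space, and
  the order-unit spaces below are carried by linear subspaces of such an ambient space.
\<close>

instantiation "fun" :: (type, real_vector) real_vector
begin

definition scaleR_fun :: "real \<Rightarrow> ('a \<Rightarrow> 'b) \<Rightarrow> 'a \<Rightarrow> 'b"
  where "scaleR_fun r f = (\<lambda>x. r *\<^sub>R f x)"

instance
  by standard (simp_all add: scaleR_fun_def fun_eq_iff scaleR_add_right scaleR_add_left)

end


section \<open>Order-unit spaces\<close>

record 'a ou_space =
  ou_carrier :: "'a set"
  ou_le :: "'a \<Rightarrow> 'a \<Rightarrow> bool"
  ou_unit :: 'a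

definition order_unit_space :: "('a::real_vector) ou_space \<Rightarrow> bool" where
  "order_unit_space A \<longleftrightarrow>
     subspace (ou_carrier A) \<and>
     (\<forall>a\<in>ou_carrier A. ou_le A a a) \<and>
     (\<forall>a\<in>ou_carrier A. \<forall>b\<in>ou_carrier A. ou_le A a b \<longrightarrow> ou_le A b a \<longrightarrow> a = b) \<and>
     (\<forall>a\<in>ou_carrier A. \<forall>b\<in>ou_carrier A. \<forall>c\<in>ou_carrier A.
        ou_le A a b \<longrightarrow> ou_le A b c \<longrightarrow> ou_le A a c) \<and>
     (\<forall>a\<in>ou_carrier A. \<forall>b\<in>ou_carrier A. \<forall>c\<in>ou_carrier A.
        ou_le A a b \<longrightarrow> ou_le A (a + c) (b + c)) \<and>
     (\<forall>a\<in>ou_carrier A. \<forall>b\<in>ou_carrier A. \<forall>r\<ge>0.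
        ou_le A a b \<longrightarrow> ou_le A (r *\<^sub>R a) (r *\<^sub>R b)) \<and>
     ou_unit A \<in> ou_carrier A \<and>
     (\<forall>a\<in>ou_carrier A. \<exists>r>0. ou_le A a (r *\<^sub>R ou_unit A)) \<and>
     (\<forall>a\<in>ou_carrier A. (\<forall>r>0. ou_le A a (r *\<^sub>R ou_unit A)) \<longrightarrow> ou_le A a 0)"

definition ou_norm :: "('a::real_vector) ou_space \<Rightarrow> 'a \<Rightarrow> real" where
  "ou_norm A a =
     Inf {r. 0 \<le> r \<and> ou_le A (- (r *\<^sub>R ou_unit A)) a \<and> ou_le A a (r *\<^sub>R ou_unit A)}"

text \<open>
  Functionals live on the carrier only; taking them extensional makes them the points
  of the product topology below.
\<close>

definition state_space :: "('a::real_vector) ou_space \<Rightarrow> ('a \<Rightarrow> real) set" where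
  "state_space A = {\<mu> \<in> extensional (ou_carrier A).
     (\<forall>a\<in>ou_carrier A. \<forall>b\<in>ou_carrier A. \<mu> (a + b) = \<mu> a + \<mu> b) \<and>
     (\<forall>a\<in>ou_carrier A. \<forall>r. \<mu> (r *\<^sub>R a) = r * \<mu> a) \<and>
     (\<exists>C. \<forall>a\<in>ou_carrier A. \<bar>\<mu> a\<bar> \<le> C * ou_norm A a) \<and>
     \<mu> (ou_unit A) = 1 \<and>
     (SUP a\<in>{a \<in> ou_carrier A. ou_norm A a \<le> 1}. \<bar>\<mu> a\<bar>) = 1}"

definition weak_star_topology :: "('a::real_vector) ou_space \<Rightarrow> ('a \<Rightarrow> real) topology" where
  "weak_star_topology A =
     subtopology (product_topology (\<lambda>_. euclideanreal) (ou_carrier A)) (state_space A)"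

definition ou_sum ::
  "('a::real_vector) ou_space \<Rightarrow> ('b::real_vector) ou_space \<Rightarrow> ('a \<times> 'b) ou_space" where
  "ou_sum A B = \<lparr>ou_carrier = ou_carrier A \<times> ou_carrier B,
     ou_le = (\<lambda>p q. ou_le A (fst p) (fst q) \<and> ou_le B (snd p) (snd q)),
     ou_unit = (ou_unit A, ou_unit B)\<rparr>"


section \<open>Lip-norms and the quantum Gromov-Hausdorff distance\<close>

definition seminorm_on_ou :: "('a::real_vector) ou_space \<Rightarrow> ('a \<Rightarrow> real) \<Rightarrow> bool" where
  "seminorm_on_ou A L \<longleftrightarrow>
     (\<forall>a\<in>ou_carrier A. 0 \<le> L a) \<and>
     (\<forall>a\<in>ou_carrier A. \<forall>b\<in>ou_carrier A. L (a + b) \<le> L a + L b) \<and>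
     (\<forall>a\<in>ou_carrier A. \<forall>r. L (r *\<^sub>R a) = \<bar>r\<bar> * L a)"

definition rho ::
  "('a::real_vector) ou_space \<Rightarrow> ('a \<Rightarrow> real) \<Rightarrow> ('a \<Rightarrow> real) \<Rightarrow> ('a \<Rightarrow> real) \<Rightarrow> ennreal" where
  "rho A L \<mu> \<nu> = (SUP a\<in>{a \<in> ou_carrier A. L a \<le> 1}. ennreal \<bar>\<mu> a - \<nu> a\<bar>)"

definition lip_norm :: "('a::real_vector) ou_space \<Rightarrow> ('a \<Rightarrow> real) \<Rightarrow> bool" where
  "lip_norm A L \<longleftrightarrow>
     seminorm_on_ou A L \<and> L (ou_unit A) = 0 \<and>
     (\<forall>\<mu>\<in>state_space A. \<forall>\<nu>\<in>state_space A. rho A L \<mu> \<nu> < \<infinity>) \<and>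
     Metric_space (state_space A) (\<lambda>\<mu> \<nu>. enn2real (rho A L \<mu> \<nu>)) \<and>
     Metric_space.mtopology (state_space A) (\<lambda>\<mu> \<nu>. enn2real (rho A L \<mu> \<nu>))
       = weak_star_topology A"

definition compact_quantum_metric_space ::
  "('a::real_vector) ou_space \<Rightarrow> ('a \<Rightarrow> real) \<Rightarrow> bool" where
  "compact_quantum_metric_space A L \<longleftrightarrow> order_unit_space A \<and> lip_norm A L"

definition admissible_lip_norms ::
  "('a::real_vector) ou_space \<Rightarrow> ('a \<Rightarrow> real) \<Rightarrow> ('b::real_vector) ou_space \<Rightarrow> ('b \<Rightarrow> real)
   \<Rightarrow> ('a \<times> 'b \<Rightarrow> real) set" where
  "admissible_lip_norms A LA B LB = {L. lip_norm (ou_sum A B) L \<and>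
     (\<forall>a\<in>ou_carrier A. LA a = (INF b\<in>ou_carrier B. L (a, b))) \<and>
     (\<forall>b\<in>ou_carrier B. LB b = (INF a\<in>ou_carrier A. L (a, b)))}"

definition hausdorff_dist :: "('x \<Rightarrow> 'x \<Rightarrow> ennreal) \<Rightarrow> 'x set \<Rightarrow> 'x set \<Rightarrow> ennreal" where
  "hausdorff_dist \<delta> X Y =
     max (SUP x\<in>X. INF y\<in>Y. \<delta> x y) (SUP y\<in>Y. INF x\<in>X. \<delta> x y)"

definition embed_fst ::
  "'a ou_space \<Rightarrow> 'b ou_space \<Rightarrow> ('a \<Rightarrow> real) \<Rightarrow> 'a \<times> 'b \<Rightarrow> real" where
  "embed_fst A B \<mu> = restrict (\<lambda>p. \<mu> (fst p)) (ou_carrier A \<times> ou_carrier B)"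

definition embed_snd ::
  "'a ou_space \<Rightarrow> 'b ou_space \<Rightarrow> ('b \<Rightarrow> real) \<Rightarrow> 'a \<times> 'b \<Rightarrow> real" where
  "embed_snd A B \<nu> = restrict (\<lambda>p. \<nu> (snd p)) (ou_carrier A \<times> ou_carrier B)"

definition dist_q ::
  "('a::real_vector) ou_space \<Rightarrow> ('a \<Rightarrow> real) \<Rightarrow> ('b::real_vector) ou_space \<Rightarrow> ('b \<Rightarrow> real)
   \<Rightarrow> ennreal" where
  "dist_q A LA B LB = (INF L\<in>admissible_lip_norms A LA B LB.
     hausdorff_dist (rho (ou_sum A B) L)
       (embed_fst A B ` state_space A) (embed_snd A B ` state_space B))"


section \<open>Generalized Bergman spaces on the unit ball\<close>

text \<open>
  The dimension \<open>d\<close> is the cardinality of the index type \<open>'d\<close>.  Elements of the Bergman space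
  are represented by functions on the whole space that vanish outside the open ball, and operators
  on it by maps that send everything outside the Bergman space to 0, so that equality
  of representatives is equality of the objects.
\<close>

type_synonym 'd hfun = "complex ^ 'd \<Rightarrow> complex"
type_synonym 'd hop = "'d hfun \<Rightarrow> 'd hfun"

definition dV :: "nat \<Rightarrow> (complex ^ 'd) measure" where
  "dV n = density lborel (\<lambda>z. ennreal (indicator (ball 0 1) z *
     (fact n / (fact (n - CARD('d)) * pi ^ CARD('d)) * (1 - (norm z)\<^sup>2) ^ (n - CARD('d)))))"

definition analytic_on_ball :: "'d::finite hfun \<Rightarrow> bool" where
  "analytic_on_ball f \<longleftrightarrow> (\<forall>z\<in>ball 0 1. \<exists>D. (f has_derivative D) (at z) \<and>
     (\<forall>c v. D (c *s v) = c * D v))"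

definition bergman :: "nat \<Rightarrow> 'd::finite hfun set" where
  "bergman n = {f. analytic_on_ball f \<and> (\<forall>z. z \<notin> ball 0 1 \<longrightarrow> f z = 0) \<and>
     integrable (dV n) (\<lambda>z. (cmod (f z))\<^sup>2)}"

definition ip :: "nat \<Rightarrow> 'd::finite hfun \<Rightarrow> 'd hfun \<Rightarrow> complex" where
  "ip n f g = integral\<^sup>L (dV n) (\<lambda>z. f z * cnj (g z))"

definition hnorm :: "nat \<Rightarrow> 'd::finite hfun \<Rightarrow> real" where
  "hnorm n f = sqrt (Re (ip n f f))"

definition monomial_basis :: "nat \<Rightarrow> ('d \<Rightarrow> nat) \<Rightarrow> 'd::finite hfun" where
  "monomial_basis n k = (\<lambda>z. if z \<in> ball 0 1 then
     complex_of_real (sqrt (fact ((\<Sum>i\<in>UNIV. k i) + n) / ((\<Prod>i\<in>UNIV. fact (k i)) * fact n)))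
       * (\<Prod>i\<in>UNIV. (z $ i) ^ k i) else 0)"


section \<open>Operators on the Bergman space\<close>

definition bounded_ops :: "nat \<Rightarrow> 'd::finite hop set" where
  "bounded_ops n = {T.
     (\<forall>f\<in>bergman n. T f \<in> bergman n) \<and> (\<forall>f. f \<notin> bergman n \<longrightarrow> T f = 0) \<and>
     (\<forall>f\<in>bergman n. \<forall>g\<in>bergman n. T (f + g) = T f + T g) \<and>
     (\<forall>f\<in>bergman n. \<forall>c. T (\<lambda>z. c * f z) = (\<lambda>z. c * T f z)) \<and>
     (\<exists>C. \<forall>f\<in>bergman n. hnorm n (T f) \<le> C * hnorm n f)}"

definition op_norm :: "nat \<Rightarrow> 'd::finite hop \<Rightarrow> real" where
  "op_norm n T = (SUP f\<in>{f \<in> bergman n. hnorm n f \<le> 1}. hnorm n (T f))"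

definition op_id :: "nat \<Rightarrow> 'd::finite hop" where
  "op_id n = (\<lambda>f. if f \<in> bergman n then f else 0)"

definition is_adjoint :: "nat \<Rightarrow> 'd::finite hop \<Rightarrow> 'd hop \<Rightarrow> bool" where
  "is_adjoint n T S \<longleftrightarrow> T \<in> bounded_ops n \<and> S \<in> bounded_ops n \<and>
     (\<forall>f\<in>bergman n. \<forall>g\<in>bergman n. ip n (T f) g = ip n f (S g))"

definition positive_op :: "nat \<Rightarrow> 'd::finite hop \<Rightarrow> bool" where
  "positive_op n T \<longleftrightarrow> T \<in> bounded_ops n \<and>
     (\<forall>f\<in>bergman n. ip n (T f) f \<in> \<real> \<and> 0 \<le> Re (ip n (T f) f))"

definition compact_ops :: "nat \<Rightarrow> 'd::finite hop set" where
  "compact_ops n = {T \<in> bounded_ops n.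
     \<forall>s::nat \<Rightarrow> 'd hfun. (\<forall>k. s k \<in> bergman n \<and> hnorm n (s k) \<le> 1) \<longrightarrow>
       (\<exists>r g. strict_mono r \<and> g \<in> bergman n \<and> (\<lambda>k. hnorm n (T (s (r k)) - g)) \<longlonglongrightarrow> 0)}"

definition cstar_subalgebra :: "nat \<Rightarrow> 'd::finite hop set \<Rightarrow> bool" where
  "cstar_subalgebra n \<A> \<longleftrightarrow> \<A> \<subseteq> bounded_ops n \<and> 0 \<in> \<A> \<and>
     (\<forall>S\<in>\<A>. \<forall>T\<in>\<A>. S + T \<in> \<A>) \<and>
     (\<forall>T\<in>\<A>. \<forall>c::complex. (\<lambda>f z. c * T f z) \<in> \<A>) \<and>
     (\<forall>S\<in>\<A>. \<forall>T\<in>\<A>. S \<circ> T \<in> \<A>) \<and>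
     (\<forall>T\<in>\<A>. \<forall>S. is_adjoint n T S \<longrightarrow> S \<in> \<A>) \<and>
     (\<forall>T\<in>bounded_ops n. (\<forall>\<epsilon>>0. \<exists>S\<in>\<A>. op_norm n (T - S) < \<epsilon>) \<longrightarrow> T \<in> \<A>)"


section \<open>Toeplitz algebras\<close>

definition bergman_proj :: "nat \<Rightarrow> 'd::finite hfun \<Rightarrow> 'd hfun" where
  "bergman_proj n g = (THE h. h \<in> bergman n \<and> (\<forall>f\<in>bergman n. ip n (g - h) f = 0))"

definition toeplitz :: "nat \<Rightarrow> 'd::finite hfun \<Rightarrow> 'd hop" where
  "toeplitz n \<phi> = (\<lambda>f. if f \<in> bergman n then bergman_proj n (\<lambda>z. \<phi> z * f z) else 0)"

definition toeplitz_algebra :: "nat \<Rightarrow> 'd::finite hop set" where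
  "toeplitz_algebra n = \<Inter>{\<A>. cstar_subalgebra n \<A> \<and>
     (\<forall>\<phi>. continuous_on (cball 0 1) \<phi> \<longrightarrow> toeplitz n \<phi> \<in> \<A>)}"

text \<open>Continuous functions on the sphere, extended by 0.\<close>

definition C_sphere :: "'d::finite hfun set" where
  "C_sphere = {f. continuous_on (sphere 0 1) f \<and> (\<forall>z. z \<notin> sphere 0 1 \<longrightarrow> f z = 0)}"

text \<open>The graph of the symbol map: \<open>has_symbol n T f\<close> says \<open>\<pi>(T) = f\<close>.\<close>

definition has_symbol :: "nat \<Rightarrow> 'd::finite hop \<Rightarrow> 'd hfun \<Rightarrow> bool" where
  "has_symbol n T f \<longleftrightarrow> f \<in> C_sphere \<and>
     (\<exists>\<phi> K. continuous_on (cball 0 1) \<phi> \<and> K \<in> compact_ops n \<and> T = toeplitz n \<phi> + K \<and>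
        (\<forall>z\<in>sphere 0 1. \<phi> z = f z))"

definition positive_splitting :: "nat \<Rightarrow> ('d::finite hfun \<Rightarrow> 'd hop) \<Rightarrow> bool" where
  "positive_splitting n \<sigma> \<longleftrightarrow>
     (\<forall>f\<in>C_sphere. \<sigma> f \<in> toeplitz_algebra n) \<and>
     (\<forall>f\<in>C_sphere. \<forall>g\<in>C_sphere. \<sigma> (f + g) = \<sigma> f + \<sigma> g) \<and>
     (\<forall>f\<in>C_sphere. \<forall>c::complex. \<sigma> (\<lambda>z. c * f z) = (\<lambda>h z. c * \<sigma> f h z)) \<and>
     (\<forall>f\<in>C_sphere. (\<forall>z. f z \<in> \<real> \<and> 0 \<le> Re (f z)) \<longrightarrow> positive_op n (\<sigma> f)) \<and>
     (\<forall>f\<in>C_sphere. has_symbol n (\<sigma> f) f)"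


section \<open>The two compact quantum metric spaces\<close>

text \<open>The metric of the sphere is the restriction of the Euclidean one.\<close>

definition Lip_sphere :: "(complex ^ 'd::finite \<Rightarrow> real) set" where
  "Lip_sphere = {f. (\<exists>C. C-lipschitz_on (sphere 0 1) f) \<and> (\<forall>z. z \<notin> sphere 0 1 \<longrightarrow> f z = 0)}"

definition L_sphere :: "(complex ^ 'd::finite \<Rightarrow> real) \<Rightarrow> real" where
  "L_sphere f = Inf {C. C-lipschitz_on (sphere 0 1) f}"

definition sphere_space :: "(complex ^ 'd::finite \<Rightarrow> real) ou_space" where
  "sphere_space = \<lparr>ou_carrier = Lip_sphere,
     ou_le = (\<lambda>f g. \<forall>z\<in>sphere 0 1. f z \<le> g z),
     ou_unit = indicator (sphere 0 1)\<rparr>"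

text \<open>In the following, \<open>e\<close> is the sequence of basis vectors, indexed from 1 (\<open>e 0\<close> is unused).\<close>

definition L_compact :: "nat \<Rightarrow> (nat \<Rightarrow> 'd::finite hfun) \<Rightarrow> 'd hop \<Rightarrow> real" where
  "L_compact n e T =
     (SUP (i, j)\<in>{1..} \<times> {1..}. real (i + j) ^ (n + 2) * cmod (ip n (T (e i)) (e j)))"

definition Lip_compact :: "nat \<Rightarrow> (nat \<Rightarrow> 'd::finite hfun) \<Rightarrow> 'd hop set" where
  "Lip_compact n e = {T \<in> compact_ops n. is_adjoint n T T \<and>
     (\<forall>i\<ge>1. \<forall>j\<ge>1. ip n (T (e i)) (e j) \<in> \<real>) \<and>
     bdd_above ((\<lambda>(i, j). real (i + j) ^ (n + 2) * cmod (ip n (T (e i)) (e j)))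
       ` ({1..} \<times> {1..}))}"

definition Lip_toeplitz ::
  "nat \<Rightarrow> (nat \<Rightarrow> 'd::finite hfun) \<Rightarrow> ('d hfun \<Rightarrow> 'd hop) \<Rightarrow> 'd hop set" where
  "Lip_toeplitz n e \<sigma> =
     {\<sigma> (complex_of_real \<circ> f) + K | f K. f \<in> Lip_sphere \<and> K \<in> Lip_compact n e}"

text \<open>
  For a splitting \<open>\<sigma>\<close> of the symbol map the decomposition \<open>T = \<sigma>(f) + K\<close> is unique.
\<close>

definition L_toeplitz ::
  "nat \<Rightarrow> (nat \<Rightarrow> 'd::finite hfun) \<Rightarrow> ('d hfun \<Rightarrow> 'd hop) \<Rightarrow> 'd hop \<Rightarrow> real" where
  "L_toeplitz n e \<sigma> T = (THE r. \<exists>f K. f \<in> Lip_sphere \<and> K \<in> Lip_compact n e \<and>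
     T = \<sigma> (complex_of_real \<circ> f) + K \<and> r = L_compact n e K + L_sphere f)"

definition toeplitz_space ::
  "nat \<Rightarrow> (nat \<Rightarrow> 'd::finite hfun) \<Rightarrow> ('d hfun \<Rightarrow> 'd hop) \<Rightarrow> 'd hop ou_space" where
  "toeplitz_space n e \<sigma> = \<lparr>ou_carrier = Lip_toeplitz n e \<sigma>,
     ou_le = (\<lambda>S T. positive_op n (T - S)),
     ou_unit = op_id n\<rparr>"

end

theory Submission
  imports Defs "HOL-Complex_Analysis.Complex_Analysis"
begin

text \<open>
  The symbol map \<open>\<pi>\<close> retracts \<open>Lip(T\<^sub>n)\<close> onto the Lipschitz functions on the sphere, with section \<open>\<sigma>\<close>;
  both maps are positive and unital, \<open>L \<circ> \<pi> \<le> L\<^sub>n\<close> and \<open>L\<^sub>n \<circ> \<sigma> = L\<close>. If \<open>\<parallel>T - \<sigma> (\<pi> T)\<parallel> \<le> \<delta>\<close> whenever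
  \<open>L\<^sub>n T \<le> 1\<close>, then the bridges \<open>max {L\<^sub>n T, L g, \<parallel>\<pi> T - g\<parallel> / \<gamma>}\<close> with \<open>\<gamma> \<rightarrow> 0\<close> show that the quantum
  Gromov-Hausdorff distance is at most \<open>\<delta>\<close>. Here \<open>T - \<sigma> (\<pi> T)\<close> is the compact part \<open>K\<close> of \<open>T\<close>, whose matrix
  entries are at most \<open>(i + j)\<^bsup>-(n+2)\<^esup>\<close>, so that \<open>\<parallel>K\<parallel> \<le> c 2\<^bsup>-(n+2)\<^esup>\<close>. The same decay makes the Lip-norm ball
  of the compact part totally bounded, and Arzela-Ascoli handles the symbols; a seminorm whose unit
  ball is totally bounded modulo scalars is a Lip-norm.

  Positivity and uniqueness of the symbol are obtained from normalised powers of a linear function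
  peaking at a boundary point: they converge weakly to \<open>0\<close>, so compact operators do not see them, while
  \<open>T\<^sub>\<phi>\<close> evaluates \<open>\<phi>\<close> at that point in the limit.
\<close>

section \<open>Order-unit spaces and their states\<close>

text \<open>Matrix entries control an operator only if the monomials are orthonormal and total, so
  the Bergman space itself takes much of the work. Orthonormality rests on the moments of
  \<open>dV n\<close>. For totality, \<open>f\<close> is replaced by its dilations
  \<open>f (r z)\<close>, which live on a larger ball, and these are split into parts homogeneous in
  one coordinate after another until only monomials remain.

  Operator norms play no part in the estimates: in the Toeplitz space \<open>ou_within\<close> is a
  two-sided bound on quadratic forms, which the entries control directly. States cause no extension
  problem either, because both maps of the retraction are positive and unital, so states pull back
  along them in both directions.

  The delicate point about Lip-norms is the scalars. Total boundedness holds only modulo multiples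
  of the unit, and a direct sum has one unit for two summands; the two scalars are matched by a
  state evaluated on the difference that the bridge controls.\<close>

definition ou_within :: "('a::real_vector) ou_space \<Rightarrow> real \<Rightarrow> 'a \<Rightarrow> bool" where
  "ou_within A r a \<longleftrightarrow> ou_le A (- (r *\<^sub>R ou_unit A)) a \<and> ou_le A a (r *\<^sub>R ou_unit A)"

lemma order_unit_spaceI:
  assumes "subspace (ou_carrier A)"
    and "\<And>a. a \<in> ou_carrier A \<Longrightarrow> ou_le A a a"
    and "\<And>a b. a \<in> ou_carrier A \<Longrightarrow> b \<in> ou_carrier A \<Longrightarrow> ou_le A a b \<Longrightarrow> ou_le A b a \<Longrightarrow> a = b"
    and "\<And>a b c. a \<in> ou_carrier A \<Longrightarrow> b \<in> ou_carrier A \<Longrightarrow> c \<in> ou_carrier A \<Longrightarrow>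
      ou_le A a b \<Longrightarrow> ou_le A b c \<Longrightarrow> ou_le A a c"
    and "\<And>a b c. a \<in> ou_carrier A \<Longrightarrow> b \<in> ou_carrier A \<Longrightarrow> c \<in> ou_carrier A \<Longrightarrow>
      ou_le A a b \<Longrightarrow> ou_le A (a + c) (b + c)"
    and "\<And>a b r. a \<in> ou_carrier A \<Longrightarrow> b \<in> ou_carrier A \<Longrightarrow> 0 \<le> r \<Longrightarrow>
      ou_le A a b \<Longrightarrow> ou_le A (r *\<^sub>R a) (r *\<^sub>R b)"
    and "ou_unit A \<in> ou_carrier A"
    and "\<And>a. a \<in> ou_carrier A \<Longrightarrow> \<exists>r>0. ou_le A a (r *\<^sub>R ou_unit A)"
    and "\<And>a. a \<in> ou_carrier A \<Longrightarrow> (\<And>r. r > 0 \<Longrightarrow> ou_le A a (r *\<^sub>R ou_unit A)) \<Longrightarrow> ou_le A a 0"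
  shows "order_unit_space A"
  unfolding order_unit_space_def
proof (intro conjI ballI allI impI)
  fix a assume "a \<in> ou_carrier A" "\<forall>r>0. ou_le A a (r *\<^sub>R ou_unit A)"
  then show "ou_le A a 0" by (intro assms(9)) (auto simp del: scaleR_eq_0_iff)
qed (rule assms; assumption)+

locale ou =
  fixes A :: "('a::real_vector) ou_space"
  assumes ou: "order_unit_space A"
begin

lemmas ou_conjuncts = ou[unfolded order_unit_space_def]

lemma carrier_subspace: "subspace (ou_carrier A)"
  by (rule ou_conjuncts[THEN conjunct1])

lemma le_refl: "a \<in> ou_carrier A \<Longrightarrow> ou_le A a a"
  by (rule ou_conjuncts[THEN conjunct2, THEN conjunct1, rule_format])

lemma le_antisym:
  "a \<in> ou_carrier A \<Longrightarrow> b \<in> ou_carrier A \<Longrightarrow> ou_le A a b \<Longrightarrow> ou_le A b a \<Longrightarrow> a = b"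
  by (rule ou_conjuncts[THEN conjunct2, THEN conjunct2, THEN conjunct1, rule_format])

lemma le_trans:
  "a \<in> ou_carrier A \<Longrightarrow> b \<in> ou_carrier A \<Longrightarrow> c \<in> ou_carrier A \<Longrightarrow>
    ou_le A a b \<Longrightarrow> ou_le A b c \<Longrightarrow> ou_le A a c"
  by (rule ou_conjuncts[THEN conjunct2, THEN conjunct2, THEN conjunct2, THEN conjunct1, rule_format])

lemma le_add_right:
  "a \<in> ou_carrier A \<Longrightarrow> b \<in> ou_carrier A \<Longrightarrow> c \<in> ou_carrier A \<Longrightarrow>
    ou_le A a b \<Longrightarrow> ou_le A (a + c) (b + c)"
  by (rule ou_conjuncts[THEN conjunct2, THEN conjunct2, THEN conjunct2, THEN conjunct2,
        THEN conjunct1, rule_format])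

lemma le_scale:
  "a \<in> ou_carrier A \<Longrightarrow> b \<in> ou_carrier A \<Longrightarrow> 0 \<le> r \<Longrightarrow>
    ou_le A a b \<Longrightarrow> ou_le A (r *\<^sub>R a) (r *\<^sub>R b)"
  by (rule ou_conjuncts[THEN conjunct2, THEN conjunct2, THEN conjunct2, THEN conjunct2,
        THEN conjunct2, THEN conjunct1, rule_format])

lemmas ou_unit_conjuncts = ou_conjuncts[THEN conjunct2, THEN conjunct2, THEN conjunct2,
    THEN conjunct2, THEN conjunct2, THEN conjunct2]

lemma order_unit: "a \<in> ou_carrier A \<Longrightarrow> \<exists>r>0. ou_le A a (r *\<^sub>R ou_unit A)"
  by (rule ou_unit_conjuncts[THEN conjunct2, THEN conjunct1, rule_format])

lemma archimedean:
  "a \<in> ou_carrier A \<Longrightarrow> (\<And>r. r > 0 \<Longrightarrow> ou_le A a (r *\<^sub>R ou_unit A)) \<Longrightarrow> ou_le A a 0"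
  by (rule ou_unit_conjuncts[THEN conjunct2, THEN conjunct2, rule_format]) auto

lemma carrier_intros [intro, simp]:
  "0 \<in> ou_carrier A"
  "ou_unit A \<in> ou_carrier A"
  "a \<in> ou_carrier A \<Longrightarrow> b \<in> ou_carrier A \<Longrightarrow> a + b \<in> ou_carrier A"
  "a \<in> ou_carrier A \<Longrightarrow> b \<in> ou_carrier A \<Longrightarrow> a - b \<in> ou_carrier A"
  "a \<in> ou_carrier A \<Longrightarrow> - a \<in> ou_carrier A"
  "a \<in> ou_carrier A \<Longrightarrow> r *\<^sub>R a \<in> ou_carrier A"
  using carrier_subspace ou_unit_conjuncts[THEN conjunct1]
  by (simp_all add: subspace_add subspace_diff subspace_neg subspace_scale subspace_0)

lemma le_add:
  assumes "a \<in> ou_carrier A" "b \<in> ou_carrier A" "c \<in> ou_carrier A" "d \<in> ou_carrier A"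
    and "ou_le A a b" "ou_le A c d"
  shows "ou_le A (a + c) (b + d)"
proof (rule le_trans[of _ "b + c"])
  show "ou_le A (a + c) (b + c)" using assms by (intro le_add_right)
  show "ou_le A (b + c) (b + d)"
    using le_add_right[of c d b] assms by (simp add: add.commute)
qed (use assms in auto)

lemma le_uminus:
  assumes "a \<in> ou_carrier A" "b \<in> ou_carrier A" "ou_le A a b"
  shows "ou_le A (- b) (- a)"
  using le_add_right[of a b "- a - b"] assms by (simp add: algebra_simps)

lemma unit_nonneg: "0 \<le> r \<Longrightarrow> ou_le A 0 (r *\<^sub>R ou_unit A)"
proof -
  assume r: "0 \<le> r"
  obtain s where s: "s > 0" "ou_le A 0 (s *\<^sub>R ou_unit A)"
    using order_unit[of 0] by auto
  have "ou_le A ((r / s) *\<^sub>R 0) ((r / s) *\<^sub>R (s *\<^sub>R ou_unit A))"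
    using r s by (intro le_scale) auto
  then show ?thesis using s by simp
qed

lemma within_add:
  assumes "a \<in> ou_carrier A" "b \<in> ou_carrier A" "ou_within A r a" "ou_within A s b"
  shows "ou_within A (r + s) (a + b)"
  using assms le_add[of "- (r *\<^sub>R ou_unit A)" a "- (s *\<^sub>R ou_unit A)" b]
    le_add[of a "r *\<^sub>R ou_unit A" b "s *\<^sub>R ou_unit A"]
  by (auto simp: ou_within_def scaleR_add_left)

lemma within_uminus:
  assumes "a \<in> ou_carrier A" "ou_within A r a"
  shows "ou_within A r (- a)"
  using assms le_uminus[of "- (r *\<^sub>R ou_unit A)" a] le_uminus[of a "r *\<^sub>R ou_unit A"]
  by (auto simp: ou_within_def)

lemma within_scale:
  assumes "a \<in> ou_carrier A" "ou_within A r a"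
  shows "ou_within A (\<bar>c\<bar> * r) (c *\<^sub>R a)"
proof -
  have *: "ou_within A (c * r) (c *\<^sub>R a)" if "0 \<le> c" for c
    using that assms le_scale[of "- (r *\<^sub>R ou_unit A)" a c] le_scale[of a "r *\<^sub>R ou_unit A" c]
    by (auto simp: ou_within_def)
  show ?thesis
  proof (cases "0 \<le> c")
    case False
    then have "ou_within A (\<bar>c\<bar> * r) (- (\<bar>c\<bar> *\<^sub>R a))"
      using assms by (intro within_uminus *) auto
    with False show ?thesis by simp
  qed (use * in auto)
qed

lemma within_0: "0 \<le> r \<Longrightarrow> ou_within A r 0"
  using unit_nonneg[of r] le_uminus[of 0 "r *\<^sub>R ou_unit A"] by (simp add: ou_within_def)

lemma within_mono:
  assumes "a \<in> ou_carrier A" "ou_within A r a" "r \<le> s"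
  shows "ou_within A s a"
  using within_add[of a 0 r "s - r"] within_0[of "s - r"] assms by simp

lemma within_unit: "ou_within A \<bar>c\<bar> (c *\<^sub>R ou_unit A)"
proof -
  have "ou_within A 1 (ou_unit A)"
    using unit_nonneg[of 2] le_add_right[of 0 "2 *\<^sub>R ou_unit A" "- ou_unit A"] le_refl[of "ou_unit A"]
    by (simp add: ou_within_def scaleR_2)
  from within_scale[OF _ this, of c] show ?thesis by simp
qed

lemma within_exists: "a \<in> ou_carrier A \<Longrightarrow> \<exists>r\<ge>0. ou_within A r a"
proof -
  assume a: "a \<in> ou_carrier A"
  obtain r where r: "r > 0" "ou_le A a (r *\<^sub>R ou_unit A)" using order_unit a by auto
  obtain s where s: "s > 0" "ou_le A (- a) (s *\<^sub>R ou_unit A)" using order_unit[of "- a"] a by auto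
  have mono: "ou_le A (x *\<^sub>R ou_unit A) (y *\<^sub>R ou_unit A)" if "x \<le> y" for x y
    using unit_nonneg[of "y - x"] that
      le_add_right[of 0 "(y - x) *\<^sub>R ou_unit A" "x *\<^sub>R ou_unit A"]
    by (simp add: scaleR_diff_left)
  have "ou_le A a (max r s *\<^sub>R ou_unit A)"
    by (rule le_trans[OF _ _ _ r(2) mono]) (use a in auto)
  moreover have "ou_le A (- a) (max r s *\<^sub>R ou_unit A)"
    by (rule le_trans[OF _ _ _ s(2) mono]) (use a in auto)
  then have "ou_le A (- (max r s *\<^sub>R ou_unit A)) a"
    using le_uminus[of "- a"] a by fastforce
  ultimately show ?thesis using r by (intro exI[of _ "max r s"]) (auto simp: ou_within_def)
qed

lemma within_0_eq: "a \<in> ou_carrier A \<Longrightarrow> ou_within A 0 a \<Longrightarrow> a = 0"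
  by (rule le_antisym) (auto simp: ou_within_def)

lemma ou_norm_alt: "ou_norm A a = Inf {r. 0 \<le> r \<and> ou_within A r a}"
  by (simp add: ou_norm_def ou_within_def)

lemma ou_norm_le: "0 \<le> r \<Longrightarrow> ou_within A r a \<Longrightarrow> ou_norm A a \<le> r"
  unfolding ou_norm_alt by (rule cInf_lower) (auto intro!: bdd_belowI[of _ 0])

lemma ou_norm_ge:
  assumes "a \<in> ou_carrier A" "\<And>r. 0 \<le> r \<Longrightarrow> ou_within A r a \<Longrightarrow> x \<le> r"
  shows "x \<le> ou_norm A a"
  unfolding ou_norm_alt using within_exists[OF assms(1)] assms(2) by (intro cInf_greatest) auto

lemma ou_norm_nonneg: "a \<in> ou_carrier A \<Longrightarrow> 0 \<le> ou_norm A a"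
  by (rule ou_norm_ge) auto

text \<open>A strict inequality is converted, which avoids showing that the infimum in
  \<open>ou_norm\<close> is attained. Later estimates leave room for this, such as the doubled
  \<open>\<gamma>\<close> in \<open>rho_bridge_le\<close>.\<close>

lemma ou_norm_less_within:
  assumes a: "a \<in> ou_carrier A" and less: "ou_norm A a < r"
  shows "ou_within A r a"
proof (rule ccontr)
  assume "\<not> ou_within A r a"
  then have "r \<le> s" if "0 \<le> s" "ou_within A s a" for s
    using within_mono[OF a that(2)] by (cases "r \<le> s") auto
  then have "r \<le> ou_norm A a" using a by (intro ou_norm_ge) auto
  with less show False by simp
qed

lemma ou_norm_0: "ou_norm A 0 = 0"
  using ou_norm_le[of 0 0] ou_norm_nonneg[of 0] within_0[of 0] by auto

lemma ou_norm_triangle: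
  assumes a: "a \<in> ou_carrier A" and b: "b \<in> ou_carrier A"
  shows "ou_norm A (a + b) \<le> ou_norm A a + ou_norm A b"
proof (rule field_le_epsilon)
  fix e :: real assume e: "e > 0"
  have "ou_within A ((ou_norm A a + e / 2) + (ou_norm A b + e / 2)) (a + b)"
    using a b e by (intro within_add ou_norm_less_within) auto
  then show "ou_norm A (a + b) \<le> ou_norm A a + ou_norm A b + e"
    using ou_norm_nonneg[OF a] ou_norm_nonneg[OF b] e by (intro ou_norm_le) (auto simp: algebra_simps)
qed

lemma ou_norm_scale_le:
  assumes a: "a \<in> ou_carrier A"
  shows "ou_norm A (c *\<^sub>R a) \<le> \<bar>c\<bar> * ou_norm A a"
proof (rule field_le_epsilon)
  fix e :: real assume e: "e > 0"
  define d where "d = e / (\<bar>c\<bar> + 1)"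
  have d: "d > 0" "\<bar>c\<bar> * d \<le> e"
    using e by (auto simp: d_def field_simps intro!: mult_right_mono)
  have "ou_within A (\<bar>c\<bar> * (ou_norm A a + d)) (c *\<^sub>R a)"
    using a d by (intro within_scale ou_norm_less_within) auto
  then have "ou_norm A (c *\<^sub>R a) \<le> \<bar>c\<bar> * (ou_norm A a + d)"
    using ou_norm_nonneg[OF a] d by (intro ou_norm_le) auto
  also have "\<dots> \<le> \<bar>c\<bar> * ou_norm A a + e" using d by (simp add: algebra_simps)
  finally show "ou_norm A (c *\<^sub>R a) \<le> \<bar>c\<bar> * ou_norm A a + e" .
qed

lemma ou_norm_scale:
  assumes a: "a \<in> ou_carrier A"
  shows "ou_norm A (c *\<^sub>R a) = \<bar>c\<bar> * ou_norm A a"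
proof (cases "c = 0")
  case False
  have "ou_norm A ((1 / c) *\<^sub>R (c *\<^sub>R a)) \<le> \<bar>1 / c\<bar> * ou_norm A (c *\<^sub>R a)"
    using a by (intro ou_norm_scale_le) auto
  then have "\<bar>c\<bar> * ou_norm A a \<le> ou_norm A (c *\<^sub>R a)" using False by (simp add: field_simps)
  with ou_norm_scale_le[OF a, of c] show ?thesis by simp
qed (simp add: ou_norm_0)

text \<open>Bounds on order intervals replace the supremum over the unit ball, so states can be
  built and used without the order norm. Forwards, one rescales by \<open>1 / r\<close>; the
  excluded value \<open>r = 0\<close> is settled by antisymmetry of the order, through
  \<open>within_0_eq\<close>. Backwards, the supremum is attained at the order unit.\<close>

lemma state_space_iff:
  "\<mu> \<in> state_space A \<longleftrightarrow>
     \<mu> \<in> extensional (ou_carrier A) \<and>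
     (\<forall>a\<in>ou_carrier A. \<forall>b\<in>ou_carrier A. \<mu> (a + b) = \<mu> a + \<mu> b) \<and>
     (\<forall>a\<in>ou_carrier A. \<forall>r. \<mu> (r *\<^sub>R a) = r * \<mu> a) \<and>
     \<mu> (ou_unit A) = 1 \<and>
     (\<forall>a\<in>ou_carrier A. \<forall>r\<ge>0. ou_within A r a \<longrightarrow> \<bar>\<mu> a\<bar> \<le> r)" (is "?L \<longleftrightarrow> ?R")
proof
  let ?U = "{a \<in> ou_carrier A. ou_norm A a \<le> 1}"
  assume L: ?L
  then have hom: "\<forall>a\<in>ou_carrier A. \<forall>r. \<mu> (r *\<^sub>R a) = r * \<mu> a"
    and S: "(SUP a\<in>?U. \<bar>\<mu> a\<bar>) = 1" by (auto simp: state_space_def)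
  obtain C where C: "\<forall>a\<in>ou_carrier A. \<bar>\<mu> a\<bar> \<le> C * ou_norm A a"
    using L by (auto simp: state_space_def)
  have "\<bar>\<mu> a\<bar> \<le> \<bar>C\<bar>" if "a \<in> ?U" for a
  proof -
    have "\<bar>\<mu> a\<bar> \<le> C * ou_norm A a" using C that by auto
    also have "\<dots> \<le> \<bar>C\<bar> * 1" using that ou_norm_nonneg[of a] by (intro mult_mono) auto
    finally show ?thesis by simp
  qed
  then have bdd: "bdd_above ((\<lambda>a. \<bar>\<mu> a\<bar>) ` ?U)" by (intro bdd_aboveI[of _ "\<bar>C\<bar>"]) auto
  have le1: "\<bar>\<mu> a\<bar> \<le> 1" if "a \<in> ?U" for a
    using cSUP_upper[OF that bdd] S by simp
  have "\<bar>\<mu> a\<bar> \<le> r" if a: "a \<in> ou_carrier A" "0 \<le> r" "ou_within A r a" for a r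
  proof (cases "r = 0")
    case True
    then have "a = 0" using within_0_eq a by auto
    with hom[rule_format, of 0 0] True show ?thesis by auto
  next
    case False
    then have "ou_within A 1 ((1 / r) *\<^sub>R a)"
      using within_scale[OF a(1,3), of "1 / r"] a by simp
    then have "\<bar>\<mu> ((1 / r) *\<^sub>R a)\<bar> \<le> 1"
      using a by (intro le1) (auto intro: ou_norm_le)
    then show ?thesis using hom a False by (simp add: field_simps abs_mult)
  qed
  with L show ?R by (auto simp: state_space_def)
next
  let ?U = "{a \<in> ou_carrier A. ou_norm A a \<le> 1}"
  assume R: ?R
  have bd: "\<bar>\<mu> a\<bar> \<le> 1 * ou_norm A a" if "a \<in> ou_carrier A" for a
    using R that ou_norm_ge[of a "\<bar>\<mu> a\<bar>"] by auto
  have e: "ou_unit A \<in> ?U"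
    using ou_norm_le[of 1 "ou_unit A"] within_unit[of 1] by simp
  have "(SUP a\<in>?U. \<bar>\<mu> a\<bar>) = 1"
  proof (rule cSup_eq_maximum)
    show "1 \<in> (\<lambda>a. \<bar>\<mu> a\<bar>) ` ?U" using e R by (intro image_eqI[of _ _ "ou_unit A"]) auto
    show "x \<le> 1" if "x \<in> (\<lambda>a. \<bar>\<mu> a\<bar>) ` ?U" for x using that bd by fastforce
  qed
  with R bd show ?L unfolding state_space_def by (auto intro!: exI[of _ 1])
qed

lemma state_add:
    "\<mu> \<in> state_space A \<Longrightarrow> a \<in> ou_carrier A \<Longrightarrow> b \<in> ou_carrier A \<Longrightarrow> \<mu> (a + b) = \<mu> a + \<mu> b"
  and state_scale: "\<mu> \<in> state_space A \<Longrightarrow> a \<in> ou_carrier A \<Longrightarrow> \<mu> (r *\<^sub>R a) = r * \<mu> a"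
  and state_unit: "\<mu> \<in> state_space A \<Longrightarrow> \<mu> (ou_unit A) = 1"
  by (simp_all add: state_space_iff)

lemma state_diff:
  assumes "\<mu> \<in> state_space A" "a \<in> ou_carrier A" "b \<in> ou_carrier A"
  shows "\<mu> (a - b) = \<mu> a - \<mu> b"
  using state_add[OF assms(1,2), of "(-1) *\<^sub>R b"] state_scale[OF assms(1,3), of "-1"] assms by simp

lemmas state_linear = state_add state_scale state_unit state_diff

lemma state_bound:
  "\<mu> \<in> state_space A \<Longrightarrow> a \<in> ou_carrier A \<Longrightarrow> 0 \<le> r \<Longrightarrow> ou_within A r a \<Longrightarrow> \<bar>\<mu> a\<bar> \<le> r"
  by (auto simp: state_space_iff)

end

section \<open>Finite covers by small sets\<close>

text \<open>Total boundedness without a metric: \<open>P\<close> may be any relation, closeness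
  modulo scalars included, and neither symmetry nor a triangle inequality is asked of it. Conditions
  concern \<open>S \<inter> X\<close> only, so covering sets may stick out of \<open>X\<close>; this
  makes pullbacks and intersections immediate.\<close>

definition small_cover :: "'a set \<Rightarrow> ('a \<Rightarrow> 'a \<Rightarrow> bool) \<Rightarrow> bool" where
  "small_cover X P \<longleftrightarrow> (\<exists>\<C>. finite \<C> \<and> X \<subseteq> \<Union>\<C> \<and> (\<forall>S\<in>\<C>. \<forall>a\<in>S \<inter> X. \<forall>b\<in>S \<inter> X. P a b))"

lemma small_coverI:
  assumes "finite \<C>" "X \<subseteq> \<Union>\<C>" "\<And>S a b. S \<in> \<C> \<Longrightarrow> a \<in> S \<Longrightarrow> b \<in> S \<Longrightarrow> a \<in> X \<Longrightarrow> b \<in> X \<Longrightarrow> P a b"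
  shows "small_cover X P"
  unfolding small_cover_def using assms by (intro exI[of _ \<C>] conjI ballI) (blast+)

lemma small_cover_mono:
  assumes "small_cover X P" and PQ: "\<And>a b. a \<in> X \<Longrightarrow> b \<in> X \<Longrightarrow> P a b \<Longrightarrow> Q a b"
  shows "small_cover X Q"
proof -
  obtain C where C: "finite C \<and> X \<subseteq> \<Union>C \<and> (\<forall>S\<in>C. \<forall>a\<in>S \<inter> X. \<forall>b\<in>S \<inter> X. P a b)"
    using assms(1)[unfolded small_cover_def] by (rule exE)
  show ?thesis by (rule small_coverI[of C]) (use C in \<open>auto intro!: PQ\<close>)
qed

lemma small_cover_conj:
  assumes "small_cover X P" "small_cover X Q"
  shows "small_cover X (\<lambda>a b. P a b \<and> Q a b)"
proof -
  obtain C where C0: "finite C \<and> X \<subseteq> \<Union>C \<and> (\<forall>S\<in>C. \<forall>a\<in>S \<inter> X. \<forall>b\<in>S \<inter> X. P a b)"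
    using assms(1)[unfolded small_cover_def] by (rule exE)
  then have C: "finite C" "X \<subseteq> \<Union>C" by auto
  have P: "P a b" if "S \<in> C" "a \<in> S" "b \<in> S" "a \<in> X" "b \<in> X" for S a b
    using C0 that by blast
  obtain D where D0: "finite D \<and> X \<subseteq> \<Union>D \<and> (\<forall>S\<in>D. \<forall>a\<in>S \<inter> X. \<forall>b\<in>S \<inter> X. Q a b)"
    using assms(2)[unfolded small_cover_def] by (rule exE)
  then have D: "finite D" "X \<subseteq> \<Union>D" by auto
  have Q: "Q a b" if "S \<in> D" "a \<in> S" "b \<in> S" "a \<in> X" "b \<in> X" for S a b
    using D0 that by blast
  show ?thesis
  proof (rule small_coverI)
    show "finite ((\<lambda>(S, T). S \<inter> T) ` (C \<times> D))" using C D by auto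
    show "X \<subseteq> \<Union>((\<lambda>(S, T). S \<inter> T) ` (C \<times> D))"
    proof
      fix x assume "x \<in> X"
      then obtain S T where "S \<in> C" "x \<in> S" "T \<in> D" "x \<in> T" using C(2) D(2) by blast
      then show "x \<in> \<Union>((\<lambda>(S, T). S \<inter> T) ` (C \<times> D))" by (intro UnionI[of "S \<inter> T"]) auto
    qed
    fix S a b assume "S \<in> (\<lambda>(S, T). S \<inter> T) ` (C \<times> D)" and ab: "a \<in> S" "b \<in> S" "a \<in> X" "b \<in> X"
    then obtain U V where "U \<in> C" "V \<in> D" "S = U \<inter> V" by auto
    then show "P a b \<and> Q a b" using P[of U a b] Q[of V a b] ab by simp
  qed
qed

lemma small_cover_pullback:
  assumes "small_cover Y P" and h: "h ` X \<subseteq> Y"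
  shows "small_cover X (\<lambda>a b. P (h a) (h b))"
proof -
  obtain C where C0: "finite C \<and> Y \<subseteq> \<Union>C \<and> (\<forall>S\<in>C. \<forall>a\<in>S \<inter> Y. \<forall>b\<in>S \<inter> Y. P a b)"
    using assms(1)[unfolded small_cover_def] by (rule exE)
  then have C: "finite C" "Y \<subseteq> \<Union>C" by auto
  have P: "P a b" if "S \<in> C" "a \<in> S" "b \<in> S" "a \<in> Y" "b \<in> Y" for S a b
    using C0 that by blast
  show ?thesis
  proof (rule small_coverI)
    show "finite ((\<lambda>S. h -` S) ` C)" using C by simp
    show "X \<subseteq> \<Union>((\<lambda>S. h -` S) ` C)"
    proof
      fix x assume "x \<in> X"
      then have "h x \<in> \<Union>C" using C(2) h by blast
      then show "x \<in> \<Union>((\<lambda>S. h -` S) ` C)" by auto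
    qed
    fix S a b assume "S \<in> (\<lambda>S. h -` S) ` C" and ab: "a \<in> S" "b \<in> S" "a \<in> X" "b \<in> X"
    then obtain U where "U \<in> C" "S = h -` U" by auto
    then show "P (h a) (h b)" using P[of U "h a" "h b"] ab h by auto
  qed
qed

lemma small_cover_Ball:
  assumes "finite I" "\<And>i. i \<in> I \<Longrightarrow> small_cover X (P i)"
  shows "small_cover X (\<lambda>a b. \<forall>i\<in>I. P i a b)"
  using assms
proof (induction I)
  case empty
  then show ?case by (intro small_coverI[of "{X}"]) auto
next
  case (insert i I)
  then have "small_cover X (\<lambda>a b. P i a b \<and> (\<forall>i\<in>I. P i a b))"
    by (intro small_cover_conj) auto
  then show ?case by (rule small_cover_mono) auto
qed

text \<open>Reals whose quotients by \<open>\<delta>\<close> have the same floor differ by at most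
  \<open>\<delta>\<close>, and only finitely many floors occur on a bounded interval.\<close>

lemma small_cover_interval:
  assumes d: "0 < \<delta>"
  shows "small_cover {-M..M::real} (\<lambda>x y. \<bar>x - y\<bar> \<le> \<delta>)"
proof -
  let ?\<C> = "(\<lambda>k::int. {x. \<lfloor>x / \<delta>\<rfloor> = k}) ` {\<lfloor>- M / \<delta>\<rfloor>..\<lfloor>M / \<delta>\<rfloor>}"
  have "{-M..M} \<subseteq> \<Union>?\<C>"
  proof
    fix x assume x: "x \<in> {-M..M}"
    have "\<lfloor>- M / \<delta>\<rfloor> \<le> \<lfloor>x / \<delta>\<rfloor>" "\<lfloor>x / \<delta>\<rfloor> \<le> \<lfloor>M / \<delta>\<rfloor>"
      using x d by (intro floor_mono divide_right_mono; simp)+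
    then show "x \<in> \<Union>?\<C>" by (intro UnionI[of "{y. \<lfloor>y / \<delta>\<rfloor> = \<lfloor>x / \<delta>\<rfloor>}"]) auto
  qed
  moreover have "\<bar>x - y\<bar> \<le> \<delta>" if "\<lfloor>x / \<delta>\<rfloor> = \<lfloor>y / \<delta>\<rfloor>" for x y :: real
  proof -
    have "\<bar>x / \<delta> - y / \<delta>\<bar> \<le> 1" using that by linarith
    then have "\<bar>x - y\<bar> / \<delta> \<le> 1" using d by (simp add: diff_divide_distrib[symmetric])
    then show ?thesis using d by (simp add: field_simps)
  qed
  ultimately show ?thesis by (intro small_coverI[of ?\<C>]) auto
qed

lemma small_cover_bounded:
  assumes "0 < \<delta>" "\<And>a. a \<in> X \<Longrightarrow> \<bar>\<phi> a\<bar> \<le> M"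
  shows "small_cover X (\<lambda>a b. \<bar>\<phi> a - \<phi> b\<bar> \<le> (\<delta>::real))"
  using assms by (intro small_cover_pullback[OF small_cover_interval[of \<delta> M]]) (auto simp: abs_le_iff minus_le_iff)

lemma small_cover_net:
  assumes "small_cover X P"
  obtains F where "finite F" "F \<subseteq> X" "\<And>a. a \<in> X \<Longrightarrow> \<exists>b\<in>F. P a b"
proof -
  obtain \<C> where C0: "finite \<C> \<and> X \<subseteq> \<Union>\<C> \<and> (\<forall>S\<in>\<C>. \<forall>a\<in>S \<inter> X. \<forall>b\<in>S \<inter> X. P a b)"
    using assms[unfolded small_cover_def] by (rule exE)
  then have C: "finite \<C>" "X \<subseteq> \<Union>\<C>" by auto
  have P: "P a b" if "S \<in> \<C>" "a \<in> S" "b \<in> S" "a \<in> X" "b \<in> X" for S a b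
    using C0 that by blast
  let ?F = "(\<lambda>S. SOME a. a \<in> S \<inter> X) ` {S \<in> \<C>. S \<inter> X \<noteq> {}}"
  have some: "(SOME a. a \<in> S \<inter> X) \<in> S \<inter> X" if "S \<inter> X \<noteq> {}" for S
    using that by (metis some_in_eq)
  have "finite ?F" using C by auto
  moreover have "?F \<subseteq> X" using some by blast
  moreover have "\<exists>b\<in>?F. P a b" if "a \<in> X" for a
  proof -
    obtain S where S: "S \<in> \<C>" "a \<in> S" using C(2) \<open>a \<in> X\<close> by blast
    then have ne: "S \<inter> X \<noteq> {}" using that by blast
    then have "P a (SOME b. b \<in> S \<inter> X)" using P[of S] S that some[OF ne] by blast
    with S ne show ?thesis by blast
  qed
  ultimately show ?thesis using that by blast
qed

section \<open>A criterion for Lip-norms\<close>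

context ou
begin

text \<open>States agree on the unit, so the scalar \<open>c\<close> drops out of
  \<open>\<mu> a - \<nu> a\<close>, and a finite net modulo scalars controls the whole unit ball of
  \<open>L\<close>. Hence the metric is finite, and every metric ball contains a weak-star
  neighbourhood given by finitely many evaluations. Conversely, evaluation at any \<open>a\<close>
  is Lipschitz for the metric.\<close>

lemma
  assumes sn: "seminorm_on_ou A L" and unit: "L (ou_unit A) = 0"
    and cover: "\<And>\<epsilon>. \<epsilon> > 0 \<Longrightarrow> small_cover {a \<in> ou_carrier A. L a \<le> 1}
      (\<lambda>a b. \<exists>c. ou_within A \<epsilon> (a - b - c *\<^sub>R ou_unit A))"
  shows lip_normI: "lip_norm A L"
proof -
  let ?S = "state_space A"
  let ?X = "{a \<in> ou_carrier A. L a \<le> 1}"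
  let ?d = "\<lambda>\<mu> \<nu>. enn2real (rho A L \<mu> \<nu>)"
  have net: "\<exists>F. finite F \<and> F \<subseteq> ou_carrier A \<and>
      (\<forall>\<mu>\<in>?S. \<forall>\<nu>\<in>?S. \<forall>a\<in>?X. \<exists>b\<in>F. \<bar>\<mu> a - \<nu> a\<bar> \<le> \<bar>\<mu> b - \<nu> b\<bar> + 2 * \<epsilon>)"
    if e: "\<epsilon> > 0" for \<epsilon>
  proof -
    obtain F where F: "finite F" "F \<subseteq> ?X"
      and near: "\<And>a. a \<in> ?X \<Longrightarrow> \<exists>b\<in>F. \<exists>c. ou_within A \<epsilon> (a - b - c *\<^sub>R ou_unit A)"
      using small_cover_net[OF cover[OF e]] by metis
    have "\<exists>b\<in>F. \<bar>\<mu> a - \<nu> a\<bar> \<le> \<bar>\<mu> b - \<nu> b\<bar> + 2 * \<epsilon>"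
      if \<mu>: "\<mu> \<in> ?S" and \<nu>: "\<nu> \<in> ?S" and a: "a \<in> ?X" for \<mu> \<nu> a
    proof -
      obtain b c where b: "b \<in> F" and w: "ou_within A \<epsilon> (a - b - c *\<^sub>R ou_unit A)"
        using near[OF a] by auto
      have bc: "b \<in> ou_carrier A" using b F by auto
      have *: "\<tau> (a - b - c *\<^sub>R ou_unit A) = \<tau> a - \<tau> b - c" "\<bar>\<tau> (a - b - c *\<^sub>R ou_unit A)\<bar> \<le> \<epsilon>"
        if l: "\<tau> \<in> ?S" for \<tau>
      proof -
        have ac: "a \<in> ou_carrier A" using a by simp
        show "\<tau> (a - b - c *\<^sub>R ou_unit A) = \<tau> a - \<tau> b - c"
          using ac bc by (simp add: state_linear[OF l])
        show "\<bar>\<tau> (a - b - c *\<^sub>R ou_unit A)\<bar> \<le> \<epsilon>"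
          using ac bc e by (intro state_bound[OF l _ _ w]) auto
      qed
      have "\<bar>\<mu> a - \<nu> a\<bar> \<le> \<bar>\<mu> b - \<nu> b\<bar> + 2 * \<epsilon>"
        using *[OF \<mu>] *[OF \<nu>] by linarith
      with b show ?thesis by blast
    qed
    with F show ?thesis by (intro exI[of _ F]) auto
  qed
  have fin: "rho A L \<mu> \<nu> < \<infinity>" if \<mu>: "\<mu> \<in> ?S" and \<nu>: "\<nu> \<in> ?S" for \<mu> \<nu>
  proof -
    obtain F where F: "finite F" "F \<subseteq> ou_carrier A"
      and *: "\<And>a. a \<in> ?X \<Longrightarrow> \<exists>b\<in>F. \<bar>\<mu> a - \<nu> a\<bar> \<le> \<bar>\<mu> b - \<nu> b\<bar> + 2 * 1"
      using net[of 1] \<mu> \<nu> by (auto simp del: One_nat_def)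
    have "\<bar>\<mu> a - \<nu> a\<bar> \<le> (\<Sum>b\<in>F. \<bar>\<mu> b - \<nu> b\<bar>) + 2" if "a \<in> ?X" for a
    proof -
      obtain b where b: "b \<in> F" "\<bar>\<mu> a - \<nu> a\<bar> \<le> \<bar>\<mu> b - \<nu> b\<bar> + 2 * 1" using *[OF \<open>a \<in> ?X\<close>] by auto
      moreover have "\<bar>\<mu> b - \<nu> b\<bar> \<le> (\<Sum>b\<in>F. \<bar>\<mu> b - \<nu> b\<bar>)"
        using F b by (intro member_le_sum) auto
      ultimately show ?thesis by linarith
    qed
    then have "rho A L \<mu> \<nu> \<le> ennreal ((\<Sum>b\<in>F. \<bar>\<mu> b - \<nu> b\<bar>) + 2)"
      unfolding rho_def by (intro SUP_least ennreal_leI) auto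
    then show ?thesis by (simp add: le_less_trans)
  qed
  have d_upper: "\<bar>\<mu> a - \<nu> a\<bar> \<le> ?d \<mu> \<nu>" if "\<mu> \<in> ?S" "\<nu> \<in> ?S" "a \<in> ?X" for \<mu> \<nu> a
  proof -
    have "ennreal \<bar>\<mu> a - \<nu> a\<bar> \<le> rho A L \<mu> \<nu>" unfolding rho_def using that by (intro SUP_upper) auto
    from enn2real_mono[OF this] fin[OF that(1,2)] show ?thesis by simp
  qed
  have d_least: "?d \<mu> \<nu> \<le> x"
    if "\<mu> \<in> ?S" "\<nu> \<in> ?S" "0 \<le> x" "\<And>a. a \<in> ?X \<Longrightarrow> \<bar>\<mu> a - \<nu> a\<bar> \<le> x" for \<mu> \<nu> x
  proof -
    have "rho A L \<mu> \<nu> \<le> ennreal x" unfolding rho_def using that by (intro SUP_least ennreal_leI) auto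
    then show ?thesis using that(3) by (intro enn2real_leI)
  qed
  have L_nonneg: "0 \<le> L a" if "a \<in> ou_carrier A" for a
    using sn that by (simp add: seminorm_on_ou_def)
  \<comment> \<open>Dividing by \<open>L a + 1\<close> instead of \<open>L a\<close> includes the
    elements with \<open>L a = 0\<close> without a case distinction.\<close>
  have d_scale: "\<bar>\<mu> a - \<nu> a\<bar> \<le> (L a + 1) * ?d \<mu> \<nu>"
    if \<mu>: "\<mu> \<in> ?S" and \<nu>: "\<nu> \<in> ?S" and a: "a \<in> ou_carrier A" for \<mu> \<nu> a
  proof -
    have pos: "L a + 1 > 0" using L_nonneg[OF a] by simp
    let ?b = "(1 / (L a + 1)) *\<^sub>R a"
    have "L ?b = \<bar>1 / (L a + 1)\<bar> * L a"
      using sn a unfolding seminorm_on_ou_def by blast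
    also have "\<dots> \<le> 1" using pos by (simp add: field_simps)
    finally have "\<bar>\<mu> ?b - \<nu> ?b\<bar> \<le> ?d \<mu> \<nu>" using a by (intro d_upper \<mu> \<nu>) auto
    moreover have "\<mu> ?b - \<nu> ?b = (\<mu> a - \<nu> a) / (L a + 1)"
      using state_scale[OF \<mu> a] state_scale[OF \<nu> a] by (simp add: diff_divide_distrib)
    ultimately have "\<bar>(\<mu> a - \<nu> a) / (L a + 1)\<bar> \<le> ?d \<mu> \<nu>" by simp
    then have "\<bar>\<mu> a - \<nu> a\<bar> / (L a + 1) \<le> ?d \<mu> \<nu>" using pos by (simp add: abs_divide)
    then show ?thesis using pos by (simp add: pos_divide_le_eq mult.commute)
  qed
  have ms: "Metric_space ?S ?d"
  proof
    show "0 \<le> ?d \<mu> \<nu>" for \<mu> \<nu> by simp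
    show "?d \<mu> \<nu> = ?d \<nu> \<mu>" for \<mu> \<nu>
      by (simp add: rho_def abs_minus_commute)
    show "?d \<mu> \<nu> = 0 \<longleftrightarrow> \<mu> = \<nu>" if m: "\<mu> \<in> ?S" "\<nu> \<in> ?S" for \<mu> \<nu>
    proof
      assume 0: "?d \<mu> \<nu> = 0"
      have "\<mu> a = \<nu> a" if "a \<in> ou_carrier A" for a
        using d_scale[OF m that] by (simp add: 0)
      then show "\<mu> = \<nu>"
        using m by (intro extensionalityI[of _ "ou_carrier A"]) (auto simp: state_space_iff)
    next
      assume "\<mu> = \<nu>"
      then have "?d \<mu> \<nu> \<le> 0" using m by (intro d_least) auto
      then show "?d \<mu> \<nu> = 0" by (simp add: order_antisym)
    qed
    show "?d \<mu> \<tau> \<le> ?d \<mu> \<nu> + ?d \<nu> \<tau>" if m: "\<mu> \<in> ?S" "\<nu> \<in> ?S" "\<tau> \<in> ?S" for \<mu> \<nu> \<tau>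
    proof (rule d_least[OF m(1,3)])
      fix a assume "a \<in> ?X"
      then show "\<bar>\<mu> a - \<tau> a\<bar> \<le> ?d \<mu> \<nu> + ?d \<nu> \<tau>"
        using d_upper[OF m(1,2), of a] d_upper[OF m(2,3), of a] by linarith
    qed auto
  qed
  interpret M: Metric_space ?S ?d by (rule ms)
  have top: "topspace (product_topology (\<lambda>_. euclideanreal) (ou_carrier A)) = extensional (ou_carrier A)"
    by (simp add: PiE_def)
  have S_ext: "?S \<subseteq> extensional (ou_carrier A)" by (auto simp: state_space_iff)
  have eval_open: "openin M.mtopology {\<mu> \<in> ?S. \<mu> a \<in> V}" if a: "a \<in> ou_carrier A" and V: "open V" for a V
    unfolding M.openin_mtopology
  proof safe
    fix \<mu> assume \<mu>: "\<mu> \<in> ?S" "\<mu> a \<in> V"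
    obtain \<delta> where \<delta>: "\<delta> > 0" "\<And>x. \<bar>x - \<mu> a\<bar> < \<delta> \<Longrightarrow> x \<in> V"
      using V \<mu>(2) unfolding open_dist by (auto simp: dist_real_def)
    have pos: "L a + 1 > 0" using L_nonneg[OF a] by simp
    have "M.mball \<mu> (\<delta> / (L a + 1)) \<subseteq> {\<mu> \<in> ?S. \<mu> a \<in> V}"
    proof (clarsimp)
      fix \<nu> assume \<nu>: "\<nu> \<in> ?S" "?d \<mu> \<nu> < \<delta> / (L a + 1)"
      then have "(L a + 1) * ?d \<mu> \<nu> < \<delta>" using pos by (simp add: field_simps)
      with d_scale[OF \<mu>(1) \<nu>(1) a] show "\<nu> a \<in> V" by (intro \<delta>) (simp add: abs_minus_commute)
    qed
    with \<delta> pos show "\<exists>r>0. M.mball \<mu> r \<subseteq> {\<mu> \<in> ?S. \<mu> a \<in> V}"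
      by (intro exI[of _ "\<delta> / (L a + 1)"]) auto
  qed
  have 1: "openin M.mtopology U" if U: "openin (weak_star_topology A) U" for U
  proof -
    have "continuous_map M.mtopology (weak_star_topology A) (\<lambda>\<mu>. \<mu>)"
      unfolding weak_star_topology_def
    proof (subst continuous_map_in_subtopology, intro conjI)
      show "continuous_map M.mtopology (product_topology (\<lambda>_. euclideanreal) (ou_carrier A)) (\<lambda>\<mu>. \<mu>)"
        using S_ext eval_open
        by (subst continuous_map_componentwise) (auto simp: continuous_map_def)
    qed auto
    then have "openin M.mtopology {\<mu> \<in> topspace M.mtopology. \<mu> \<in> U}"
      using U by (auto simp: continuous_map_def)
    moreover have "U \<subseteq> ?S" using openin_subset[OF U] by (auto simp: weak_star_topology_def)
    then have "{\<mu> \<in> topspace M.mtopology. \<mu> \<in> U} = U" by auto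
    ultimately show ?thesis by simp
  qed
  have 2: "openin (weak_star_topology A) U" if U: "openin M.mtopology U" for U
  proof (subst openin_subopen, intro ballI)
    fix \<mu> assume "\<mu> \<in> U"
    then obtain r where r: "r > 0" "M.mball \<mu> r \<subseteq> U" and \<mu>: "\<mu> \<in> ?S"
      using U unfolding M.openin_mtopology by blast
    \<comment> \<open>The net costs \<open>2 * (r / 8)\<close> and the finitely many evaluations
      less than \<open>r / 4\<close>, so the distance is at most \<open>r / 2\<close>, strictly
      inside the ball.\<close>
    obtain F where F: "finite F" "F \<subseteq> ou_carrier A"
      and near: "\<And>\<nu> a. \<nu> \<in> ?S \<Longrightarrow> a \<in> ?X \<Longrightarrow> \<exists>b\<in>F. \<bar>\<mu> a - \<nu> a\<bar> \<le> \<bar>\<mu> b - \<nu> b\<bar> + 2 * (r / 8)"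
      using net[of "r / 8"] \<mu> r by auto
    let ?W = "\<lambda>b. {\<nu> \<in> ?S. \<nu> b \<in> ball (\<mu> b) (r / 4)}"
    let ?T = "?S \<inter> (\<Inter>b\<in>F. ?W b)"
    have "openin (weak_star_topology A) (?W b)" if "b \<in> F" for b
    proof -
      have "continuous_map (weak_star_topology A) euclideanreal (\<lambda>\<nu>. \<nu> b)"
        unfolding weak_star_topology_def using that F
        by (intro continuous_map_from_subtopology continuous_map_product_projection) auto
      then have "openin (weak_star_topology A)
          {\<nu> \<in> topspace (weak_star_topology A). \<nu> b \<in> ball (\<mu> b) (r / 4)}"
        by (auto simp: continuous_map_def simp del: mem_ball)
      moreover have "topspace (weak_star_topology A) = ?S"
        using S_ext top by (auto simp: weak_star_topology_def)
      ultimately show ?thesis by simp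
    qed
    moreover have topW: "topspace (weak_star_topology A) = ?S"
      using S_ext top by (auto simp: weak_star_topology_def)
    then have "openin (weak_star_topology A) ?S" using openin_topspace by metis
    ultimately have "openin (weak_star_topology A) ?T"
      using F(1) by (cases "F = {}") (auto intro!: openin_Int openin_INT2)
    moreover have "\<mu> \<in> ?T" using \<mu> r by auto
    moreover have "?T \<subseteq> U"
    proof
      fix \<nu> assume \<nu>: "\<nu> \<in> ?T"
      have "?d \<mu> \<nu> \<le> r / 2"
      proof (rule d_least)
        fix a assume "a \<in> ?X"
        then obtain b where "b \<in> F" "\<bar>\<mu> a - \<nu> a\<bar> \<le> \<bar>\<mu> b - \<nu> b\<bar> + 2 * (r / 8)"
          using near[of \<nu> a] \<nu> by auto
        with \<nu> show "\<bar>\<mu> a - \<nu> a\<bar> \<le> r / 2" by (fastforce simp: dist_real_def)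
      qed (use \<mu> \<nu> r in auto)
      then show "\<nu> \<in> U" using r \<mu> \<nu> by (intro subsetD[OF r(2)]) auto
    qed
    ultimately show "\<exists>T. openin (weak_star_topology A) T \<and> \<mu> \<in> T \<and> T \<subseteq> U" by blast
  qed
  have "M.mtopology = weak_star_topology A"
    using 1 2 by (auto simp: topology_eq)
  then show ?thesis
    using sn unit fin ms by (auto simp: lip_norm_def)
qed

end

section \<open>Bounding the quantum Gromov-Hausdorff distance by a retraction\<close>

lemma ou_within_sum:
  "ou_within (ou_sum A B) r x \<longleftrightarrow> ou_within A r (fst x) \<and> ou_within B r (snd x)"
  by (auto simp: ou_within_def ou_sum_def)

lemma order_unit_space_ou_sum:
  assumes "order_unit_space A" "order_unit_space B"
  shows "order_unit_space (ou_sum A B)"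
proof -
  interpret A: ou A by standard (rule assms)
  interpret B: ou B by standard (rule assms)
  have unit: "\<exists>r>0. ou_le A a (r *\<^sub>R ou_unit A) \<and> ou_le B b (r *\<^sub>R ou_unit B)"
    if ab: "a \<in> ou_carrier A" "b \<in> ou_carrier B" for a b
  proof -
    obtain r where r: "0 \<le> r" "ou_within A r a" using A.within_exists[OF ab(1)] by auto
    obtain s where s: "0 \<le> s" "ou_within B s b" using B.within_exists[OF ab(2)] by auto
    note rs = r s
    then have "ou_within A (r + s + 1) a" "ou_within B (r + s + 1) b"
      using A.within_mono[of a r "r + s + 1"] B.within_mono[of b s "r + s + 1"] ab by auto
    then show ?thesis using rs by (intro exI[of _ "r + s + 1"]) (auto simp: ou_within_def)
  qed
  have arch: "ou_le A a 0 \<and> ou_le B b 0"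
    if "a \<in> ou_carrier A" "b \<in> ou_carrier B"
      "\<forall>r>0. ou_le A a (r *\<^sub>R ou_unit A) \<and> ou_le B b (r *\<^sub>R ou_unit B)" for a b
    using that by (intro conjI A.archimedean B.archimedean) auto
  note [simp] = ou_sum_def
  show ?thesis
  proof (rule order_unit_spaceI)
    show "subspace (ou_carrier (ou_sum A B))"
      by (simp add: subspace_Times A.carrier_subspace B.carrier_subspace)
  next
    fix a b c assume "a \<in> ou_carrier (ou_sum A B)" "b \<in> ou_carrier (ou_sum A B)" "c \<in> ou_carrier (ou_sum A B)"
      "ou_le (ou_sum A B) a b" "ou_le (ou_sum A B) b c"
    then show "ou_le (ou_sum A B) a c"
      using A.le_trans[of "fst a" "fst b" "fst c"] B.le_trans[of "snd a" "snd b" "snd c"] by auto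
  next
    fix a assume "a \<in> ou_carrier (ou_sum A B)"
    then show "\<exists>r>0. ou_le (ou_sum A B) a (r *\<^sub>R ou_unit (ou_sum A B))"
      using unit[of "fst a" "snd a"] by auto
  next
    fix a assume "a \<in> ou_carrier (ou_sum A B)"
      "\<And>r. 0 < r \<Longrightarrow> ou_le (ou_sum A B) a (r *\<^sub>R ou_unit (ou_sum A B))"
    then show "ou_le (ou_sum A B) a 0"
      using arch[of "fst a" "snd a"] by auto
  qed (auto intro: A.le_refl B.le_refl A.le_antisym B.le_antisym
      A.le_add_right B.le_add_right A.le_scale B.le_scale)
qed

text \<open>\<open>LB_p\<close> and \<open>LA_s\<close> make the infima in the quotient conditions
  attained; \<open>s_within\<close> and \<open>p_within\<close> make states pull back along
  \<open>s\<close> and \<open>p\<close>. The state of \<open>B\<close> whose existence is required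
  serves as a reference functional for comparing scalars.\<close>

locale ou_retraction = A: ou A + B: ou B
  for A :: "('a::real_vector) ou_space" and B :: "('b::real_vector) ou_space" +
  fixes s :: "'b \<Rightarrow> 'a" and p :: "'a \<Rightarrow> 'b"
    and LA :: "'a \<Rightarrow> real" and LB :: "'b \<Rightarrow> real"
  assumes s_carrier [simp]: "b \<in> ou_carrier B \<Longrightarrow> s b \<in> ou_carrier A"
    and s_add: "b \<in> ou_carrier B \<Longrightarrow> b' \<in> ou_carrier B \<Longrightarrow> s (b + b') = s b + s b'"
    and s_scale: "b \<in> ou_carrier B \<Longrightarrow> s (r *\<^sub>R b) = r *\<^sub>R s b"
    and s_unit: "s (ou_unit B) = ou_unit A"
    and s_within: "b \<in> ou_carrier B \<Longrightarrow> ou_within B r b \<Longrightarrow> ou_within A r (s b)"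
    and p_carrier [simp]: "a \<in> ou_carrier A \<Longrightarrow> p a \<in> ou_carrier B"
    and p_add: "a \<in> ou_carrier A \<Longrightarrow> a' \<in> ou_carrier A \<Longrightarrow> p (a + a') = p a + p a'"
    and p_scale: "a \<in> ou_carrier A \<Longrightarrow> p (r *\<^sub>R a) = r *\<^sub>R p a"
    and p_unit: "p (ou_unit A) = ou_unit B"
    and p_within: "a \<in> ou_carrier A \<Longrightarrow> ou_within A r a \<Longrightarrow> ou_within B r (p a)"
    and p_s: "b \<in> ou_carrier B \<Longrightarrow> p (s b) = b"
    and LA: "seminorm_on_ou A LA" and LB: "seminorm_on_ou B LB"
    and LA_unit: "LA (ou_unit A) = 0" and LB_unit: "LB (ou_unit B) = 0"
    and LB_p: "a \<in> ou_carrier A \<Longrightarrow> LB (p a) \<le> LA a"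
    and LA_s: "b \<in> ou_carrier B \<Longrightarrow> LA (s b) = LB b"
    and coverA: "\<epsilon> > 0 \<Longrightarrow> small_cover {a \<in> ou_carrier A. LA a \<le> 1}
      (\<lambda>a b. \<exists>c. ou_within A \<epsilon> (a - b - c *\<^sub>R ou_unit A))"
    and coverB: "\<epsilon> > 0 \<Longrightarrow> small_cover {a \<in> ou_carrier B. LB a \<le> 1}
      (\<lambda>a b. \<exists>c. ou_within B \<epsilon> (a - b - c *\<^sub>R ou_unit B))"
    and states_nonempty: "state_space B \<noteq> {}"
begin

lemma s_diff: "b \<in> ou_carrier B \<Longrightarrow> b' \<in> ou_carrier B \<Longrightarrow> s (b - b') = s b - s b'"
  using s_add[of b "(-1) *\<^sub>R b'"] s_scale[of b' "-1"] by simp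

lemma p_diff: "a \<in> ou_carrier A \<Longrightarrow> a' \<in> ou_carrier A \<Longrightarrow> p (a - a') = p a - p a'"
  using p_add[of a "(-1) *\<^sub>R a'"] p_scale[of a' "-1"] by simp

lemma seminormA:
  "a \<in> ou_carrier A \<Longrightarrow> 0 \<le> LA a"
  "a \<in> ou_carrier A \<Longrightarrow> a' \<in> ou_carrier A \<Longrightarrow> LA (a + a') \<le> LA a + LA a'"
  "a \<in> ou_carrier A \<Longrightarrow> LA (r *\<^sub>R a) = \<bar>r\<bar> * LA a"
  using LA unfolding seminorm_on_ou_def by blast+

lemma seminormB:
  "a \<in> ou_carrier B \<Longrightarrow> 0 \<le> LB a"
  "a \<in> ou_carrier B \<Longrightarrow> a' \<in> ou_carrier B \<Longrightarrow> LB (a + a') \<le> LB a + LB a'"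
  "a \<in> ou_carrier B \<Longrightarrow> LB (r *\<^sub>R a) = \<bar>r\<bar> * LB a"
  using LB unfolding seminorm_on_ou_def by blast+

definition bridge :: "real \<Rightarrow> 'a \<times> 'b \<Rightarrow> real" where
  "bridge \<gamma> x = max (LA (fst x)) (max (LB (snd x)) (ou_norm B (p (fst x) - snd x) / \<gamma>))"

lemma bridge_le:
  assumes "\<gamma> > 0"
  shows "bridge \<gamma> (a, b) \<le> r \<longleftrightarrow> LA a \<le> r \<and> LB b \<le> r \<and> ou_norm B (p a - b) \<le> \<gamma> * r"
  using assms by (simp add: bridge_def pos_divide_le_eq mult.commute)

lemma bridge_seminorm:
  assumes \<gamma>: "\<gamma> > 0"
  shows "seminorm_on_ou (ou_sum A B) (bridge \<gamma>)"
proof -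
  have "0 \<le> bridge \<gamma> (a, b)" if "a \<in> ou_carrier A" "b \<in> ou_carrier B" for a b
    using seminormA(1)[OF that(1)] by (simp add: bridge_def)
  moreover have "bridge \<gamma> (a + a', b + b') \<le> bridge \<gamma> (a, b) + bridge \<gamma> (a', b')"
    if ab: "a \<in> ou_carrier A" "b \<in> ou_carrier B" "a' \<in> ou_carrier A" "b' \<in> ou_carrier B" for a a' b b'
  proof -
    let ?r = "bridge \<gamma> (a, b)" and ?r' = "bridge \<gamma> (a', b')"
    have 1: "LA a \<le> ?r" "LB b \<le> ?r" "ou_norm B (p a - b) \<le> \<gamma> * ?r"
      using bridge_le[OF \<gamma>, of a b ?r] by auto
    have 2: "LA a' \<le> ?r'" "LB b' \<le> ?r'" "ou_norm B (p a' - b') \<le> \<gamma> * ?r'"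
      using bridge_le[OF \<gamma>, of a' b' ?r'] by auto
    have eq: "p (a + a') - (b + b') = (p a - b) + (p a' - b')"
      using ab by (simp add: p_add)
    have 3: "ou_norm B (p (a + a') - (b + b')) \<le> ou_norm B (p a - b) + ou_norm B (p a' - b')"
      unfolding eq using ab by (intro B.ou_norm_triangle) auto
    show ?thesis unfolding bridge_le[OF \<gamma>]
      using 1 2 3 seminormA(2)[of a a'] seminormB(2)[of b b'] ab by (simp add: distrib_left)
  qed
  moreover have "bridge \<gamma> (r *\<^sub>R a, r *\<^sub>R b) = \<bar>r\<bar> * bridge \<gamma> (a, b)"
    if ab: "a \<in> ou_carrier A" "b \<in> ou_carrier B" for a b r
  proof -
    have "p (r *\<^sub>R a) - r *\<^sub>R b = r *\<^sub>R (p a - b)"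
      using ab by (simp add: p_scale scaleR_diff_right)
    then show ?thesis
      using ab B.ou_norm_scale[of "p a - b" r]
      by (simp add: bridge_def seminormA(3) seminormB(3) max_mult_distrib_left)
  qed
  ultimately show ?thesis unfolding seminorm_on_ou_def by (auto simp: ou_sum_def)
qed

text \<open>The covers of the two summands come with separate scalars \<open>c\<close> and
  \<open>c'\<close>, but the sum space has a single unit. The bridge term bounds
  \<open>p a - b\<close>, so the value of a fixed state of \<open>B\<close> on it ranges over a
  bounded interval. A third cover by these values forces \<open>c\<close> and \<open>c'\<close> to
  differ by at most three quarters of \<open>\<epsilon>\<close>.\<close>

lemma bridge_lip_norm:
  assumes \<gamma>: "\<gamma> > 0"
  shows "lip_norm (ou_sum A B) (bridge \<gamma>)"
proof -
  interpret S: ou "ou_sum A B"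
    by standard (intro order_unit_space_ou_sum A.ou B.ou)
  obtain \<nu> where \<nu>: "\<nu> \<in> state_space B" using states_nonempty by auto
  have unit: "ou_unit (ou_sum A B) = (ou_unit A, ou_unit B)"
    and car: "ou_carrier (ou_sum A B) = ou_carrier A \<times> ou_carrier B" by (auto simp: ou_sum_def)
  show ?thesis
  proof (rule S.lip_normI)
    show "seminorm_on_ou (ou_sum A B) (bridge \<gamma>)" using \<gamma> by (rule bridge_seminorm)
    show "bridge \<gamma> (ou_unit (ou_sum A B)) = 0"
      by (simp add: bridge_def unit LA_unit LB_unit p_unit B.ou_norm_0)
    fix \<epsilon> :: real assume \<epsilon>: "\<epsilon> > 0"
    let ?X = "{x \<in> ou_carrier (ou_sum A B). bridge \<gamma> x \<le> 1}"
    have X: "fst x \<in> ou_carrier A" "snd x \<in> ou_carrier B" "LA (fst x) \<le> 1" "LB (snd x) \<le> 1"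
      "ou_norm B (p (fst x) - snd x) \<le> \<gamma>" if "x \<in> ?X" for x
      using that bridge_le[OF \<gamma>, of "fst x" "snd x" 1] by (auto simp: car)
    let ?\<phi> = "\<lambda>x. \<nu> (p (fst x) - snd x)"
    have 1: "small_cover ?X (\<lambda>x y. \<exists>c. ou_within A (\<epsilon> / 4) (fst x - fst y - c *\<^sub>R ou_unit A))"
      using \<epsilon> X by (intro small_cover_pullback[OF coverA]) auto
    have 2: "small_cover ?X (\<lambda>x y. \<exists>c. ou_within B (\<epsilon> / 4) (snd x - snd y - c *\<^sub>R ou_unit B))"
      using \<epsilon> X by (intro small_cover_pullback[OF coverB]) auto
    have 3: "small_cover ?X (\<lambda>x y. \<bar>?\<phi> x - ?\<phi> y\<bar> \<le> \<epsilon> / 4)"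
    proof (rule small_cover_bounded)
      fix x assume x: "x \<in> ?X"
      have "ou_within B (2 * \<gamma>) (p (fst x) - snd x)"
        using X[OF x] \<gamma> by (intro B.ou_norm_less_within) auto
      then show "\<bar>?\<phi> x\<bar> \<le> 2 * \<gamma>" using X[OF x] \<gamma> by (intro B.state_bound[OF \<nu>]) auto
    qed (use \<epsilon> in auto)
    show "small_cover ?X (\<lambda>x y. \<exists>c. ou_within (ou_sum A B) \<epsilon> (x - y - c *\<^sub>R ou_unit (ou_sum A B)))"
    proof (rule small_cover_mono[OF small_cover_conj[OF small_cover_conj[OF 1 2] 3]])
      fix x y assume x: "x \<in> ?X" and y: "y \<in> ?X"
        and *: "((\<exists>c. ou_within A (\<epsilon> / 4) (fst x - fst y - c *\<^sub>R ou_unit A)) \<and>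
          (\<exists>c. ou_within B (\<epsilon> / 4) (snd x - snd y - c *\<^sub>R ou_unit B))) \<and>
          \<bar>?\<phi> x - ?\<phi> y\<bar> \<le> \<epsilon> / 4"
      obtain c c' where c: "ou_within A (\<epsilon> / 4) (fst x - fst y - c *\<^sub>R ou_unit A)"
        and c': "ou_within B (\<epsilon> / 4) (snd x - snd y - c' *\<^sub>R ou_unit B)"
        and phi: "\<bar>?\<phi> x - ?\<phi> y\<bar> \<le> \<epsilon> / 4" using * by blast
      note xy = X(1,2)[OF x] X(1,2)[OF y]
      \<comment> \<open>The estimate in \<open>A\<close> is moved to \<open>B\<close>, where the
        same state reads off both scalars.\<close>
      have "ou_within B (\<epsilon> / 4) (p (fst x - fst y - c *\<^sub>R ou_unit A))"
        using xy c by (intro p_within) auto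
      then have pc: "ou_within B (\<epsilon> / 4) (p (fst x) - p (fst y) - c *\<^sub>R ou_unit B)"
        using xy by (simp add: p_diff p_scale p_unit)
      have "\<bar>\<nu> (p (fst x) - p (fst y) - c *\<^sub>R ou_unit B)\<bar> \<le> \<epsilon> / 4"
        "\<bar>\<nu> (snd x - snd y - c' *\<^sub>R ou_unit B)\<bar> \<le> \<epsilon> / 4"
        using xy \<epsilon> by (intro B.state_bound[OF \<nu>] pc c'; simp)+
      then have "\<bar>\<nu> (p (fst x)) - \<nu> (p (fst y)) - c\<bar> \<le> \<epsilon> / 4" "\<bar>\<nu> (snd x) - \<nu> (snd y) - c'\<bar> \<le> \<epsilon> / 4"
        using xy by (simp_all add: B.state_linear[OF \<nu>])
      moreover have "\<bar>\<nu> (p (fst x)) - \<nu> (snd x) - (\<nu> (p (fst y)) - \<nu> (snd y))\<bar> \<le> \<epsilon> / 4"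
        using phi xy by (simp add: B.state_linear[OF \<nu>])
      ultimately have "\<bar>c' - c\<bar> \<le> 3 * (\<epsilon> / 4)" by linarith
      then have "ou_within B (3 * (\<epsilon> / 4)) ((c' - c) *\<^sub>R ou_unit B)"
        by (intro B.within_mono[OF _ B.within_unit]) simp_all
      from B.within_add[OF _ _ c' this] have "ou_within B \<epsilon> (snd x - snd y - c *\<^sub>R ou_unit B)"
        using xy by (simp add: scaleR_diff_left)
      moreover have "ou_within A \<epsilon> (fst x - fst y - c *\<^sub>R ou_unit A)"
        using xy \<epsilon> by (intro A.within_mono[OF _ c]) simp_all
      ultimately show "\<exists>c. ou_within (ou_sum A B) \<epsilon> (x - y - c *\<^sub>R ou_unit (ou_sum A B))"
        by (intro exI[of _ c]) (simp add: ou_within_sum unit)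
    qed
  qed
qed

text \<open>Both infima are minima: the bridge term vanishes at \<open>b = p a\<close> and at
  \<open>a = s b\<close>, and there the seminorm of the new component does not exceed the given
  one.\<close>

lemma bridge_admissible:
  assumes \<gamma>: "\<gamma> > 0"
  shows "bridge \<gamma> \<in> admissible_lip_norms A LA B LB"
proof -
  have "LA a = (INF b\<in>ou_carrier B. bridge \<gamma> (a, b))" if a: "a \<in> ou_carrier A" for a
  proof (rule sym, rule cInf_eq_minimum)
    have "bridge \<gamma> (a, p a) = LA a"
      using LB_p[OF a] seminormA(1)[OF a] by (simp add: bridge_def B.ou_norm_0)
    then show "LA a \<in> (\<lambda>b. bridge \<gamma> (a, b)) ` ou_carrier B" using a by (intro image_eqI[of _ _ "p a"]) auto
  qed (auto simp: bridge_def)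
  moreover have "LB b = (INF a\<in>ou_carrier A. bridge \<gamma> (a, b))" if b: "b \<in> ou_carrier B" for b
  proof (rule sym, rule cInf_eq_minimum)
    have "bridge \<gamma> (s b, b) = LB b"
      using LA_s[OF b] seminormB(1)[OF b] by (simp add: bridge_def p_s[OF b] B.ou_norm_0)
    then show "LB b \<in> (\<lambda>a. bridge \<gamma> (a, b)) ` ou_carrier A" using b by (intro image_eqI[of _ _ "s b"]) auto
  qed (auto simp: bridge_def)
  ultimately show ?thesis
    using bridge_lip_norm[OF \<gamma>] by (auto simp: admissible_lip_norms_def)
qed

lemma state_pullback_s:
  assumes \<mu>: "\<mu> \<in> state_space A"
  shows "restrict (\<lambda>b. \<mu> (s b)) (ou_carrier B) \<in> state_space B"
  unfolding B.state_space_iff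
  using s_within by (auto simp: s_add s_scale s_unit A.state_linear[OF \<mu>] intro: A.state_bound[OF \<mu>])

lemma state_pullback_p:
  assumes \<nu>: "\<nu> \<in> state_space B"
  shows "restrict (\<lambda>a. \<nu> (p a)) (ou_carrier A) \<in> state_space A"
  unfolding A.state_space_iff
  using p_within by (auto simp: p_add p_scale p_unit B.state_linear[OF \<nu>] intro: B.state_bound[OF \<nu>])

lemma rho_bridge_le:
  assumes \<gamma>: "\<gamma> > 0"
    and "\<And>a b. a \<in> ou_carrier A \<Longrightarrow> b \<in> ou_carrier B \<Longrightarrow> LA a \<le> 1 \<Longrightarrow>
      ou_within B (2 * \<gamma>) (p a - b) \<Longrightarrow> \<bar>\<mu> a - \<nu> b\<bar> \<le> x"
  shows "rho (ou_sum A B) (bridge \<gamma>) (embed_fst A B \<mu>) (embed_snd A B \<nu>) \<le> ennreal x"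
  unfolding rho_def
proof (intro SUP_least ennreal_leI)
  fix y assume y: "y \<in> {y \<in> ou_carrier (ou_sum A B). bridge \<gamma> y \<le> 1}"
  then have c: "fst y \<in> ou_carrier A" "snd y \<in> ou_carrier B" by (auto simp: ou_sum_def)
  have "LA (fst y) \<le> 1" "ou_norm B (p (fst y) - snd y) \<le> \<gamma>"
    using y bridge_le[OF \<gamma>, of "fst y" "snd y" 1] by auto
  moreover from this have "ou_within B (2 * \<gamma>) (p (fst y) - snd y)"
    using c \<gamma> by (intro B.ou_norm_less_within) auto
  ultimately have "\<bar>\<mu> (fst y) - \<nu> (snd y)\<bar> \<le> x" using assms(2) c by blast
  then show "\<bar>embed_fst A B \<mu> y - embed_snd A B \<nu> y\<bar> \<le> x"
    using c by (cases y) (simp add: embed_fst_def embed_snd_def)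
qed

text \<open>A state \<open>\<mu>\<close> of \<open>A\<close> is paired with its pullback along
  \<open>s\<close>: the difference \<open>a - s b\<close> is the sum of \<open>a - s (p a)\<close>,
  bounded by \<open>C\<close>, and \<open>s (p a - b)\<close>, bounded by twice the bridge
  parameter. A state of \<open>B\<close> is paired with its pullback along \<open>p\<close>, where
  only the second error occurs.\<close>

theorem dist_q_le:
  assumes C: "0 \<le> C"
    and near: "\<And>a. a \<in> ou_carrier A \<Longrightarrow> LA a \<le> 1 \<Longrightarrow> ou_within A C (a - s (p a))"
  shows "dist_q A LA B LB \<le> ennreal C"
proof (rule ennreal_le_epsilon)
  fix e :: real assume e: "e > 0"
  let ?\<gamma> = "e / 2"
  let ?rho = "rho (ou_sum A B) (bridge ?\<gamma>)"
  have \<gamma>: "?\<gamma> > 0" using e by simp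
  have 1: "(INF y\<in>embed_snd A B ` state_space B. ?rho (embed_fst A B \<mu>) y) \<le> ennreal (C + e)"
    if \<mu>: "\<mu> \<in> state_space A" for \<mu>
  proof (rule INF_lower2[OF imageI[OF state_pullback_s[OF \<mu>]]], rule rho_bridge_le[OF \<gamma>])
    fix a b assume ab: "a \<in> ou_carrier A" "b \<in> ou_carrier B" "LA a \<le> 1" "ou_within B (2 * ?\<gamma>) (p a - b)"
    have "ou_within A e (s (p a - b))"
      using ab by (intro s_within) auto
    from A.within_add[OF _ _ near[OF ab(1,3)] this] have "ou_within A (C + e) (a - s b)"
      using ab by (simp add: s_diff)
    then have "\<bar>\<mu> (a - s b)\<bar> \<le> C + e"
      using ab C e by (intro A.state_bound[OF \<mu>]) auto
    then show "\<bar>\<mu> a - restrict (\<lambda>b. \<mu> (s b)) (ou_carrier B) b\<bar> \<le> C + e"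
      using ab by (simp add: A.state_linear[OF \<mu>])
  qed
  have 2: "(INF x\<in>embed_fst A B ` state_space A. ?rho x (embed_snd A B \<nu>)) \<le> ennreal (C + e)"
    if \<nu>: "\<nu> \<in> state_space B" for \<nu>
  proof (rule INF_lower2[OF imageI[OF state_pullback_p[OF \<nu>]]], rule rho_bridge_le[OF \<gamma>])
    fix a b assume ab: "a \<in> ou_carrier A" "b \<in> ou_carrier B" "LA a \<le> 1" "ou_within B (2 * ?\<gamma>) (p a - b)"
    then have "\<bar>\<nu> (p a - b)\<bar> \<le> e"
      using e by (intro B.state_bound[OF \<nu>]) auto
    then show "\<bar>restrict (\<lambda>a. \<nu> (p a)) (ou_carrier A) a - \<nu> b\<bar> \<le> C + e"
      using ab C by (simp add: B.state_linear[OF \<nu>])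
  qed
  have "dist_q A LA B LB \<le> hausdorff_dist ?rho
      (embed_fst A B ` state_space A) (embed_snd A B ` state_space B)"
    unfolding dist_q_def by (intro INF_lower bridge_admissible \<gamma>)
  also have "\<dots> \<le> ennreal (C + e)"
    unfolding hausdorff_dist_def using 1 2 by (intro max.boundedI SUP_least) auto
  also have "\<dots> = ennreal C + ennreal e" using C e by (simp add: ennreal_plus)
  finally show "dist_q A LA B LB \<le> ennreal C + ennreal e" .
qed

theorem lip_norms: "lip_norm A LA" "lip_norm B LB"
  using A.lip_normI[OF LA LA_unit coverA] B.lip_normI[OF LB LB_unit coverB] by auto

end

section \<open>Lebesgue measure: isometries, coordinates, radial integrals\<close>

lemma nn_integral_lborel_translate:
  fixes c :: "'a::euclidean_space"
  assumes [measurable]: "f \<in> borel_measurable borel"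
  shows "(\<integral>\<^sup>+x. f (c + x) \<partial>lborel) = (\<integral>\<^sup>+x. f x \<partial>lborel)"
proof -
  have "(\<integral>\<^sup>+x. f x \<partial>lborel) = (\<integral>\<^sup>+x. f x \<partial>distr lborel borel ((+) c))"
    by (simp add: lborel_distr_plus)
  also have "\<dots> = (\<integral>\<^sup>+x. f (c + x) \<partial>lborel)"
    by (subst nn_integral_distr) auto
  finally show ?thesis by simp
qed

text \<open>
  The unit ball is invariant under the isometry \<open>U\<close>. Computing
  \<open>\<integral>\<integral> f (x + U y) 1\<^sub>B (U y) dx dy\<close> in both orders cancels the volume of the ball, in the manner of
  the uniqueness proof for Haar measure.
\<close>

lemma nn_integral_lborel_isometry:
  fixes U :: "'a::euclidean_space \<Rightarrow> 'a"
  assumes lin: "linear U" and norm: "\<And>x. norm (U x) = norm x"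
    and [measurable]: "f \<in> borel_measurable borel"
  shows "(\<integral>\<^sup>+x. f (U x) \<partial>lborel) = (\<integral>\<^sup>+x. f x \<partial>lborel)"
proof -
  define B where "B = ball (0::'a) 1"
  have [measurable]: "B \<in> sets borel" by (simp add: B_def)
  have [measurable]: "U \<in> borel_measurable borel"
    using lin by (simp add: linear_continuous_on borel_measurable_continuous_onI linear_linear)
  have "inj U" using norm by (intro iffD2[OF linear_injective_0[OF lin]]) (metis norm_eq_zero)
  then have "surj U" by (rule linear_inj_imp_surj[OF lin])
  then obtain V where V: "\<And>x. U (V x) = x" by (metis surj_def)
  define v where "v = emeasure lborel B"
  have v: "v \<noteq> 0" "v \<noteq> \<infinity>" using unit_ball_vol_pos[of "DIM('a)"] by (auto simp: v_def B_def emeasure_ball simp del: unit_ball_vol_pos)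
  have BU: "indicator B (U y) = (indicator B y :: ennreal)" for y
    by (simp add: B_def indicator_def norm)
  have vint: "(\<integral>\<^sup>+x. indicator B (c - x) \<partial>lborel) = v" for c :: 'a
  proof -
    have "(\<integral>\<^sup>+x. indicator B (c - x) \<partial>lborel) = (\<integral>\<^sup>+x. indicator (ball c 1) x \<partial>lborel)"
      by (intro nn_integral_cong) (simp add: B_def indicator_def dist_norm norm_minus_commute)
    then show ?thesis by (simp add: v_def B_def emeasure_ball)
  qed
  have "v * (\<integral>\<^sup>+x. f x \<partial>lborel) = (\<integral>\<^sup>+y. indicator B (U y) * (\<integral>\<^sup>+x. f x \<partial>lborel) \<partial>lborel)"
    by (simp add: BU v_def nn_integral_multc)
  also have "\<dots> = (\<integral>\<^sup>+y. (\<integral>\<^sup>+x. indicator B (U y) * f (U y + x) \<partial>lborel) \<partial>lborel)"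
    by (simp add: nn_integral_cmult nn_integral_lborel_translate)
  also have "\<dots> = (\<integral>\<^sup>+x. (\<integral>\<^sup>+y. indicator B (U y) * f (U y + x) \<partial>lborel) \<partial>lborel)"
    by (rule lborel_pair.Fubini') measurable
  \<comment> \<open>Shifting \<open>y\<close> by \<open>- V x\<close> turns \<open>U y\<close> into
    \<open>U y - x\<close>, because \<open>U (V x) = x\<close>.\<close>
  also have "\<dots> = (\<integral>\<^sup>+x. (\<integral>\<^sup>+y. indicator B (U y - x) * f (U y) \<partial>lborel) \<partial>lborel)"
  proof (rule nn_integral_cong)
    fix x :: 'a
    have "(\<integral>\<^sup>+y. indicator B (U y) * f (U y + x) \<partial>lborel)
        = (\<integral>\<^sup>+y. indicator B (U (- V x + y)) * f (U (- V x + y) + x) \<partial>lborel)"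
      by (rule nn_integral_lborel_translate[symmetric]) measurable
    then show "(\<integral>\<^sup>+y. indicator B (U y) * f (U y + x) \<partial>lborel) = (\<integral>\<^sup>+y. indicator B (U y - x) * f (U y) \<partial>lborel)"
      by (simp add: linear_add[OF lin] linear_neg[OF lin] linear_diff[OF lin] V algebra_simps)
  qed
  also have "\<dots> = (\<integral>\<^sup>+y. (\<integral>\<^sup>+x. indicator B (U y - x) * f (U y) \<partial>lborel) \<partial>lborel)"
    by (rule lborel_pair.Fubini') measurable
  also have "\<dots> = (\<integral>\<^sup>+y. v * f (U y) \<partial>lborel)"
    by (simp add: nn_integral_multc vint)
  also have "\<dots> = v * (\<integral>\<^sup>+y. f (U y) \<partial>lborel)"
    by (simp add: nn_integral_cmult)
  finally show ?thesis using v by (simp add: ennreal_mult_cancel_left)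
qed

lemma measurable_vec_lambda_PiM:
  "(\<lambda>f. \<chi> i. f i) \<in> (\<Pi>\<^sub>M i\<in>(UNIV::'d::finite set). (borel :: 'a::euclidean_space measure)) \<rightarrow>\<^sub>M borel"
proof (rule iffD2[OF borel_measurable_euclidean_space], rule ballI)
  fix b :: "'a ^ 'd" assume "b \<in> Basis"
  then obtain i u where b: "b = axis i u" by (auto simp: Basis_vec_def)
  have "(\<lambda>f. f i) \<in> (\<Pi>\<^sub>M i\<in>(UNIV::'d set). (borel :: 'a measure)) \<rightarrow>\<^sub>M borel"
    by (rule measurable_component_singleton) simp
  then show "(\<lambda>f. (\<chi> i. f i) \<bullet> b) \<in> borel_measurable (\<Pi>\<^sub>M i\<in>(UNIV::'d set). (borel :: 'a measure))"
    by (simp add: b inner_axis borel_measurable_inner)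
qed

text \<open>Lebesgue measure is determined by its values on boxes. The basis of the vector space
  consists of the vectors \<open>axis i b\<close>, so its boxes are products of boxes in the factors
  and the volumes multiply.\<close>

lemma lborel_vec:
  "(lborel :: ('a::euclidean_space ^ 'd::finite) measure) =
    distr (\<Pi>\<^sub>M i\<in>(UNIV::'d set). (lborel :: 'a measure)) borel (\<lambda>f. \<chi> i. f i)"
proof (rule lborel_eqI)
  interpret product_sigma_finite "\<lambda>_::'d. lborel :: 'a measure" by standard
  have meas: "(\<lambda>f. \<chi> i. f i) \<in> (\<Pi>\<^sub>M i\<in>(UNIV::'d set). (lborel :: 'a measure)) \<rightarrow>\<^sub>M borel"
    using measurable_vec_lambda_PiM by (simp cong: measurable_cong_sets sets_PiM_cong)
  fix l u :: "'a ^ 'd" assume le: "\<And>b. b \<in> Basis \<Longrightarrow> l \<bullet> b \<le> u \<bullet> b"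
  have le': "l $ i \<bullet> b \<le> u $ i \<bullet> b" if "b \<in> Basis" for i b
    using le[of "axis i b"] that by (simp add: axis_in_Basis_iff inner_axis)
  have box: "(\<lambda>f. \<chi> i. f i) -` box l u \<inter> space (\<Pi>\<^sub>M i\<in>(UNIV::'d set). (lborel :: 'a measure))
      = (\<Pi>\<^sub>E i\<in>UNIV. box (l $ i) (u $ i))"
    by (auto simp: space_PiM mem_box Basis_vec_def inner_axis PiE_iff)
  have Bas: "(Basis :: ('a ^ 'd) set) = (\<lambda>(i, b). axis i b) ` (UNIV \<times> Basis)"
    by (auto simp: Basis_vec_def)
  have inj: "inj_on (\<lambda>(i, b). axis i b :: 'a ^ 'd) (UNIV \<times> Basis)"
    by (auto simp: inj_on_def axis_eq_axis)
  have "emeasure (distr (\<Pi>\<^sub>M i\<in>(UNIV::'d set). (lborel :: 'a measure)) borel (\<lambda>f. \<chi> i. f i)) (box l u)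
      = emeasure (\<Pi>\<^sub>M i\<in>(UNIV::'d set). (lborel :: 'a measure)) (\<Pi>\<^sub>E i\<in>UNIV. box (l $ i) (u $ i))"
    by (subst emeasure_distr[OF meas]) (simp_all add: box)
  also have "\<dots> = (\<Prod>i\<in>UNIV. emeasure lborel (box (l $ i) (u $ i)))"
    by (rule emeasure_PiM) auto
  also have "\<dots> = (\<Prod>i\<in>UNIV. ennreal (\<Prod>b\<in>Basis. (u $ i - l $ i) \<bullet> b))"
    using le' by (simp add: emeasure_lborel_box)
  also have "\<dots> = ennreal (\<Prod>i\<in>UNIV. \<Prod>b\<in>Basis. (u $ i - l $ i) \<bullet> b)"
    using le' by (intro prod_ennreal prod_nonneg) (simp add: inner_diff_left)
  also have "(\<Prod>i\<in>UNIV. \<Prod>b\<in>Basis. (u $ i - l $ i) \<bullet> b) = (\<Prod>b\<in>Basis. (u - l) \<bullet> b)"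
    unfolding Bas by (subst prod.reindex[OF inj]) (simp add: prod.cartesian_product inner_axis case_prod_unfold)
  finally show "emeasure (distr (\<Pi>\<^sub>M i\<in>(UNIV::'d set). (lborel :: 'a measure)) borel (\<lambda>f. \<chi> i. f i)) (box l u)
      = ennreal (\<Prod>b\<in>Basis. (u - l) \<bullet> b)" .
qed simp

lemma nn_integral_lborel_vec_prod:
  fixes f :: "'d::finite \<Rightarrow> 'a::euclidean_space \<Rightarrow> ennreal"
  assumes [measurable]: "\<And>i. f i \<in> borel_measurable borel"
  shows "(\<integral>\<^sup>+z. (\<Prod>i\<in>UNIV. f i (z $ i)) \<partial>lborel) = (\<Prod>i\<in>UNIV. \<integral>\<^sup>+x. f i x \<partial>lborel)"
proof -
  interpret product_sigma_finite "\<lambda>_::'d. lborel :: 'a measure" by standard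
  have [measurable]: "(\<lambda>z::'a ^ 'd. z $ i) \<in> borel_measurable borel" for i
    by (intro borel_measurable_continuous_onI continuous_intros)
  have meas: "(\<lambda>f. \<chi> i. f i) \<in> (\<Pi>\<^sub>M i\<in>(UNIV::'d set). (lborel :: 'a measure)) \<rightarrow>\<^sub>M borel"
    using measurable_vec_lambda_PiM by (simp cong: measurable_cong_sets sets_PiM_cong)
  have "(\<integral>\<^sup>+z. (\<Prod>i\<in>UNIV. f i (z $ i)) \<partial>lborel)
      = (\<integral>\<^sup>+x. (\<Prod>i\<in>UNIV. f i (x i)) \<partial>(\<Pi>\<^sub>M i\<in>(UNIV::'d set). (lborel :: 'a measure)))"
    by (subst lborel_vec, subst nn_integral_distr[OF meas]) simp_all
  also have "\<dots> = (\<Prod>i\<in>UNIV. \<integral>\<^sup>+x. f i x \<partial>lborel)"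
    by (rule product_nn_integral_prod) auto
  finally show ?thesis .
qed

text \<open>Both measures are compared on open half-lines, an intersection-stable generator of the
  Borel sets. The density is the derivative of the prescribed distribution function
  \<open>C * t ^ Suc s\<close>.\<close>

lemma distr_eq_power_density:
  fixes q :: "'a \<Rightarrow> real"
  assumes q [measurable]: "q \<in> borel_measurable M" and pos: "\<And>x. x \<in> space M \<Longrightarrow> 0 \<le> q x"
    and C: "0 \<le> C"
    and dist: "\<And>t. t > 0 \<Longrightarrow> emeasure M {x \<in> space M. q x < t} = ennreal (C * t ^ Suc s)"
  shows "distr M borel q = density lborel (\<lambda>t. ennreal (C * Suc s * t ^ s) * indicator {0..} t)"
    (is "?L = ?R")
proof -
  have left: "emeasure ?L {..<t} = (if t > 0 then ennreal (C * t ^ Suc s) else 0)" for t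
  proof -
    have "emeasure ?L {..<t} = emeasure M {x \<in> space M. q x < t}"
      by (subst emeasure_distr) (auto intro!: arg_cong[of _ _ "emeasure M"])
    moreover have "{x \<in> space M. q x < t} = {}" if "t \<le> 0" using pos that by force
    ultimately show ?thesis using dist[of t] by (cases "t > 0") (simp_all add: not_less)
  qed
  have right: "emeasure ?R {..<t} = (if t > 0 then ennreal (C * t ^ Suc s) else 0)" for t
  proof (cases "t > 0")
    case True
    have "emeasure ?R {..<t} = (\<integral>\<^sup>+x. ennreal (C * Suc s * x ^ s) * indicator {0..} x * indicator {..<t} x \<partial>lborel)"
      by (subst emeasure_density) auto
    also have "\<dots> = (\<integral>\<^sup>+x. ennreal (C * Suc s * x ^ s) * indicator {0..t} x \<partial>lborel)"
      by (intro nn_integral_cong_AE AE_I[of _ _ "{t}"]) (auto simp: indicator_def split: if_splits)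
    also have "\<dots> = ennreal (C * t ^ Suc s - C * 0 ^ Suc s)"
      using True C by (intro nn_integral_FTC_Icc)
        (auto intro!: derivative_eq_intros simp: mult_ac simp del: of_nat_Suc power_Suc)
    finally show ?thesis using True by simp
  next
    case False
    have "emeasure ?R {..<t} = (\<integral>\<^sup>+x. ennreal (C * Suc s * x ^ s) * indicator {0..} x * indicator {..<t} x \<partial>lborel)"
      by (subst emeasure_density) auto
    also have "\<dots> = (\<integral>\<^sup>+x. 0 \<partial>(lborel :: real measure))"
      using False by (intro nn_integral_cong) (auto simp: indicator_def)
    finally show ?thesis using False by simp
  qed
  show ?thesis
  proof (rule measure_eqI_generator_eq[where E = "range lessThan" and \<Omega> = UNIV and A = "\<lambda>i. {..<real i}"])
    show "Int_stable (range (lessThan :: real \<Rightarrow> _))"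
      unfolding Int_stable_def
    proof clarify
      fix a b :: real
      show "{..<a} \<inter> {..<b} \<in> range lessThan" by (intro range_eqI[of _ _ "min a b"]) auto
    qed
    show "(\<Union>i. {..<real i}) = UNIV"
      by (simp add: set_eq_iff reals_Archimedean2)
    show "emeasure ?L {..<real i} \<noteq> \<infinity>" for i by (simp add: left)
    show "emeasure ?L X = emeasure ?R X" if "X \<in> range lessThan" for X
      using that left right by auto
    show "sets ?L = sigma_sets UNIV (range lessThan)" "sets ?R = sigma_sets UNIV (range lessThan)"
      by (simp_all, simp_all add: borel_Iio)
  qed auto
qed

lemma nn_integral_radial:
  fixes q :: "'a \<Rightarrow> real"
  assumes q [measurable]: "q \<in> borel_measurable M" and pos: "\<And>x. x \<in> space M \<Longrightarrow> 0 \<le> q x"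
    and C: "0 \<le> C"
    and dist: "\<And>t. t > 0 \<Longrightarrow> emeasure M {x \<in> space M. q x < t} = ennreal (C * t ^ Suc s)"
    and [measurable]: "f \<in> borel_measurable borel"
  shows "(\<integral>\<^sup>+x. f (q x) \<partial>M) = (\<integral>\<^sup>+t. ennreal (C * Suc s * t ^ s) * indicator {0..} t * f t \<partial>lborel)"
proof -
  have "(\<integral>\<^sup>+x. f (q x) \<partial>M) = (\<integral>\<^sup>+t. f t \<partial>distr M borel q)"
    by (subst nn_integral_distr) auto
  also have "\<dots> = (\<integral>\<^sup>+t. ennreal (C * Suc s * t ^ s) * indicator {0..} t * f t \<partial>lborel)"
    by (simp add: distr_eq_power_density[OF q pos C dist] nn_integral_density)
  finally show ?thesis .
qed

lemma nn_integral_power_exp: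
  "(\<integral>\<^sup>+t. ennreal (t ^ k * exp (- t)) * indicator {0..} t \<partial>lborel) = ennreal (fact k)"
proof -
  have "ennreal (Gamma (real k + 1)) = (\<integral>\<^sup>+t. ennreal (indicator {0..} t * t powr (real k + 1 - 1) / exp t) \<partial>lborel)"
    by (rule Gamma_conv_nn_integral_real) simp
  also have "\<dots> = (\<integral>\<^sup>+t. ennreal (t ^ k * exp (- t)) * indicator {0..} t \<partial>lborel)"
    by (intro nn_integral_cong_AE AE_I[of _ _ "{0}"])
      (auto simp: indicator_def exp_minus divide_inverse split: if_splits, metis order_le_less powr_realpow)
  finally show ?thesis by (simp add: Gamma_fact add.commute)
qed

lemma nn_integral_power_Beta:
  "(\<integral>\<^sup>+t. ennreal (t ^ s * (1 - t) ^ m) * indicator {0..1} t \<partial>lborel)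
    = ennreal (fact s * fact m / fact (s + m + 1))"
proof -
  have "((\<lambda>t. t powr (real s + 1 - 1) * (1 - t) powr (real m + 1 - 1)) has_integral
      Beta (real s + 1) (real m + 1)) {0..1}"
    by (rule has_integral_Beta_real) auto
  moreover have "Beta (real s + 1) (real m + 1) = fact s * fact m / fact (s + m + 1)"
    using Gamma_fact[of s, where 'a=real] Gamma_fact[of m, where 'a=real] Gamma_fact[of "s + m + 1", where 'a=real]
    by (simp add: Beta_def algebra_simps)
  ultimately have "((\<lambda>t. t ^ s * (1 - t) ^ m) has_integral (fact s * fact m / fact (s + m + 1))) {0..1::real}"
    by (simp only: add_diff_cancel_right', elim has_integral_spike_finite[of "{0, 1}", rotated 2])
      (auto simp: powr_realpow)
  then show ?thesis
    by (rule nn_integral_has_integral_lebesgue'[rotated]) auto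
qed

section \<open>Moments of the weighted measures on the ball\<close>

definition zpow :: "('d \<Rightarrow> nat) \<Rightarrow> complex ^ 'd::finite \<Rightarrow> complex" where
  "zpow k z = (\<Prod>i\<in>UNIV. (z $ i) ^ k i)"

lemma measurable_vec_nth [measurable]: "(\<lambda>z::'a::euclidean_space ^ 'd::finite. z $ i) \<in> borel_measurable borel"
  by (intro borel_measurable_continuous_onI continuous_intros)

lemma pred_ball [measurable]: "Measurable.pred borel (\<lambda>x::'a::euclidean_space. x \<in> ball c r)"
  by (simp add: pred_def)

lemma measurable_zpow [measurable]: "zpow k \<in> borel_measurable borel"
  unfolding zpow_def by measurable

lemma norm_vec_sq: "(norm (z :: complex ^ 'd::finite))\<^sup>2 = (\<Sum>i\<in>UNIV. (cmod (z $ i))\<^sup>2)"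
  by (simp add: norm_vec_def L2_set_def sum_nonneg)

lemma cmod_zpow: "cmod (zpow k z) = (\<Prod>i\<in>UNIV. cmod (z $ i) ^ k i)"
  by (simp add: zpow_def prod_norm [symmetric] norm_power)

lemma cmod_zpow_le_1:
  assumes "norm z \<le> 1"
  shows "cmod (zpow k z) \<le> 1"
  unfolding cmod_zpow
proof (rule prod_le_1, intro conjI)
  show "cmod (z $ i) ^ k i \<le> 1" for i
    using Finite_Cartesian_Product.norm_nth_le[of z i] assms by (intro power_le_one) auto
qed auto

lemma zpow_scaleR: "zpow k (c *\<^sub>R z) = of_real (c ^ (\<Sum>i\<in>UNIV. k i)) * zpow k z"
  by (simp add: zpow_def scaleR_conv_of_real[where 'a = complex] power_mult_distrib prod.distrib power_sum)

lemma zpow_update: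
  "zpow k (\<chi> l. if l = i then w * z $ l else z $ l) = w ^ k i * zpow k z"
proof -
  have "zpow k (\<chi> l. if l = i then w * z $ l else z $ l)
      = (\<Prod>l\<in>UNIV. (if l = i then w ^ k l else 1) * (z $ l) ^ k l)"
    unfolding zpow_def by (intro prod.cong) (auto simp: power_mult_distrib)
  then show ?thesis by (simp add: prod.distrib zpow_def)
qed

lemma nn_integral_lborel_scale:
  fixes f :: "'a::euclidean_space \<Rightarrow> ennreal"
  assumes [measurable]: "f \<in> borel_measurable borel" and c: "c > 0"
  shows "(\<integral>\<^sup>+x. f x \<partial>lborel) = ennreal (c ^ DIM('a)) * (\<integral>\<^sup>+x. f (c *\<^sub>R x) \<partial>lborel)"
proof -
  have "(\<integral>\<^sup>+x. f x \<partial>lborel)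
      = (\<integral>\<^sup>+x. f x \<partial>density (distr lborel borel (\<lambda>x. 0 + c *\<^sub>R x)) (\<lambda>_. \<bar>c\<bar> ^ DIM('a)))"
    using c by (subst lborel_affine[of c 0]) auto
  also have "\<dots> = ennreal (c ^ DIM('a)) * (\<integral>\<^sup>+x. f (c *\<^sub>R x) \<partial>lborel)"
    using c by (simp add: nn_integral_density nn_integral_distr nn_integral_cmult)
  finally show ?thesis .
qed

text \<open>The squared modulus is the good radial variable: discs have area \<open>pi * t\<close>
  in terms of it, so its density is constant and a Gamma integral remains.\<close>

lemma nn_integral_complex_gauss:
  "(\<integral>\<^sup>+z. ennreal (cmod z ^ (2 * k) * exp (- (cmod z)\<^sup>2)) \<partial>lborel) = ennreal (pi * fact k)"
proof -
  have "(\<integral>\<^sup>+z. ennreal ((cmod z)\<^sup>2 ^ k * exp (- (cmod z)\<^sup>2)) \<partial>lborel)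
      = (\<integral>\<^sup>+t. ennreal (pi * Suc 0 * t ^ 0) * indicator {0..} t * ennreal (t ^ k * exp (- t)) \<partial>lborel)"
  proof (rule nn_integral_radial[where q = "\<lambda>z. (cmod z)\<^sup>2" and f = "\<lambda>t. ennreal (t ^ k * exp (- t))"])
    fix t :: real assume t: "t > 0"
    have "{z \<in> space lborel. (cmod z)\<^sup>2 < t} = ball 0 (sqrt t)"
      by auto (metis norm_ge_zero real_sqrt_less_iff real_sqrt_unique)+
    then show "emeasure lborel {z \<in> space lborel. (cmod z)\<^sup>2 < t} = ennreal (pi * t ^ Suc 0)"
      using t by (simp add: emeasure_ball eval_unit_ball_vol)
  qed auto
  also have "\<dots> = (\<integral>\<^sup>+t. ennreal pi * (ennreal (t ^ k * exp (- t)) * indicator {0..} t) \<partial>lborel)"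
    by (intro nn_integral_cong) (simp add: mult_ac)
  also have "\<dots> = ennreal (pi * fact k)"
    by (simp add: nn_integral_cmult nn_integral_power_exp ennreal_mult)
  finally show ?thesis by (simp add: power_mult)
qed

lemma nn_integral_zpow_gauss:
  "(\<integral>\<^sup>+z. ennreal ((cmod (zpow k z))\<^sup>2 * exp (- (norm z)\<^sup>2)) \<partial>lborel)
    = ennreal (pi ^ CARD('d) * (\<Prod>i\<in>UNIV. fact (k i)))"
  for k :: "'d::finite \<Rightarrow> nat"
proof -
  have "(cmod (zpow k z))\<^sup>2 * exp (- (norm z)\<^sup>2)
      = (\<Prod>i\<in>UNIV. cmod (z $ i) ^ (2 * k i) * exp (- (cmod (z $ i))\<^sup>2))" for z
    by (simp add: cmod_zpow norm_vec_sq prod.distrib prod_power_distrib power_mult[symmetric]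
        mult.commute exp_sum sum_negf[symmetric])
  then have "(\<integral>\<^sup>+z. ennreal ((cmod (zpow k z))\<^sup>2 * exp (- (norm z)\<^sup>2)) \<partial>lborel)
      = (\<integral>\<^sup>+z. (\<Prod>i\<in>UNIV. ennreal (cmod (z $ i) ^ (2 * k i) * exp (- (cmod (z $ i))\<^sup>2))) \<partial>lborel)"
    by (simp add: prod_ennreal)
  also have "\<dots> = (\<Prod>i\<in>UNIV. ennreal (pi * fact (k i)))"
    by (subst nn_integral_lborel_vec_prod) (simp_all add: nn_integral_complex_gauss)
  also have "\<dots> = ennreal (pi ^ CARD('d) * (\<Prod>i\<in>UNIV. fact (k i)))"
    by (subst prod_ennreal) (simp_all add: prod.distrib)
  finally show ?thesis .
qed

text \<open>
  Both integrals against \<open>|z\<^sup>k|\<^sup>2\<close> are radial. By homogeneity the Gaussian one determines the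
  constant of the radial density.
\<close>

lemma nn_integral_zpow_ball:
  fixes k :: "'d::finite \<Rightarrow> nat"
  shows "(\<integral>\<^sup>+z. ennreal ((cmod (zpow k z))\<^sup>2) * ennreal (indicator (ball 0 1) z * (1 - (norm z)\<^sup>2) ^ m) \<partial>lborel)
    = ennreal (pi ^ CARD('d) * (\<Prod>i\<in>UNIV. fact (k i)) * fact m / fact ((\<Sum>i\<in>UNIV. k i) + CARD('d) + m))"
proof -
  define K where "K = (\<Sum>i\<in>UNIV. k i)"
  define s where "s = K + CARD('d) - 1"
  have s: "Suc s = K + CARD('d)" using zero_less_card_finite[where 'a = 'd] by (simp add: s_def)
  define M where "M = density lborel (\<lambda>z::complex^'d. ennreal ((cmod (zpow k z))\<^sup>2))"
  have [simp]: "space M = UNIV" "sets M = sets borel" by (simp_all add: M_def)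
  have M: "(\<integral>\<^sup>+z. f z \<partial>M) = (\<integral>\<^sup>+z. ennreal ((cmod (zpow k z))\<^sup>2) * f z \<partial>lborel)"
    if [measurable]: "f \<in> borel_measurable borel" for f
    unfolding M_def by (subst nn_integral_density) auto
  have ballM: "emeasure M {z. (norm z)\<^sup>2 < t}
      = (\<integral>\<^sup>+z. ennreal ((cmod (zpow k z))\<^sup>2) * indicator {z. (norm z)\<^sup>2 < t} z \<partial>lborel)" for t
    unfolding M_def by (subst emeasure_density) auto
  have "emeasure M {z. (norm z)\<^sup>2 < 1} \<le> (\<integral>\<^sup>+z. indicator (ball 0 1) (z::complex^'d) \<partial>lborel)"
    unfolding ballM
    by (intro nn_integral_mono)
      (auto simp: indicator_def power_less_one_iff abs_square_less_1 power_le_one cmod_zpow_le_1 ennreal_le_1)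
  also have "\<dots> < top" by (simp add: emeasure_ball)
  finally have "emeasure M {z. (norm z)\<^sup>2 < 1} < top" .
  then obtain C where C: "0 \<le> C" "emeasure M {z. (norm z)\<^sup>2 < 1} = ennreal C"
    by (cases "emeasure M {z. (norm z)\<^sup>2 < 1}") auto
  \<comment> \<open>Scaling by \<open>sqrt t\<close> reduces to \<open>t = 1\<close>. The monomial
    contributes the factor \<open>t ^ K\<close>, the real dimension \<open>2 * CARD('d)\<close> the
    factor \<open>t ^ CARD('d)\<close>.\<close>
  have dist: "emeasure M {z \<in> space M. (norm z)\<^sup>2 < t} = ennreal (C * t ^ Suc s)" if t: "t > 0" for t
  proof -
    define c where "c = sqrt t"
    have c: "c > 0" "c\<^sup>2 = t" using t by (auto simp: c_def)
    have cc: "(c * norm z)\<^sup>2 < t \<longleftrightarrow> (norm z)\<^sup>2 < 1" for z :: "complex^'d"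
      using t by (simp add: power_mult_distrib c)
    have "emeasure M {z \<in> space M. (norm z)\<^sup>2 < t} = ennreal (c ^ DIM(complex^'d)) *
        (\<integral>\<^sup>+z. ennreal ((cmod (zpow k (c *\<^sub>R z)))\<^sup>2) * indicator {z. (norm z)\<^sup>2 < t} (c *\<^sub>R z) \<partial>lborel)"
      using c by (simp add: ballM, subst nn_integral_lborel_scale[of _ c]) simp_all
    also have "(\<integral>\<^sup>+z. ennreal ((cmod (zpow k (c *\<^sub>R z)))\<^sup>2) * indicator {z. (norm z)\<^sup>2 < t} (c *\<^sub>R z) \<partial>lborel)
        = (\<integral>\<^sup>+z. ennreal ((c ^ K)\<^sup>2) * (ennreal ((cmod (zpow k z))\<^sup>2) * indicator {z. (norm z)\<^sup>2 < 1} z) \<partial>lborel)"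
      using c t
      by (intro nn_integral_cong)
        (auto simp: zpow_scaleR abs_of_pos[OF c(1)] K_def[symmetric] norm_mult norm_power power_mult_distrib indicator_def c
          ennreal_mult[symmetric])
    also have "\<dots> = ennreal ((c ^ K)\<^sup>2) * ennreal C"
      by (simp add: nn_integral_cmult ballM[symmetric] C)
    also have "ennreal (c ^ DIM(complex^'d)) * (ennreal ((c ^ K)\<^sup>2) * ennreal C) = ennreal (C * t ^ Suc s)"
    proof -
      have "c ^ DIM(complex^'d) * (c ^ K)\<^sup>2 = t ^ Suc s"
        unfolding s c(2)[symmetric] by (simp add: power_mult[symmetric] power_add[symmetric] mult.commute)
      then show ?thesis using c C by (simp add: ennreal_mult[symmetric] mult_ac)
    qed
    finally show ?thesis .
  qed
  have [measurable]: "(\<lambda>z. (norm z)\<^sup>2) \<in> borel_measurable M"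
    by (subst measurable_cong_sets[OF \<open>sets M = sets borel\<close> refl]) measurable
  have radial: "(\<integral>\<^sup>+z. f ((norm z)\<^sup>2) \<partial>M)
      = (\<integral>\<^sup>+t. ennreal (C * Suc s * t ^ s) * indicator {0..} t * f t \<partial>lborel)"
    if f: "f \<in> borel_measurable borel" for f
    using C dist f by (intro nn_integral_radial) auto
  have "ennreal (pi ^ CARD('d) * (\<Prod>i\<in>UNIV. fact (k i)))
      = (\<integral>\<^sup>+z. ennreal (exp (- (norm z)\<^sup>2)) \<partial>M)"
    by (subst M) (simp_all add: nn_integral_zpow_gauss[symmetric] ennreal_mult)
  also have "\<dots> = (\<integral>\<^sup>+t. ennreal (C * Suc s * t ^ s) * indicator {0..} t * ennreal (exp (- t)) \<partial>lborel)"
    by (rule radial[where f = "\<lambda>t. ennreal (exp (- t))"]) measurable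
  also have "\<dots> = (\<integral>\<^sup>+t. ennreal (C * Suc s) * (ennreal (t ^ s * exp (- t)) * indicator {0..} t) \<partial>lborel)"
    using C by (intro nn_integral_cong) (auto simp: indicator_def ennreal_mult[symmetric] mult_ac simp del: of_nat_Suc)
  also have "\<dots> = ennreal (C * Suc s * fact s)"
    using C by (simp add: nn_integral_cmult nn_integral_power_exp ennreal_mult[symmetric] del: of_nat_Suc)
  finally have CS: "C * Suc s * fact s = pi ^ CARD('d) * (\<Prod>i\<in>UNIV. fact (k i))"
    using C by (subst (asm) ennreal_inj) (auto intro!: mult_nonneg_nonneg prod_nonneg)
  have "(\<integral>\<^sup>+z. ennreal ((cmod (zpow k z))\<^sup>2) * ennreal (indicator (ball 0 1) z * (1 - (norm z)\<^sup>2) ^ m) \<partial>lborel)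
      = (\<integral>\<^sup>+z. ennreal (indicator {0..<1} ((norm z)\<^sup>2) * (1 - (norm z)\<^sup>2) ^ m) \<partial>M)"
    by (subst M) (auto simp: indicator_def abs_square_less_1 intro!: nn_integral_cong)
  also have "\<dots> = (\<integral>\<^sup>+t. ennreal (C * Suc s * t ^ s) * indicator {0..} t *
      ennreal (indicator {0..<1} t * (1 - t) ^ m) \<partial>lborel)"
    by (rule radial[where f = "\<lambda>t. ennreal (indicator {0..<1} t * (1 - t) ^ m)"]) measurable
  also have "\<dots> = (\<integral>\<^sup>+t. ennreal (C * Suc s) * (ennreal (t ^ s * (1 - t) ^ m) * indicator {0..1} t) \<partial>lborel)"
    using C by (intro nn_integral_cong_AE AE_I[of _ _ "{1}"])
      (auto simp: indicator_def ennreal_mult[symmetric] mult_ac split: if_splits simp del: of_nat_Suc)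
  also have "\<dots> = ennreal (C * Suc s * (fact s * fact m / fact (s + m + 1)))"
    using C by (simp add: nn_integral_cmult nn_integral_power_Beta ennreal_mult[symmetric] del: of_nat_Suc)
  also have "C * Suc s * (fact s * fact m / fact (s + m + 1))
      = pi ^ CARD('d) * (\<Prod>i\<in>UNIV. fact (k i)) * fact m / fact (K + CARD('d) + m)"
  proof -
    have "s + m + 1 = K + CARD('d) + m" using s by simp
    then show ?thesis unfolding CS[symmetric] by (simp only: mult.assoc times_divide_eq_right)
  qed
  finally show ?thesis by (simp add: K_def)
qed

lemma sets_dV [simp, measurable_cong]: "sets (dV n) = sets borel"
  and space_dV [simp]: "space (dV n) = UNIV"
  by (simp_all add: dV_def)

lemma nn_integral_dV_zpow:
  fixes k :: "'d::finite \<Rightarrow> nat"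
  assumes n: "n \<ge> CARD('d)"
  shows "(\<integral>\<^sup>+z. ennreal ((cmod (zpow k z))\<^sup>2) \<partial>dV n)
    = ennreal (fact n * (\<Prod>i\<in>UNIV. fact (k i)) / fact ((\<Sum>i\<in>UNIV. k i) + n))"
proof -
  define c where "c = fact n / (fact (n - CARD('d)) * pi ^ CARD('d) :: real)"
  have c: "c \<ge> 0" by (simp add: c_def)
  have w: "ennreal (indicator (ball 0 1) z * (c * (1 - (norm z)\<^sup>2) ^ (n - CARD('d))))
      = ennreal c * ennreal (indicator (ball 0 1) z * (1 - (norm z)\<^sup>2) ^ (n - CARD('d)))" for z :: "complex^'d"
    using c by (simp add: indicator_def ennreal_mult' split: if_splits)
  have "(\<integral>\<^sup>+z. ennreal ((cmod (zpow k z))\<^sup>2) \<partial>dV n)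
      = (\<integral>\<^sup>+z. ennreal c * (ennreal ((cmod (zpow k z))\<^sup>2) *
          ennreal (indicator (ball 0 1) z * (1 - (norm z)\<^sup>2) ^ (n - CARD('d)))) \<partial>lborel)"
    unfolding dV_def c_def[symmetric]
    by (subst nn_integral_density, measurable, measurable) (intro nn_integral_cong, simp only: w, simp only: mult_ac)
  also have "\<dots> = ennreal c * ennreal (pi ^ CARD('d) * (\<Prod>i\<in>UNIV. fact (k i)) * fact (n - CARD('d)) /
      fact ((\<Sum>i\<in>UNIV. k i) + CARD('d) + (n - CARD('d))))"
    by (subst nn_integral_cmult, measurable) (simp only: nn_integral_zpow_ball)
  also have "\<dots> = ennreal (c * (pi ^ CARD('d) * (\<Prod>i\<in>UNIV. fact (k i)) * fact (n - CARD('d)) /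
      fact ((\<Sum>i\<in>UNIV. k i) + n)))"
    by (simp only: add.assoc le_add_diff_inverse[OF n] ennreal_mult'[OF c])
  also have "c * (pi ^ CARD('d) * (\<Prod>i\<in>UNIV. fact (k i)) * fact (n - CARD('d)) / fact ((\<Sum>i\<in>UNIV. k i) + n))
      = fact n * (\<Prod>i\<in>UNIV. fact (k i)) / fact ((\<Sum>i\<in>UNIV. k i) + n)"
    by (simp add: c_def)
  finally show ?thesis .
qed

lemma emeasure_dV_UNIV:
  assumes "n \<ge> CARD('d)"
  shows "emeasure (dV n) (UNIV :: (complex^'d::finite) set) = 1"
proof -
  have "emeasure (dV n) (UNIV :: (complex^'d) set) = (\<integral>\<^sup>+z. ennreal ((cmod (zpow (\<lambda>_::'d. 0) z))\<^sup>2) \<partial>dV n)"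
    by (simp add: zpow_def)
  also have "\<dots> = ennreal (fact n * (\<Prod>i\<in>(UNIV::'d set). fact 0) / fact ((\<Sum>i\<in>(UNIV::'d set). 0) + n))"
    by (rule nn_integral_dV_zpow[OF assms])
  also have "\<dots> = 1" by simp
  finally show ?thesis .
qed

lemma distr_dV_isometry:
  fixes U :: "complex^'d::finite \<Rightarrow> complex^'d"
  assumes lin: "linear U" and norm: "\<And>x. norm (U x) = norm x"
  shows "distr (dV n) borel U = dV n"
proof (rule measure_eqI)
  define w where "w = (\<lambda>z::complex^'d. ennreal (indicator (ball 0 1) z *
     (fact n / (fact (n - CARD('d)) * pi ^ CARD('d)) * (1 - (norm z)\<^sup>2) ^ (n - CARD('d)))))"
  have dV: "dV n = density lborel w" by (simp add: dV_def w_def)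
  have [measurable]: "w \<in> borel_measurable borel" unfolding w_def by measurable
  have wU: "w (U z) = w z" for z by (simp add: w_def norm indicator_def)
  fix X assume "X \<in> sets (distr (dV n) borel U)"
  then have [measurable]: "X \<in> sets borel" by simp
  have [measurable]: "U \<in> borel_measurable borel"
    using lin by (simp add: linear_continuous_on borel_measurable_continuous_onI linear_linear)
  have "emeasure (distr (dV n) borel U) X = (\<integral>\<^sup>+x. w x * indicator X (U x) \<partial>lborel)"
    by (simp flip: nn_integral_indicator add: nn_integral_distr dV nn_integral_density)
  also have "\<dots> = (\<integral>\<^sup>+x. w (U x) * indicator X (U x) \<partial>lborel)" by (simp add: wU)
  also have "\<dots> = (\<integral>\<^sup>+x. w x * indicator X x \<partial>lborel)"
    by (rule nn_integral_lborel_isometry[OF lin norm]) auto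
  also have "\<dots> = emeasure (dV n) X"
    by (simp add: dV emeasure_density)
  finally show "emeasure (distr (dV n) borel U) X = emeasure (dV n) X" .
qed simp

text \<open>In a coordinate where the exponents differ, a rotation by the angle
  \<open>\<theta>\<close> changes the sign of the integrand and preserves the measure, so the
  integral is its own negative.\<close>

lemma integral_dV_zpow_orthogonal:
  fixes j k :: "'d::finite \<Rightarrow> nat"
  assumes "j \<noteq> k"
  shows "(\<integral>z. zpow j z * cnj (zpow k z) \<partial>dV n) = 0"
proof -
  obtain i where i: "j i \<noteq> k i" using assms by auto
  define \<theta> where "\<theta> = pi / (real (j i) - real (k i))"
  define \<omega> where "\<omega> = cis \<theta>"
  have "\<omega> ^ j i * cnj \<omega> ^ k i = cis (\<theta> * (real (j i) - real (k i)))"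
    by (simp add: \<omega>_def cis_cnj Complex.DeMoivre cis_mult algebra_simps)
  also have "\<dots> = -1" using i by (simp add: \<theta>_def)
  finally have w: "\<omega> ^ j i * cnj \<omega> ^ k i = -1" .
  define U where "U = (\<lambda>z::complex^'d. \<chi> l. if l = i then \<omega> * z $ l else z $ l)"
  have lin: "linear U"
    by (rule linearI) (auto simp: U_def vec_eq_iff algebra_simps)
  have "cmod (U z $ l) = cmod (z $ l)" for z l by (simp add: U_def \<omega>_def norm_mult)
  then have nrm: "norm (U z) = norm z" for z
    by (simp add: norm_vec_def L2_set_def)
  have [measurable]: "U \<in> borel_measurable borel"
    using lin by (simp add: linear_continuous_on borel_measurable_continuous_onI linear_linear)
  let ?f = "\<lambda>z. zpow j z * cnj (zpow k z)"
  have [measurable]: "?f \<in> borel_measurable borel"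
    unfolding zpow_def by (intro borel_measurable_continuous_onI continuous_intros)
  have "(\<integral>z. ?f z \<partial>dV n) = (\<integral>z. ?f z \<partial>distr (dV n) borel U)"
    by (simp add: distr_dV_isometry[OF lin nrm])
  also have "\<dots> = (\<integral>z. ?f (U z) \<partial>dV n)"
    by (subst integral_distr) (auto simp: measurable_cong_sets[OF sets_dV refl])
  also have "\<dots> = (\<integral>z. (\<omega> ^ j i * cnj \<omega> ^ k i) * ?f z \<partial>dV n)"
    by (simp add: U_def zpow_update mult_ac)
  also have "\<dots> = - (\<integral>z. ?f z \<partial>dV n)" by (simp add: w)
  finally show ?thesis by simp
qed

section \<open>Polynomial approximation of analytic functions on the ball\<close>

definition upd :: "complex ^ 'd::finite \<Rightarrow> 'd \<Rightarrow> complex \<Rightarrow> complex ^ 'd" where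
  "upd z i w = (\<chi> l. if l = i then w else z $ l)"

lemma upd_nth [simp]: "upd z i w $ l = (if l = i then w else z $ l)"
  by (simp add: upd_def)

lemma upd_same [simp]: "upd (upd z i w) i v = upd z i v"
  by (simp add: vec_eq_iff)

lemma upd_commute: "i \<noteq> j \<Longrightarrow> upd (upd z i w) j v = upd (upd z j v) i w"
  by (simp add: vec_eq_iff)

lemma upd_triv [simp]: "upd z i (z $ i) = z"
  by (simp add: vec_eq_iff)

lemma continuous_upd: "continuous_on S (upd z i)"
  unfolding upd_def
proof (rule continuous_on_vec_lambda)
  show "continuous_on S (\<lambda>w. if l = i then w else z $ l)" for l by (cases "l = i") auto
qed

lemma open_upd: "open {w. upd z i w \<in> ball 0 s}"
  using open_vimage[OF open_ball continuous_upd[of UNIV z i], of 0 s] by (simp add: vimage_def)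

lemma norm_vec_le:
  fixes x y :: "complex ^ 'd::finite"
  shows "(\<And>l. cmod (x $ l) \<le> cmod (y $ l)) \<Longrightarrow> norm x \<le> norm y"
  by (rule norm_le_componentwise_cart)

lemma norm_upd_le:
  fixes z :: "complex ^ 'd::finite"
  assumes "cmod w \<le> r * cmod (z $ i)" "1 \<le> r"
  shows "norm (upd z i w) \<le> r * norm z"
proof -
  have "cmod (z $ l) \<le> r * cmod (z $ l)" for l
    using assms(2) mult_right_mono[of 1 r "cmod (z $ l)"] by simp
  then have "norm (upd z i w) \<le> norm (r *\<^sub>R z)"
    using assms by (intro norm_vec_le) auto
  then show ?thesis using assms by simp
qed

text \<open>Bounded separate holomorphy suffices for the expansion and passes to the components.
  Joint analyticity enters only in \<open>dilation_cls\<close>, which puts dilations into this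
  class.\<close>

definition cls :: "real \<Rightarrow> real \<Rightarrow> (complex ^ 'd::finite \<Rightarrow> complex) \<Rightarrow> bool" where
  "cls s M g \<longleftrightarrow> (\<forall>z\<in>ball 0 s. cmod (g z) \<le> M) \<and>
     (\<forall>z\<in>ball 0 s. \<forall>i. (\<lambda>w. g (upd z i w)) holomorphic_on {w. upd z i w \<in> ball 0 s})"

text \<open>Multipliers with \<open>cmod t \<le> 1\<close> keep the point in the ball, whatever the
  other coordinates are.\<close>

definition homog :: "real \<Rightarrow> 'd \<Rightarrow> nat \<Rightarrow> (complex ^ 'd::finite \<Rightarrow> complex) \<Rightarrow> bool" where
  "homog s i k g \<longleftrightarrow> (\<forall>z\<in>ball 0 s. \<forall>t. cmod t \<le> 1 \<longrightarrow> g (upd z i (t * z $ i)) = t ^ k * g z)"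

text \<open>The part of degree \<open>l\<close> in the \<open>i\<close>-th variable. The expansion
  is in a factor \<open>t\<close> multiplying \<open>z $ i\<close>, not in \<open>z $ i\<close>
  itself, so the power of \<open>z $ i\<close> is contained in the value and nothing is divided by
  it.\<close>

definition component :: "'d \<Rightarrow> nat \<Rightarrow> (complex ^ 'd::finite \<Rightarrow> complex) \<Rightarrow> complex ^ 'd \<Rightarrow> complex" where
  "component i l g z = (deriv ^^ l) (\<lambda>t. g (upd z i (t * z $ i))) 0 / fact l"

lemma cls_bound: "cls s M g \<Longrightarrow> z \<in> ball 0 s \<Longrightarrow> cmod (g z) \<le> M"
  by (simp add: cls_def)

lemma cls_holomorphic:
  "cls s M g \<Longrightarrow> z \<in> ball 0 s \<Longrightarrow> (\<lambda>w. g (upd z i w)) holomorphic_on {w. upd z i w \<in> ball 0 s}"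
  by (simp add: cls_def)

lemma open_slice: "open {t. upd z i (t * z $ i) \<in> ball 0 s}"
proof -
  have "open ((\<lambda>t. t * z $ i) -` {w. upd z i w \<in> ball 0 s})"
    by (intro open_vimage open_upd continuous_intros)
  then show ?thesis by (simp add: vimage_def)
qed

lemma slice_holomorphic:
  assumes "cls s M g" "z \<in> ball 0 s"
  shows "(\<lambda>t. g (upd z i (t * z $ i))) holomorphic_on {t. upd z i (t * z $ i) \<in> ball 0 s}"
proof -
  have "((\<lambda>w. g (upd z i w)) \<circ> (\<lambda>t. t * z $ i)) holomorphic_on {t. upd z i (t * z $ i) \<in> ball 0 s}"
    using cls_holomorphic[OF assms, of i]
    by (intro holomorphic_on_compose_gen) (auto intro!: holomorphic_intros)
  then show ?thesis by (simp add: o_def)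
qed

lemma slice_in_ball:
  assumes "cmod t \<le> r" "1 \<le> r" "r * norm z < s"
  shows "upd z i (t * z $ i) \<in> ball 0 s"
proof -
  have "norm (upd z i (t * z $ i)) \<le> r * norm z"
    using assms by (intro norm_upd_le) (auto simp: norm_mult intro: mult_right_mono)
  then show ?thesis using assms by simp
qed

text \<open>Cauchy's inequality on the circle of radius \<open>r\<close>: stretching one coordinate
  by at most \<open>r\<close> multiplies the norm by at most \<open>r\<close>, which stays below
  \<open>s\<close>.\<close>

lemma component_bound:
  assumes g: "cls s M g" and r: "1 \<le> r" "r * norm z < s"
  shows "cmod (component i l g z) \<le> M / r ^ l"
proof -
  have z: "z \<in> ball 0 s"
    using r mult_right_mono[of 1 r "norm z"] by simp
  have sub: "cball 0 r \<subseteq> {t. upd z i (t * z $ i) \<in> ball 0 s}"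
    using slice_in_ball[OF _ r] by auto
  have hol: "(\<lambda>t. g (upd z i (t * z $ i))) holomorphic_on cball 0 r"
    using slice_holomorphic[OF g z] sub by (rule holomorphic_on_subset)
  have "cmod ((deriv ^^ l) (\<lambda>t. g (upd z i (t * z $ i))) 0) \<le> fact l * M / r ^ l"
  proof (rule Cauchy_inequality)
    show "(\<lambda>t. g (upd z i (t * z $ i))) holomorphic_on ball 0 r"
      using hol by (rule holomorphic_on_subset) auto
    show "continuous_on (cball 0 r) (\<lambda>t. g (upd z i (t * z $ i)))"
      using hol by (rule holomorphic_on_imp_continuous_on)
    show "cmod (g (upd z i (x * z $ i))) \<le> M" if "cmod (0 - x) = r" for x
      using that sub by (intro cls_bound[OF g]) auto
  qed (use r in auto)
  then show ?thesis by (simp add: component_def norm_divide field_simps)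
qed

lemma component_sums:
  assumes g: "cls s M g" and r: "1 \<le> r" "r * norm z < s" and t: "cmod t < r"
  shows "(\<lambda>l. component i l g z * t ^ l) sums g (upd z i (t * z $ i))"
proof -
  have z: "z \<in> ball 0 s"
    using r mult_right_mono[of 1 r "norm z"] by simp
  have "(\<lambda>t. g (upd z i (t * z $ i))) holomorphic_on ball 0 r"
    by (rule holomorphic_on_subset[OF slice_holomorphic[OF g z, of i]]) (use slice_in_ball[OF _ r] in auto)
  from holomorphic_power_series[OF this, of t] show ?thesis
    using t by (simp add: component_def)
qed

text \<open>Multiplying the coordinate by \<open>t\<close> rescales the slice variable, and
  \<open>l\<close> derivatives at \<open>0\<close> bring out \<open>t ^ l\<close>.\<close>

lemma component_homog:
  assumes g: "cls s M g"
  shows "homog s i l (component i l g)"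
  unfolding homog_def
proof (intro ballI allI impI)
  fix z :: "complex ^ 'a" and t assume z: "z \<in> ball 0 s" and t: "cmod t \<le> 1"
  have z1: "1 * norm z < s" using z by simp
  let ?T = "{x. upd z i (x * z $ i) \<in> ball 0 s}"
  have eq: "upd (upd z i (t * z $ i)) i (x * upd z i (t * z $ i) $ i) = upd z i ((t * x) * z $ i)" for x
    by (simp add: mult_ac)
  have "(deriv ^^ l) (\<lambda>x. g (upd z i ((t * x) * z $ i))) 0
      = t ^ l * (deriv ^^ l) (\<lambda>x. g (upd z i (x * z $ i))) (t * 0)"
  proof (rule higher_deriv_compose_linear[where S = "ball 0 1" and T = ?T])
    show "t * w \<in> ?T" if "w \<in> ball 0 1" for w
      using slice_in_ball[of "t * w" 1 z s i] z1 that t mult_mono[of "cmod t" 1 "cmod w" 1]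
      by (simp add: norm_mult)
  qed (use slice_holomorphic[OF g z] open_slice in auto)
  then show "component i l g (upd z i (t * z $ i)) = t ^ l * component i l g z"
    unfolding component_def eq by simp
qed

lemma geometric_tail_bound:
  fixes a :: "nat \<Rightarrow> complex"
  assumes a: "\<And>l. cmod (a l) \<le> M" and t: "0 \<le> t" "t < 1" and S: "(\<lambda>l. a l * of_real t ^ l) sums S"
  shows "cmod (S - (\<Sum>l<L. a l * of_real t ^ l)) \<le> M * t ^ L / (1 - t)"
proof -
  have "(\<lambda>l. a (l + L) * of_real t ^ (l + L)) sums (S - (\<Sum>l<L. a l * of_real t ^ l))"
    using S by (rule sums_split_initial_segment)
  moreover have "(\<lambda>l. M * t ^ L * t ^ l) sums (M * t ^ L * (1 / (1 - t)))"
    using t by (intro sums_mult geometric_sums) auto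
  moreover have "cmod (a (l + L) * of_real t ^ (l + L)) \<le> M * t ^ L * t ^ l" for l
    using t mult_right_mono[OF a[of "l + L"], of "t ^ (l + L)"]
    by (simp add: norm_mult norm_power power_add mult_ac)
  ultimately show ?thesis
    using norm_sums_le by fastforce
qed

text \<open>
  The \<open>l\<close>-th component is the pointwise limit as \<open>t \<rightarrow> 0\<close> of the bounded, separately holomorphic
  Taylor remainders \<open>(g (upd z i (t z\<^sub>i)) - \<Sum>m<l. t\<^sup>m g\<^sub>m z) / t\<^sup>l\<close>, so Montel's theorem applies.
\<close>

lemma component_cls:
  assumes g: "cls s M g"
  shows "cls s M (component i l g)"
proof (induction l rule: less_induct)
  case (less l)
  \<comment> \<open>The sequence starts at \<open>1 / 2\<close>, so the denominators
    \<open>1 - \<tau> n\<close> of the geometric tails never fall below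
    \<open>1 / 2\<close>.\<close>
  define \<tau> where "\<tau> = (\<lambda>n. inverse (real (Suc (Suc n))))"
  define B where "B = (\<lambda>n y. (g (upd y i (of_real (\<tau> n) * y $ i)) -
      (\<Sum>m<l. component i m g y * of_real (\<tau> n) ^ m)) / of_real (\<tau> n) ^ l)"
  have \<tau>: "0 < \<tau> n" "\<tau> n \<le> 1 / 2" for n by (simp_all add: \<tau>_def field_simps)
  have \<tau>0: "\<tau> \<longlonglongrightarrow> 0" unfolding \<tau>_def by (rule LIMSEQ_Suc[OF LIMSEQ_inverse_real_of_nat])
  have B_sums: "(\<lambda>m. component i (m + l) g y * of_real (\<tau> n) ^ m) sums B n y"
    if y: "y \<in> ball 0 s" for n y
  proof -
    have "(\<lambda>m. component i m g y * of_real (\<tau> n) ^ m) sums g (upd y i (of_real (\<tau> n) * y $ i))"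
      using y \<tau>[of n] by (intro component_sums[OF g, of 1]) auto
    then have "(\<lambda>m. component i (m + l) g y * of_real (\<tau> n) ^ (m + l)) sums
        (g (upd y i (of_real (\<tau> n) * y $ i)) - (\<Sum>m<l. component i m g y * of_real (\<tau> n) ^ m))"
      by (rule sums_split_initial_segment)
    from sums_divide[OF this, of "of_real (\<tau> n) ^ l"] show ?thesis
      using \<tau>[of n] by (simp add: B_def power_add)
  qed
  have M1: "cmod (component i m g y) \<le> M" if "y \<in> ball 0 s" for m y
    using component_bound[OF g, of 1 y i m] that by simp
  have M0: "0 \<le> M" if "y \<in> ball 0 s" for y :: "complex ^ 'a"
    using order_trans[OF norm_ge_zero M1[OF that]] .
  have B_bound: "cmod (B n y) \<le> 2 * M" if y: "y \<in> ball 0 s" for n y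
  proof -
    have "cmod (B n y) \<le> M / (1 - \<tau> n)"
      using geometric_tail_bound[of "\<lambda>m. component i (m + l) g y" M "\<tau> n" "B n y" 0]
        M1[OF y] B_sums[OF y, of n] \<tau>[of n] by simp
    also have "\<dots> \<le> M / (1 / 2)"
      using \<tau>[of n] M0[OF y] by (intro divide_left_mono) auto
    finally show ?thesis by simp
  qed
  have B_lim: "(\<lambda>n. B n y) \<longlonglongrightarrow> component i l g y" if y: "y \<in> ball 0 s" for y
  proof -
    have bnd: "cmod (B n y - component i l g y) \<le> M * \<tau> n * 2" for n
    proof -
      have "cmod (B n y - component i l g y) \<le> M * \<tau> n / (1 - \<tau> n)"
        using geometric_tail_bound[of "\<lambda>m. component i (m + l) g y" M "\<tau> n" "B n y" 1]
          M1[OF y] B_sums[OF y, of n] \<tau>[of n] by simp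
      also have "\<dots> \<le> M * \<tau> n / (1 / 2)"
        using \<tau>[of n] M0[OF y] by (intro divide_left_mono) auto
      finally show ?thesis by simp
    qed
    have null: "(\<lambda>n. M * \<tau> n * 2) \<longlonglongrightarrow> 0"
      using tendsto_mult_right[OF tendsto_mult_left[OF \<tau>0, of M], of 2] by simp
    have "(\<lambda>n. B n y - component i l g y) \<longlonglongrightarrow> 0"
      by (rule Lim_null_comparison[OF always_eventually[OF allI[OF bnd]] null])
    then show ?thesis by (rule LIM_zero_cancel)
  qed
  have "(\<lambda>w. component i l g (upd z j w)) holomorphic_on {w. upd z j w \<in> ball 0 s}" (is "_ holomorphic_on ?D")
    if z: "z \<in> ball 0 s" for z j
  proof -
    have hol: "(\<lambda>w. B n (upd z j w)) holomorphic_on ?D" for n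
    proof -
      let ?t = "of_real (\<tau> n) :: complex"
      have t: "cmod ?t \<le> 1" using \<tau>[of n] by simp
      \<comment> \<open>For \<open>j = i\<close> the shrinking acts on the variable
        \<open>w\<close>; otherwise it moves the base point. In both cases it only decreases moduli,
        so nothing leaves the ball.\<close>
      have "(\<lambda>w. g (upd (upd z j w) i (?t * upd z j w $ i))) holomorphic_on ?D"
      proof (cases "j = i")
        case True
        have sub: "(\<lambda>w. ?t * w) ` ?D \<subseteq> ?D"
        proof clarsimp
          fix w assume w: "norm (upd z j w) < s"
          have "norm (upd z j (?t * w)) \<le> norm (upd z j w)"
            using t by (intro norm_vec_le) (auto simp: norm_mult intro: mult_left_le_one_le)
          then show "norm (upd z j (complex_of_real (\<tau> n) * w)) < s" using w by simp
        qed
        have "((\<lambda>w. g (upd z j w)) \<circ> (\<lambda>w. ?t * w)) holomorphic_on ?D"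
          using cls_holomorphic[OF g z, of j] sub
          by (intro holomorphic_on_compose_gen) (auto intro!: holomorphic_intros)
        then show ?thesis using True by (simp add: o_def)
      next
        case False
        let ?y = "upd z i (?t * z $ i)"
        have y: "?y \<in> ball 0 s" using slice_in_ball[of ?t 1 z s i] t z by simp
        have sub: "?D \<subseteq> {w. upd ?y j w \<in> ball 0 s}"
        proof clarsimp
          fix w assume w: "norm (upd z j w) < s"
          have "norm (upd ?y j w) \<le> norm (upd z j w)"
            using t by (intro norm_vec_le) (auto simp: norm_mult intro: mult_left_le_one_le)
          then show "norm (upd ?y j w) < s" using w by simp
        qed
        have "(\<lambda>w. g (upd ?y j w)) holomorphic_on ?D"
          using cls_holomorphic[OF g y] sub by (rule holomorphic_on_subset)
        moreover have "upd (upd z j w) i (?t * upd z j w $ i) = upd ?y j w" for w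
          using False by (simp add: upd_commute)
        ultimately show ?thesis by simp
      qed
      moreover have "(\<lambda>w. component i m g (upd z j w)) holomorphic_on ?D" if "m < l" for m
        using less.IH[OF that] z by (rule cls_holomorphic)
      ultimately show ?thesis
        unfolding B_def using \<tau>(1)[of n] by (intro holomorphic_intros) auto
    qed
    \<comment> \<open>Montel yields a holomorphic limit along a subsequence only, but the whole
      sequence is already known to converge pointwise to the component, which identifies the
      limit.\<close>
    obtain h r where h: "h holomorphic_on ?D" and r: "strict_mono (r :: nat \<Rightarrow> nat)"
      and lim: "\<And>x. x \<in> ?D \<Longrightarrow> (\<lambda>n. B (r n) (upd z j x)) \<longlonglongrightarrow> h x"
    proof (rule Montel[of ?D "range (\<lambda>n w. B n (upd z j w))" "\<lambda>n w. B n (upd z j w)"])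
      show "\<exists>b. \<forall>h\<in>range (\<lambda>n w. B n (upd z j w)). \<forall>w\<in>K. cmod (h w) \<le> b"
        if "compact K" "K \<subseteq> ?D" for K
        using that B_bound by (intro exI[of _ "2 * M"]) blast
    qed (use hol open_upd in auto)
    have "component i l g (upd z j w) = h w" if w: "w \<in> ?D" for w
    proof (rule LIMSEQ_unique)
      show "(\<lambda>n. B (r n) (upd z j w)) \<longlonglongrightarrow> component i l g (upd z j w)"
        using LIMSEQ_subseq_LIMSEQ[OF B_lim r, of "upd z j w"] w by (simp add: o_def)
    qed (rule lim[OF w])
    then show ?thesis by (intro holomorphic_transform[OF h]) auto
  qed
  with M1 show ?case unfolding cls_def by blast
qed

text \<open>The factor \<open>t ^ k\<close> coming from coordinate \<open>j\<close> is constant in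
  the slice variable of coordinate \<open>i\<close>, so it passes through the derivatives. Thus
  expanding in a new coordinate keeps the homogeneity already gained.\<close>

lemma component_homog_other:
  assumes g: "cls s M g" and hom: "homog s j k g" and ij: "i \<noteq> j"
  shows "homog s j k (component i l g)"
  unfolding homog_def
proof (intro ballI allI impI)
  fix z :: "complex ^ 'a" and t assume z: "z \<in> ball 0 s" and t: "cmod t \<le> 1"
  let ?y = "upd z j (t * z $ j)"
  let ?D = "{x. upd z i (x * z $ i) \<in> ball 0 s}"
  have y: "?y \<in> ball 0 s" using slice_in_ball[of t 1 z s j] t z by simp
  have eq: "g (upd ?y i (x * ?y $ i)) = t ^ k * g (upd z i (x * z $ i))" if "x \<in> ?D" for x
    using hom[unfolded homog_def, rule_format, of "upd z i (x * z $ i)" t] that t ij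
    by (simp add: upd_commute)
  have D: "open ?D" "0 \<in> ?D"
    using open_slice slice_in_ball[of 0 1 z s i] z by auto
  have sub: "?D \<subseteq> {x. upd ?y i (x * ?y $ i) \<in> ball 0 s}"
  proof
    fix x assume x: "x \<in> ?D"
    have "norm (upd ?y i (x * ?y $ i)) \<le> norm (upd z i (x * z $ i))"
      using t ij by (intro norm_vec_le) (auto simp: norm_mult intro: mult_left_le_one_le)
    also have "\<dots> < s" using x by simp
    finally show "x \<in> {x. upd ?y i (x * ?y $ i) \<in> ball 0 s}" by (simp only: mem_Collect_eq mem_ball_0)
  qed
  have "(deriv ^^ l) (\<lambda>x. g (upd ?y i (x * ?y $ i))) 0
      = (deriv ^^ l) (\<lambda>x. t ^ k * g (upd z i (x * z $ i))) 0"
  proof (rule higher_deriv_transform_within_open[OF _ _ D])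
    show "(\<lambda>x. g (upd ?y i (x * ?y $ i))) holomorphic_on ?D"
      using slice_holomorphic[OF g y] sub by (rule holomorphic_on_subset)
    show "(\<lambda>x. t ^ k * g (upd z i (x * z $ i))) holomorphic_on ?D"
      by (intro holomorphic_intros slice_holomorphic[OF g z])
  qed (rule eq)
  also have "\<dots> = t ^ k * (deriv ^^ l) (\<lambda>x. g (upd z i (x * z $ i))) 0"
    by (rule higher_deriv_cmult[OF slice_holomorphic[OF g z] D(2,1)])
  finally show "component i l g (upd z j (t * z $ j)) = t ^ k * component i l g z"
    by (simp add: component_def)
qed

text \<open>Because \<open>s > 1\<close>, some \<open>r\<close> with \<open>1 < r < s\<close> is
  available for every point of the unit ball at once, and the components decay like powers of
  \<open>1 / r\<close> uniformly there.\<close>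

lemma component_approx:
  assumes g: "cls s M g" and s: "1 < s" and \<epsilon>: "\<epsilon> > 0"
  obtains L where "\<And>z. z \<in> ball 0 1 \<Longrightarrow> cmod (g z - (\<Sum>l<L. component i l g z)) \<le> \<epsilon>"
proof -
  obtain r where r: "1 < r" "r < s" using dense[OF s] by auto
  define t where "t = 1 / r"
  have t: "0 < t" "t < 1" using r by (auto simp: t_def)
  have "(\<lambda>L. M * t ^ L / (1 - t)) \<longlonglongrightarrow> M * 0 / (1 - t)"
    using t by (intro tendsto_intros LIMSEQ_power_zero) auto
  then have "\<forall>\<^sub>F L in sequentially. M * t ^ L / (1 - t) < \<epsilon>"
    using \<epsilon> by (intro order_tendstoD(2)) auto
  then obtain L where L: "M * t ^ L / (1 - t) < \<epsilon>"
    by (auto simp: eventually_sequentially)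
  show ?thesis
  proof (rule that[of L])
    fix z :: "complex ^ 'a" assume z: "z \<in> ball 0 1"
    have rz: "r * norm z < s"
    proof -
      have "r * norm z \<le> r * 1" using r z by (intro mult_left_mono) auto
      also have "\<dots> < s" using r by simp
      finally show ?thesis .
    qed
    have 1: "(\<lambda>l. component i l g z * 1 ^ l) sums g (upd z i (1 * z $ i))"
      using r rz by (intro component_sums[OF g, of r]) auto
    have "cmod (component i l g z * of_real r ^ l) \<le> M" for l
      using component_bound[OF g _ rz, of i l] r by (simp add: norm_mult norm_power field_simps)
    moreover have "(\<lambda>l. component i l g z * of_real r ^ l * of_real t ^ l) sums g z"
      using 1 r by (simp add: t_def power_one_over)
    ultimately have "cmod (g z - (\<Sum>l<L. component i l g z * of_real r ^ l * of_real t ^ l)) \<le> M * t ^ L / (1 - t)"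
      using t by (intro geometric_tail_bound) auto
    with L r show "cmod (g z - (\<Sum>l<L. component i l g z)) \<le> \<epsilon>"
      by (simp add: t_def power_one_over)
  qed
qed

section \<open>Functions homogeneous in every coordinate\<close>

lemma homog_all_scale:
  assumes hom: "\<And>i. homog s i (k i) g" and z: "z \<in> ball 0 s" and c: "\<And>i. cmod (c i) \<le> 1"
  shows "g (\<chi> i. c i * z $ i) = (\<Prod>i\<in>UNIV. c i ^ k i) * g z"
proof -
  have "g (\<chi> i. if i \<in> J then c i * z $ i else z $ i) = (\<Prod>i\<in>J. c i ^ k i) * g z" for J
  proof (induction J rule: finite_induct[OF finite])
    case 1
    have "(\<chi> i. z $ i) = z" by (simp add: vec_eq_iff)
    then show ?case by simp
  next
    case (2 j J)
    let ?y = "\<chi> i. if i \<in> J then c i * z $ i else z $ i"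
    have "norm ?y \<le> norm z"
      using c by (intro norm_vec_le) (auto simp: norm_mult intro: mult_left_le_one_le)
    then have y: "?y \<in> ball 0 s" using z by simp
    have "(\<chi> i. if i \<in> insert j J then c i * z $ i else z $ i) = upd ?y j (c j * ?y $ j)"
      using 2 by (auto simp: vec_eq_iff)
    then have "g (\<chi> i. if i \<in> insert j J then c i * z $ i else z $ i) = c j ^ k j * g ?y"
      using hom[of j, unfolded homog_def, rule_format, OF y c[of j]] by (simp only:)
    with 2 show ?case by simp
  qed
  from this[of UNIV] show ?thesis by simp
qed

text \<open>Coordinates of \<open>z\<close> may vanish, so \<open>g z\<close> cannot be compared
  with a fixed point by dividing by the coordinates of \<open>z\<close>. Instead \<open>z\<close>
  and a diagonal point are both compared with a point \<open>w\<close> whose coordinates are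
  positive and exceed the moduli of those of \<open>z\<close>; the constant is read off at the fixed
  diagonal point \<open>u t0\<close>.\<close>

lemma homog_all_monomial:
  assumes hom: "\<And>i. homog s i (k i) g" and s: "s > 0"
  shows "\<exists>c. \<forall>z\<in>ball 0 s. g z = c * zpow k z"
proof -
  define u where "u = (\<lambda>t::real. \<chi> i::'a. complex_of_real t)"
  have un: "norm (u t) = \<bar>t\<bar> * norm (u 1)" for t
  proof -
    have "u t = t *\<^sub>R u 1" by (simp add: u_def vec_eq_iff scaleR_conv_of_real[where 'a = complex])
    then show ?thesis by (metis norm_scaleR)
  qed
  define t0 where "t0 = s / (norm (u 1) + 1)"
  have npos: "norm (u 1) + 1 > 0" by (simp add: add_nonneg_pos)
  have t0: "t0 > 0" "u t0 \<in> ball 0 s"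
  proof -
    show pos: "t0 > 0" using s npos by (simp add: t0_def)
    have "t0 * (norm (u 1) + 1) = s" using npos by (simp add: t0_def)
    then show "u t0 \<in> ball 0 s" using un[of t0] pos by (simp add: distrib_left)
  qed
  have main: "g z * of_real t0 ^ (\<Sum>i\<in>UNIV. k i) = g (u t0) * zpow k z" if z: "z \<in> ball 0 s" for z
  proof -
    \<comment> \<open>Enlarging every modulus by this \<open>d\<close> raises the norm by at most
      \<open>norm (u d)\<close>, which is less than \<open>s - norm z\<close>.\<close>
    define d where "d = (s - norm z) / (norm (u 1) + 1)"
    have d: "d > 0" using z npos by (simp add: d_def)
    define w where "w = (\<chi> i. complex_of_real (cmod (z $ i) + d))"
    have "w = (\<chi> i. complex_of_real (cmod (z $ i))) + u d"
      by (simp add: w_def u_def vec_eq_iff)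
    then have "norm w \<le> norm (\<chi> i. complex_of_real (cmod (z $ i))) + norm (u d)"
      by (simp add: norm_triangle_ineq)
    also have "norm (\<chi> i. complex_of_real (cmod (z $ i))) = norm z"
      by (simp add: norm_vec_def L2_set_def)
    also have "norm (u d) < s - norm z"
    proof -
      have "d * (norm (u 1) + 1) = s - norm z" using npos by (simp add: d_def)
      then show ?thesis using un[of d] d by (simp add: distrib_left)
    qed
    finally have w: "w \<in> ball 0 s" by simp
    have wpos: "cmod (z $ i) + d > 0" for i using d by (simp add: add_nonneg_pos)
    define W where "W = (\<Prod>i\<in>UNIV. (w $ i) ^ k i)"
    have W: "W \<noteq> 0" using wpos by (simp add: W_def w_def less_imp_neq[symmetric] del: of_real_add)
    \<comment> \<open>The point \<open>u t\<close> links the two sides: it lies below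
      \<open>w\<close> in every coordinate because \<open>t \<le> d\<close>, and below
      \<open>u t0\<close> because \<open>t \<le> t0\<close>.\<close>
    define t where "t = min d t0"
    have t: "0 < t" "t \<le> d" "t \<le> t0" using d t0 by (auto simp: t_def)
    have scale: "g v * W = zpow k v * g w" if v: "\<And>i. cmod (v $ i) \<le> cmod (w $ i)" for v
    proof -
      have "g (\<chi> i. (v $ i / w $ i) * w $ i) = (\<Prod>i\<in>UNIV. (v $ i / w $ i) ^ k i) * g w"
        using v wpos by (intro homog_all_scale[OF hom w]) (auto simp: norm_divide divide_le_eq_1)
      moreover have "w $ i \<noteq> 0" for i using wpos[of i] by (simp add: w_def del: of_real_add)
      then have "(\<chi> i. (v $ i / w $ i) * w $ i) = v" by (simp add: vec_eq_iff)
      ultimately have "g v = (\<Prod>i\<in>UNIV. (v $ i / w $ i) ^ k i) * g w" by simp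
      also have "(\<Prod>i\<in>UNIV. (v $ i / w $ i) ^ k i) = zpow k v / W"
        by (simp add: W_def zpow_def power_divide prod_dividef)
      finally show ?thesis using W by simp
    qed
    have 1: "g z * W = zpow k z * g w"
      using d by (intro scale) (simp add: w_def del: of_real_add)
    have 2: "g (u t) * W = zpow k (u t) * g w"
      using t by (intro scale) (simp add: w_def u_def add_increasing del: of_real_add)
    have "g (\<chi> i. of_real (t / t0) * u t0 $ i) = (\<Prod>i\<in>UNIV. of_real (t / t0) ^ k i) * g (u t0)"
      using t t0 by (intro homog_all_scale[OF hom]) (auto simp: norm_divide)
    moreover have "(\<chi> i. of_real (t / t0) * u t0 $ i) = u t"
      using t0 by (simp add: u_def vec_eq_iff)
    ultimately have 3: "g (u t) * of_real t0 ^ (\<Sum>i\<in>UNIV. k i) = of_real t ^ (\<Sum>i\<in>UNIV. k i) * g (u t0)"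
      using t0 by (simp add: power_sum power_divide prod_dividef)
    have 4: "zpow k (u t) = of_real t ^ (\<Sum>i\<in>UNIV. k i)"
      by (simp add: zpow_def u_def power_sum)
    let ?K = "\<Sum>i\<in>UNIV. k i"
    have "(of_real t ^ ?K * W) * (g z * of_real t0 ^ ?K) = (of_real t ^ ?K * g w) * (zpow k z * of_real t0 ^ ?K)"
      using 1 by (simp add: mult_ac)
    also have "of_real t ^ ?K * g w = g (u t) * W" using 2 4 by simp
    also have "g (u t) * W * (zpow k z * of_real t0 ^ ?K) = (of_real t ^ ?K * W) * (g (u t0) * zpow k z)"
      using 3 by (simp add: mult_ac)
    finally show ?thesis using t W by simp
  qed
  have "g z = (g (u t0) / of_real t0 ^ (\<Sum>i\<in>UNIV. k i)) * zpow k z" if "z \<in> ball 0 s" for z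
    using main[OF that] t0 by (simp add: field_simps)
  then show ?thesis by blast
qed

inductive_set zpolys :: "(complex ^ 'd::finite \<Rightarrow> complex) set" where
  zero: "(\<lambda>z. 0) \<in> zpolys"
| add: "p \<in> zpolys \<Longrightarrow> (\<lambda>z. p z + c * zpow k z) \<in> zpolys"

lemma zpolys_add: "q \<in> zpolys \<Longrightarrow> p \<in> zpolys \<Longrightarrow> (\<lambda>z. p z + q z) \<in> zpolys"
proof (induction q rule: zpolys.induct)
  case (add q c k)
  from zpolys.add[OF add.IH[OF add.prems], of c k] show ?case by (simp add: add.assoc)
qed auto

lemma zpolys_monomial: "(\<lambda>z. c * zpow k z) \<in> zpolys"
  using zpolys.add[OF zpolys.zero, of c k] by simp

lemma zpolys_sum: "finite I \<Longrightarrow> (\<And>i. i \<in> I \<Longrightarrow> p i \<in> zpolys) \<Longrightarrow> (\<lambda>z. \<Sum>i\<in>I. p i z) \<in> zpolys"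
  by (induction I rule: finite_induct) (auto intro: zpolys.zero zpolys_add)

text \<open>Induction on a set \<open>J\<close> outside which \<open>g\<close> is homogeneous. Each
  step expands in one coordinate of \<open>J\<close>, keeps finitely many components and
  approximates each with a share of the error; once \<open>J\<close> is empty, \<open>g\<close> is a
  monomial. Starting with \<open>UNIV\<close> requires no homogeneity.\<close>

lemma zpolys_approx_cls:
  assumes s: "1 < s"
  shows "cls s M g \<Longrightarrow> (\<And>i. i \<notin> J \<Longrightarrow> \<exists>k. homog s i k g) \<Longrightarrow> \<epsilon> > 0 \<Longrightarrow>
    \<exists>p\<in>zpolys. \<forall>z\<in>ball 0 1. cmod (g z - p z) \<le> \<epsilon>"
proof (induction J arbitrary: g \<epsilon> rule: finite_induct[OF finite])
  case 1
  then obtain k where k: "\<And>i. homog s i (k i) g" by (metis empty_iff)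
  have "0 < s" using s by simp
  from homog_all_monomial[OF k this] obtain c where c: "\<forall>z\<in>ball 0 s. g z = c * zpow k z" by (rule exE)
  have "cmod (g z - c * zpow k z) \<le> \<epsilon>" if "z \<in> ball 0 1" for z
    using c[rule_format, of z] that s 1 by simp
  then show ?case by (intro bexI[of _ "\<lambda>z. c * zpow k z"] zpolys_monomial ballI)
next
  case (2 i J)
  obtain L where L: "\<And>z. z \<in> ball 0 1 \<Longrightarrow> cmod (g z - (\<Sum>l<L. component i l g z)) \<le> \<epsilon> / 2"
    using component_approx[OF 2(4) s, of "\<epsilon> / 2" i] 2(6) by auto
  have "\<exists>p\<in>zpolys. \<forall>z\<in>ball 0 1. cmod (component i l g z - p z) \<le> \<epsilon> / 2 / (real L + 1)" for l
  proof (rule 2(3))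
    show "cls s M (component i l g)" by (rule component_cls[OF 2(4)])
    show "\<exists>k. homog s j k (component i l g)" if j: "j \<notin> J" for j
    proof (cases "j = i")
      case True
      then show ?thesis using component_homog[OF 2(4)] by blast
    next
      case False
      then obtain k where k: "homog s j k g" using 2(5)[of j] j by auto
      from component_homog_other[OF 2(4) k False[symmetric]] show ?thesis by (rule exI)
    qed
  qed (use 2(6) in simp)
  then obtain p where p: "\<And>l. p l \<in> zpolys"
    "\<And>l z. z \<in> ball 0 1 \<Longrightarrow> cmod (component i l g z - p l z) \<le> \<epsilon> / 2 / (real L + 1)" by metis
  show ?case
  proof (intro bexI ballI)
    show "(\<lambda>z. \<Sum>l<L. p l z) \<in> zpolys" using p by (intro zpolys_sum) auto
    fix z :: "complex ^ 'a" assume z: "z \<in> ball 0 1"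
    have "cmod ((\<Sum>l<L. component i l g z) - (\<Sum>l<L. p l z)) \<le> (\<Sum>l<L. \<epsilon> / 2 / (real L + 1))"
      unfolding sum_subtractf[symmetric] using p z by (intro sum_norm_le) auto
    also have "\<dots> \<le> \<epsilon> / 2" using 2(6) by (simp add: field_simps)
    finally show "cmod (g z - (\<Sum>l<L. p l z)) \<le> \<epsilon>"
      using L[OF z] norm_triangle_ineq[of "g z - (\<Sum>l<L. component i l g z)"
        "(\<Sum>l<L. component i l g z) - (\<Sum>l<L. p l z)"] by simp
  qed
qed

section \<open>Dilations of analytic functions\<close>

lemma analytic_on_ball_continuous: "analytic_on_ball f \<Longrightarrow> continuous_on (ball 0 1) f"
  unfolding analytic_on_ball_def
  by (meson continuous_at_imp_continuous_on has_derivative_continuous)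

text \<open>For \<open>r * s < 1\<close> the dilated points lie in a compact subset of the unit
  ball, where \<open>f\<close> is bounded. Complex linearity of the total derivative makes each
  coordinate slice complex differentiable.\<close>

lemma dilation_cls:
  fixes f :: "'d::finite hfun"
  assumes f: "analytic_on_ball f" and r: "0 < r" "r * s < 1"
  shows "\<exists>M. cls s M (\<lambda>z. f (r *\<^sub>R z))"
proof -
  have sub: "cball (0::complex^'d) (r * s) \<subseteq> ball 0 1" using r by auto
  have "compact (f ` cball 0 (r * s))"
    using continuous_on_subset[OF analytic_on_ball_continuous[OF f] sub] by (intro compact_continuous_image) auto
  then obtain M where M: "\<And>z. z \<in> cball 0 (r * s) \<Longrightarrow> cmod (f z) \<le> M"
    by (meson bounded_iff compact_imp_bounded image_eqI)
  have rz: "r *\<^sub>R z \<in> cball 0 (r * s)" if "z \<in> ball 0 s" for z :: "complex^'d"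
    using that r by simp
  have "(\<lambda>w. f (r *\<^sub>R upd z i w)) field_differentiable at w"
    if w: "upd z i w \<in> ball 0 s" for z i w
  proof -
    obtain D where D: "(f has_derivative D) (at (r *\<^sub>R upd z i w))" and lin: "\<And>c v. D (c *s v) = c * D v"
      using f rz[OF w] sub unfolding analytic_on_ball_def by blast
    have "((\<lambda>w. upd z i w) has_derivative (\<lambda>h. upd 0 i h)) (at w)"
    proof -
      have "linear (upd (0::complex^'d) i)"
        by (rule linearI) (auto simp: vec_eq_iff)
      then have "((\<lambda>w. upd z i 0 + upd 0 i w) has_derivative (\<lambda>h. 0 + upd 0 i h)) (at w)"
        by (intro has_derivative_add has_derivative_const bounded_linear_imp_has_derivative)
          (simp add: linear_conv_bounded_linear)
      moreover have "(\<lambda>w. upd z i 0 + upd 0 i w) = upd z i"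
        by (simp add: fun_eq_iff vec_eq_iff)
      ultimately show ?thesis by simp
    qed
    then have "((\<lambda>w. r *\<^sub>R upd z i w) has_derivative (\<lambda>h. r *\<^sub>R upd 0 i h)) (at w)"
      by (rule has_derivative_scaleR_right)
    from diff_chain_at[OF this D]
    have der: "((\<lambda>w. f (r *\<^sub>R upd z i w)) has_derivative (\<lambda>h. D (r *\<^sub>R upd 0 i h))) (at w)"
      by (simp only: o_def)
    have eq: "r *\<^sub>R upd 0 i h = h *s (r *\<^sub>R upd (0::complex^'d) i 1)" for h
      by (simp add: vec_eq_iff)
    have "(\<lambda>h. D (r *\<^sub>R upd 0 i h)) = (*) (D (r *\<^sub>R upd 0 i 1))"
      by (rule ext, subst eq, subst lin) (rule mult.commute)
    with der have "((\<lambda>w. f (r *\<^sub>R upd z i w)) has_field_derivative D (r *\<^sub>R upd 0 i 1)) (at w)"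
      unfolding has_field_derivative_def by (rule subst[rotated])
    then show ?thesis by (auto simp: field_differentiable_def)
  qed
  then have "(\<lambda>w. f (r *\<^sub>R upd z i w)) holomorphic_on {w. upd z i w \<in> ball 0 s}" for z i
    by (auto simp: holomorphic_on_def intro: field_differentiable_at_within)
  with M rz show ?thesis unfolding cls_def by blast
qed

theorem zpolys_approx_dilation:
  fixes f :: "'d::finite hfun"
  assumes f: "analytic_on_ball f" and r: "0 < r" "r < 1" and \<epsilon>: "\<epsilon> > 0"
  shows "\<exists>p\<in>zpolys. \<forall>z\<in>ball 0 1. cmod (f (r *\<^sub>R z) - p z) \<le> \<epsilon>"
proof -
  obtain s where s: "1 < s" "s < 1 / r" using dense[of 1 "1 / r"] r by (auto simp: field_simps)
  then have "r * s < 1" using r by (simp add: field_simps)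
  then obtain M where "cls s M (\<lambda>z. f (r *\<^sub>R z))" using dilation_cls[OF f r(1)] by blast
  from zpolys_approx_cls[OF s(1) this, of UNIV \<epsilon>] \<epsilon> show ?thesis by simp
qed

section \<open>The Bergman space as an inner product space\<close>

text \<open>A class larger than the Bergman space is needed because \<open>\<phi> f\<close>, before
  projection, is no longer analytic.\<close>

definition L2 :: "nat \<Rightarrow> 'd::finite hfun \<Rightarrow> bool" where
  "L2 n f \<longleftrightarrow> f \<in> borel_measurable borel \<and> integrable (dV n) (\<lambda>z. (cmod (f z))\<^sup>2)"

lemma measurable_dV_iff: "f \<in> borel_measurable (dV n) \<longleftrightarrow> f \<in> borel_measurable borel"
  by (rule measurable_cong_sets[THEN arg_cong[where f = "(\<in>) f"]]) simp_all

lemma L2_measurable: "L2 n f \<Longrightarrow> f \<in> borel_measurable borel"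
  by (simp add: L2_def)

lemma L2_integrable_mult:
  assumes f: "L2 n f" and g: "L2 n g"
  shows "integrable (dV n) (\<lambda>z. f z * cnj (g z))"
proof (rule Bochner_Integration.integrable_bound)
  show "integrable (dV n) (\<lambda>z. (cmod (f z))\<^sup>2 + (cmod (g z))\<^sup>2)"
    using assms by (intro Bochner_Integration.integrable_add) (auto simp: L2_def)
  have [measurable]: "f \<in> borel_measurable borel" "g \<in> borel_measurable borel"
    using assms by (auto simp: L2_def)
  have "cnj \<in> borel_measurable borel"
    by (intro borel_measurable_continuous_onI continuous_intros)
  then have "(\<lambda>z. cnj (g z)) \<in> borel_measurable borel"
    by (rule measurable_compose[rotated]) simp
  then show "(\<lambda>z. f z * cnj (g z)) \<in> borel_measurable (dV n)"
    unfolding measurable_dV_iff by measurable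
  have "cmod (f z * cnj (g z)) \<le> (cmod (f z))\<^sup>2 + (cmod (g z))\<^sup>2" for z
  proof -
    have "2 * (cmod (f z) * cmod (g z)) \<le> (cmod (f z))\<^sup>2 + (cmod (g z))\<^sup>2"
      using sum_squares_bound[of "cmod (f z)" "cmod (g z)"] by (simp add: power2_eq_square mult_ac)
    moreover have "0 \<le> cmod (f z) * cmod (g z)" by simp
    ultimately show ?thesis unfolding norm_mult complex_mod_cnj by linarith
  qed
  then show "AE z in dV n. norm (f z * cnj (g z)) \<le> norm ((cmod (f z))\<^sup>2 + (cmod (g z))\<^sup>2)"
    by (intro AE_I2) (simp add: abs_of_nonneg)
qed

lemma L2_add:
  assumes f: "L2 n f" and g: "L2 n g"
  shows "L2 n (f + g)"
  unfolding L2_def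
proof
  have [measurable]: "f \<in> borel_measurable borel" "g \<in> borel_measurable borel"
    using assms by (auto simp: L2_def)
  show meas: "f + g \<in> borel_measurable borel" unfolding plus_fun_def by measurable
  have [measurable]: "(\<lambda>z. f z + g z) \<in> borel_measurable borel" by measurable
  show "integrable (dV n) (\<lambda>z. (cmod ((f + g) z))\<^sup>2)"
  proof (rule Bochner_Integration.integrable_bound)
    show "integrable (dV n) (\<lambda>z. 2 * (cmod (f z))\<^sup>2 + 2 * (cmod (g z))\<^sup>2)"
      using assms by (intro Bochner_Integration.integrable_add integrable_mult_right) (auto simp: L2_def)
    show "(\<lambda>z. (cmod ((f + g) z))\<^sup>2) \<in> borel_measurable (dV n)"
      unfolding measurable_dV_iff plus_fun_def by measurable
    have "(cmod (f z + g z))\<^sup>2 \<le> 2 * (cmod (f z))\<^sup>2 + 2 * (cmod (g z))\<^sup>2" for z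
    proof -
      have "(cmod (f z + g z))\<^sup>2 \<le> (cmod (f z) + cmod (g z))\<^sup>2"
        by (intro power_mono norm_triangle_ineq) simp
      also have "\<dots> \<le> 2 * (cmod (f z))\<^sup>2 + 2 * (cmod (g z))\<^sup>2"
        using sum_squares_bound[of "cmod (f z)" "cmod (g z)"] by (simp add: power2_eq_square algebra_simps)
      finally show ?thesis .
    qed
    then show "AE z in dV n. norm ((cmod ((f + g) z))\<^sup>2) \<le> norm (2 * (cmod (f z))\<^sup>2 + 2 * (cmod (g z))\<^sup>2)"
      by (intro AE_I2) (simp add: abs_of_nonneg)
  qed
qed

lemma L2_scale: "L2 n f \<Longrightarrow> L2 n (\<lambda>z. c * f z)"
  by (auto simp: L2_def norm_mult power_mult_distrib)

lemma L2_uminus: "L2 n f \<Longrightarrow> L2 n (- f)"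
  using L2_scale[of n f "-1"] by (simp add: fun_Compl_def)

lemma L2_diff: "L2 n f \<Longrightarrow> L2 n g \<Longrightarrow> L2 n (f - g)"
  using L2_add[of n f "- g"] L2_uminus[of n g] by simp

lemma L2_zero: "L2 n 0"
  by (simp add: L2_def zero_fun_def)

lemma ip_add_left: "L2 n f \<Longrightarrow> L2 n g \<Longrightarrow> L2 n h \<Longrightarrow> ip n (f + g) h = ip n f h + ip n g h"
  by (simp add: ip_def distrib_right L2_integrable_mult)

lemma ip_diff_left: "L2 n f \<Longrightarrow> L2 n g \<Longrightarrow> L2 n h \<Longrightarrow> ip n (f - g) h = ip n f h - ip n g h"
  by (simp add: ip_def left_diff_distrib L2_integrable_mult)

lemma ip_scale_left: "ip n (\<lambda>z. c * f z) h = c * ip n f h"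
  by (simp add: ip_def mult.assoc)

lemma ip_cnj: "ip n g f = cnj (ip n f g)"
  unfolding ip_def by (subst Bochner_Integration.integral_cnj[symmetric]) (simp add: mult.commute)

lemma ip_add_right: "L2 n f \<Longrightarrow> L2 n g \<Longrightarrow> L2 n h \<Longrightarrow> ip n h (f + g) = ip n h f + ip n h g"
  by (subst (1 2 3) ip_cnj) (simp add: ip_add_left)

lemma ip_diff_right: "L2 n f \<Longrightarrow> L2 n g \<Longrightarrow> L2 n h \<Longrightarrow> ip n h (f - g) = ip n h f - ip n h g"
  by (subst (1 2 3) ip_cnj) (simp add: ip_diff_left)

lemma ip_scale_right: "ip n h (\<lambda>z. c * f z) = cnj c * ip n h f"
  by (subst (1 2) ip_cnj) (simp add: ip_scale_left)

lemma ip_zero [simp]: "ip n 0 f = 0" "ip n f 0 = 0"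
  by (simp_all add: ip_def)

lemma ip_self: "ip n f f = of_real (\<integral>z. (cmod (f z))\<^sup>2 \<partial>dV n)"
  unfolding ip_def by (simp add: complex_norm_square[symmetric] flip: of_real_power)

lemma hnorm_sq: "(hnorm n f)\<^sup>2 = (\<integral>z. (cmod (f z))\<^sup>2 \<partial>dV n)"
  by (simp add: hnorm_def ip_self)

lemma hnorm_nonneg [simp]: "0 \<le> hnorm n f"
  by (simp add: hnorm_def ip_self)

lemma ip_self_hnorm: "ip n f f = of_real ((hnorm n f)\<^sup>2)"
  by (simp add: ip_self hnorm_sq)

lemma hnorm_scale: "hnorm n (\<lambda>z. c * f z) = cmod c * hnorm n f"
proof -
  have "(hnorm n (\<lambda>z. c * f z))\<^sup>2 = (cmod c * hnorm n f)\<^sup>2"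
    by (simp add: hnorm_sq power_mult_distrib norm_mult)
  then show ?thesis by (subst (asm) power2_eq_iff_nonneg) auto
qed

lemma hnorm_uminus: "hnorm n (- f) = hnorm n f"
  by (simp add: hnorm_def ip_def)

lemma hnorm_minus_commute: "hnorm n (f - g) = hnorm n (g - f)"
  using hnorm_uminus[of n "f - g"] by simp

lemma hnorm_zero [simp]: "hnorm n 0 = 0"
  by (simp add: hnorm_def)

lemma hnorm_expand:
  assumes f: "L2 n f" and g: "L2 n g"
  shows "(hnorm n (f - (\<lambda>z. c * g z)))\<^sup>2
    = (hnorm n f)\<^sup>2 - 2 * Re (cnj c * ip n f g) + (cmod c)\<^sup>2 * (hnorm n g)\<^sup>2"
proof -
  have cg: "L2 n (\<lambda>z. c * g z)" by (rule L2_scale[OF g])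
  have "ip n (f - (\<lambda>z. c * g z)) (f - (\<lambda>z. c * g z))
      = ip n f f - cnj c * ip n f g - (c * cnj (ip n f g) - c * (cnj c * ip n g g))"
    using f g cg L2_diff[OF f cg]
    by (simp add: ip_diff_left ip_diff_right ip_scale_left ip_scale_right ip_cnj[of n g f] algebra_simps)
  then have "Re (ip n (f - (\<lambda>z. c * g z)) (f - (\<lambda>z. c * g z)))
      = Re (ip n f f) - 2 * Re (cnj c * ip n f g) + Re (c * cnj c * ip n g g)"
    by (simp only:) (simp add: algebra_simps)
  then show ?thesis
    by (simp add: ip_self_hnorm complex_norm_square[symmetric] flip: of_real_power of_real_mult)
qed

text \<open>The expansion of the squared norm is a nonnegative quadratic in \<open>t\<close> along
  \<open>c = t * a\<close>, where \<open>a\<close> is the inner product. On \<open>L2\<close> the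
  norm is only a seminorm, so \<open>hnorm n g = 0\<close> is a real case: there the quadratic
  degenerates to a linear function, which a large \<open>t\<close> makes negative unless
  \<open>a = 0\<close>.\<close>

lemma Cauchy_Schwarz:
  assumes f: "L2 n f" and g: "L2 n g"
  shows "cmod (ip n f g) \<le> hnorm n f * hnorm n g"
proof -
  define a where "a = ip n f g"
  have *: "0 \<le> (hnorm n f)\<^sup>2 - 2 * Re (cnj c * a) + (cmod c)\<^sup>2 * (hnorm n g)\<^sup>2" for c
    unfolding a_def hnorm_expand[OF f g, symmetric] by simp
  have **: "0 \<le> (hnorm n f)\<^sup>2 - 2 * t * (cmod a)\<^sup>2 + t\<^sup>2 * (cmod a)\<^sup>2 * (hnorm n g)\<^sup>2" for t
  proof -
    have "cnj (of_real t * a) * a = of_real (t * (cmod a)\<^sup>2)"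
      by (simp add: complex_norm_square mult.commute mult.assoc del: of_real_power)
    then have "Re (cnj (of_real t * a) * a) = t * (cmod a)\<^sup>2" by (simp only: Re_complex_of_real)
    then show ?thesis using *[of "of_real t * a"] by (simp add: norm_mult power_mult_distrib)
  qed
  have "(cmod a)\<^sup>2 \<le> (hnorm n f * hnorm n g)\<^sup>2"
  proof (cases "hnorm n g = 0")
    case True
    have "(cmod a)\<^sup>2 = 0"
    proof (rule ccontr)
      assume na: "(cmod a)\<^sup>2 \<noteq> 0"
      have "0 \<le> (hnorm n f)\<^sup>2 - 2 * (((hnorm n f)\<^sup>2 + 1) / (cmod a)\<^sup>2) * (cmod a)\<^sup>2"
        using **[of "((hnorm n f)\<^sup>2 + 1) / (cmod a)\<^sup>2"] True by simp
      with na have "0 \<le> (hnorm n f)\<^sup>2 - 2 * ((hnorm n f)\<^sup>2 + 1)" by simp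
      moreover have "\<not> 0 \<le> x - 2 * (x + 1)" if "0 \<le> x" for x :: real using that by simp
      ultimately show False by (meson zero_le_power2)
    qed
    then show ?thesis by simp
  next
    case False
    define b where "b = (hnorm n g)\<^sup>2"
    have b: "b > 0" using False by (simp add: b_def)
    have "0 \<le> (hnorm n f)\<^sup>2 - 2 * (1 / b) * (cmod a)\<^sup>2 + (1 / b)\<^sup>2 * (cmod a)\<^sup>2 * b"
      using **[of "1 / b"] by (simp only: b_def)
    also have "\<dots> = (hnorm n f)\<^sup>2 - (cmod a)\<^sup>2 / b"
      using b by (simp add: power2_eq_square)
    finally show ?thesis using b by (simp add: b_def[symmetric] power_mult_distrib field_simps)
  qed
  then show ?thesis unfolding a_def by (rule power2_le_imp_le) simp
qed

lemma hnorm_triangle: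
  assumes f: "L2 n f" and g: "L2 n g"
  shows "hnorm n (f + g) \<le> hnorm n f + hnorm n g"
proof (rule power2_le_imp_le)
  have eq: "f + g = f - (\<lambda>z. (-1) * g z)" by (simp add: fun_eq_iff)
  have "(hnorm n (f + g))\<^sup>2 = (hnorm n f)\<^sup>2 + 2 * Re (ip n f g) + (hnorm n g)\<^sup>2"
    unfolding eq hnorm_expand[OF f g] by simp
  also have "\<dots> \<le> (hnorm n f)\<^sup>2 + 2 * (hnorm n f * hnorm n g) + (hnorm n g)\<^sup>2"
    using order_trans[OF complex_Re_le_cmod Cauchy_Schwarz[OF f g]] by simp
  finally show "(hnorm n (f + g))\<^sup>2 \<le> (hnorm n f + hnorm n g)\<^sup>2"
    by (simp add: power2_sum algebra_simps)
qed simp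

lemma hnorm_triangle_diff:
  assumes f: "L2 n f" and g: "L2 n g"
  shows "hnorm n (f - g) \<le> hnorm n f + hnorm n g"
  using hnorm_triangle[OF f L2_uminus[OF g]] by (simp add: hnorm_uminus)

section \<open>Analytic functions within the square integrable ones\<close>

lemma bergman_analytic: "f \<in> bergman n \<Longrightarrow> analytic_on_ball f"
  and bergman_outside: "f \<in> bergman n \<Longrightarrow> z \<notin> ball 0 1 \<Longrightarrow> f z = 0"
  by (auto simp: bergman_def)

lemma continuous_on_ball_measurable:
  fixes f :: "'d::finite hfun"
  assumes f: "continuous_on (ball 0 1) f" and "\<And>z. z \<notin> ball 0 1 \<Longrightarrow> f z = 0"
  shows "f \<in> borel_measurable borel"
proof -
  have "(\<lambda>z. indicator (ball 0 1) z *\<^sub>R f z) \<in> borel_measurable borel"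
    by (intro borel_measurable_continuous_on_indicator f) auto
  also have "(\<lambda>z. indicator (ball 0 1) z *\<^sub>R f z) = f"
    using assms(2) by (auto simp: fun_eq_iff indicator_def)
  finally show ?thesis .
qed

lemma bergman_L2: "f \<in> bergman n \<Longrightarrow> L2 n f"
  unfolding L2_def
  by (auto simp: bergman_def intro!: continuous_on_ball_measurable analytic_on_ball_continuous)

lemma bergmanI:
  "analytic_on_ball f \<Longrightarrow> (\<And>z. z \<notin> ball 0 1 \<Longrightarrow> f z = 0) \<Longrightarrow> L2 n f \<Longrightarrow> f \<in> bergman n"
  by (simp add: bergman_def L2_def)

lemma analytic_on_ball_add:
  assumes "analytic_on_ball f" "analytic_on_ball g"
  shows "analytic_on_ball (f + g)"
  unfolding analytic_on_ball_def
proof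
  fix z :: "complex ^ 'a" assume z: "z \<in> ball 0 1"
  obtain D where D: "(f has_derivative D) (at z)" "\<And>c v. D (c *s v) = c * D v"
    using assms(1) z unfolding analytic_on_ball_def by blast
  obtain E where E: "(g has_derivative E) (at z)" "\<And>c v. E (c *s v) = c * E v"
    using assms(2) z unfolding analytic_on_ball_def by blast
  have "(f + g has_derivative (\<lambda>h. D h + E h)) (at z)"
    using has_derivative_add[OF D(1) E(1)] by (simp add: plus_fun_def)
  then show "\<exists>D. (f + g has_derivative D) (at z) \<and> (\<forall>c v. D (c *s v) = c * D v)"
    using D E by (intro exI[of _ "\<lambda>h. D h + E h"]) (simp add: distrib_left)
qed

lemma analytic_on_ball_mult:
  assumes "analytic_on_ball f" "analytic_on_ball g"
  shows "analytic_on_ball (\<lambda>z. f z * g z)"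
  unfolding analytic_on_ball_def
proof
  fix z :: "complex ^ 'a" assume z: "z \<in> ball 0 1"
  obtain D where D: "(f has_derivative D) (at z)" "\<And>c v. D (c *s v) = c * D v"
    using assms(1) z unfolding analytic_on_ball_def by blast
  obtain E where E: "(g has_derivative E) (at z)" "\<And>c v. E (c *s v) = c * E v"
    using assms(2) z unfolding analytic_on_ball_def by blast
  show "\<exists>D. ((\<lambda>z. f z * g z) has_derivative D) (at z) \<and> (\<forall>c v. D (c *s v) = c * D v)"
    using has_derivative_mult[OF D(1) E(1)] D E
    by (intro exI[of _ "\<lambda>h. f z * E h + D h * g z"]) (simp add: algebra_simps)
qed

lemma analytic_on_ball_const: "analytic_on_ball (\<lambda>z. c)"
  unfolding analytic_on_ball_def by (intro ballI exI[of _ "\<lambda>_. 0"]) auto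

lemma analytic_on_ball_nth: "analytic_on_ball (\<lambda>z. z $ i)"
  unfolding analytic_on_ball_def
  by (intro ballI exI[of _ "\<lambda>h. h $ i"] conjI bounded_linear_imp_has_derivative bounded_linear_vec_nth) simp

lemma analytic_on_ball_power: "analytic_on_ball f \<Longrightarrow> analytic_on_ball (\<lambda>z. f z ^ m)"
  by (induction m) (auto intro: analytic_on_ball_const analytic_on_ball_mult)

lemma analytic_on_ball_sum:
  "finite I \<Longrightarrow> (\<And>i. i \<in> I \<Longrightarrow> analytic_on_ball (f i)) \<Longrightarrow> analytic_on_ball (\<lambda>z. \<Sum>i\<in>I. f i z)"
proof (induction I rule: finite_induct)
  case (insert i I)
  then show ?case using analytic_on_ball_add[of "f i" "\<lambda>z. \<Sum>i\<in>I. f i z"] by (simp add: plus_fun_def)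
qed (simp add: analytic_on_ball_const)

lemma analytic_on_ball_prod:
  "finite I \<Longrightarrow> (\<And>i. i \<in> I \<Longrightarrow> analytic_on_ball (f i)) \<Longrightarrow> analytic_on_ball (\<lambda>z. \<Prod>i\<in>I. f i z)"
  by (induction I rule: finite_induct) (auto intro: analytic_on_ball_const analytic_on_ball_mult)

lemma analytic_on_ball_cong:
  assumes f: "analytic_on_ball f" and eq: "\<And>z. z \<in> ball 0 1 \<Longrightarrow> f z = g z"
  shows "analytic_on_ball g"
  unfolding analytic_on_ball_def
proof
  fix z :: "complex ^ 'a" assume z: "z \<in> ball 0 1"
  obtain D where D: "(f has_derivative D) (at z)" "\<And>c v. D (c *s v) = c * D v"
    using f z unfolding analytic_on_ball_def by blast
  have "(g has_derivative D) (at z)"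
    by (rule has_derivative_transform_within_open[OF D(1) open_ball z]) (rule eq)
  with D(2) show "\<exists>D. (g has_derivative D) (at z) \<and> (\<forall>c v. D (c *s v) = c * D v)" by blast
qed

lemma bergman_zero: "0 \<in> bergman n"
  using analytic_on_ball_const[of 0] L2_zero[of n] by (intro bergmanI) (auto simp: zero_fun_def)

lemma bergman_add: "f \<in> bergman n \<Longrightarrow> g \<in> bergman n \<Longrightarrow> f + g \<in> bergman n"
  by (rule bergmanI) (simp_all add: analytic_on_ball_add L2_add bergman_L2 bergman_analytic bergman_outside)

lemma bergman_scale: "f \<in> bergman n \<Longrightarrow> (\<lambda>z. c * f z) \<in> bergman n"
  by (rule bergmanI)
    (simp_all add: analytic_on_ball_mult analytic_on_ball_const L2_scale bergman_L2 bergman_analytic bergman_outside)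

lemma bergman_diff: "f \<in> bergman n \<Longrightarrow> g \<in> bergman n \<Longrightarrow> f - g \<in> bergman n"
  using bergman_add[of f n "\<lambda>z. (-1) * g z"] bergman_scale[of g n "-1"] by (simp add: plus_fun_def fun_diff_def)

lemma dV_finite: "n \<ge> CARD('d) \<Longrightarrow> finite_measure (dV n :: (complex ^ 'd::finite) measure)"
  by (rule finite_measureI) (simp add: emeasure_dV_UNIV)

lemma L2_bounded:
  fixes f :: "'d::finite hfun"
  assumes n: "n \<ge> CARD('d)" and "f \<in> borel_measurable borel" "\<And>z. cmod (f z) \<le> M"
  shows "L2 n f"
  unfolding L2_def
proof
  interpret finite_measure "dV n :: (complex ^ 'd) measure" by (rule dV_finite[OF n])
  have [measurable]: "f \<in> borel_measurable borel" by fact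
  have "\<bar>(cmod (f z))\<^sup>2\<bar> \<le> M\<^sup>2" for z
    using power_mono[OF assms(3)[of z], of 2] by simp
  then show "integrable (dV n) (\<lambda>z. (cmod (f z))\<^sup>2)"
    by (intro integrable_const_bound[of _ "M\<^sup>2"] AE_I2)
      (auto simp: measurable_dV_iff)
qed fact

definition on_ball :: "'d::finite hfun \<Rightarrow> 'd hfun" where
  "on_ball f = (\<lambda>z. if z \<in> ball 0 1 then f z else 0)"

lemma on_ball_bergman:
  fixes f :: "'d::finite hfun"
  assumes n: "n \<ge> CARD('d)" and f: "analytic_on_ball f" and b: "\<And>z. z \<in> ball 0 1 \<Longrightarrow> cmod (f z) \<le> M"
  shows "on_ball f \<in> bergman n"
proof (rule bergmanI)
  show a: "analytic_on_ball (on_ball f)"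
    by (rule analytic_on_ball_cong[OF f]) (simp add: on_ball_def)
  show "on_ball f z = 0" if "z \<notin> ball 0 1" for z using that by (simp add: on_ball_def)
  then have "on_ball f \<in> borel_measurable borel"
    by (intro continuous_on_ball_measurable analytic_on_ball_continuous a)
  moreover have "cmod (on_ball f z) \<le> \<bar>M\<bar>" for z
    using b[of z] by (auto simp: on_ball_def)
  ultimately show "L2 n (on_ball f)" using n by (intro L2_bounded)
qed

lemma analytic_on_ball_zpow: "analytic_on_ball (zpow k)"
  unfolding zpow_def
  by (intro analytic_on_ball_prod analytic_on_ball_power analytic_on_ball_nth) simp

lemma emeasure_dV_pos:
  fixes U :: "(complex ^ 'd::finite) set"
  assumes U: "open U" "U \<noteq> {}" "U \<subseteq> ball 0 1"
  shows "emeasure (dV n) U > 0"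
proof (rule ccontr)
  define w where "w = (\<lambda>z::complex^'d. ennreal (indicator (ball 0 1) z *
     (fact n / (fact (n - CARD('d)) * pi ^ CARD('d)) * (1 - (norm z)\<^sup>2) ^ (n - CARD('d)))))"
  have dV: "dV n = density lborel w" by (simp add: dV_def w_def)
  have [measurable]: "w \<in> borel_measurable borel" unfolding w_def by measurable
  have [measurable]: "U \<in> sets borel" using U by simp
  have pos: "w z > 0" if "z \<in> U" for z
  proof -
    have z: "z \<in> ball 0 1" using that U by blast
    then have "1 - (norm z)\<^sup>2 > 0" by (simp add: abs_square_less_1)
    then have "fact n / (fact (n - CARD('d)) * pi ^ CARD('d)) * (1 - (norm z)\<^sup>2) ^ (n - CARD('d)) > 0"
      by simp
    with z show ?thesis by (simp add: w_def ennreal_less_zero_iff)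
  qed
  assume "\<not> emeasure (dV n) U > 0"
  then have "(\<integral>\<^sup>+z. w z * indicator U z \<partial>lborel) = 0"
    by (simp add: dV emeasure_density)
  then have "AE z in lborel. w z * indicator U z = 0"
    by (subst (asm) nn_integral_0_iff_AE) auto
  then have "AE z in lborel. z \<notin> U"
    by eventually_elim (use pos in \<open>force simp: indicator_def split: if_splits\<close>)
  then have "emeasure lborel U = 0"
    by (subst (asm) AE_iff_measurable[where N = U]) auto
  moreover obtain x e where "e > 0" "ball x e \<subseteq> U"
    using U by (meson ex_in_conv openE)
  then have "emeasure lborel (ball x e) \<le> emeasure lborel U" by (intro emeasure_mono) auto
  moreover have "emeasure lborel (ball x e) > 0"
    using \<open>e > 0\<close> unit_ball_vol_pos[of "DIM(complex^'d)"]
    by (simp add: emeasure_ball ennreal_less_zero_iff del: unit_ball_vol_pos)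
  ultimately show False by simp
qed

text \<open>A nonzero value persists on an open set by continuity, and \<open>dV n\<close> charges
  every nonempty open subset of the ball.\<close>

lemma bergman_definite:
  assumes f: "f \<in> bergman n" and 0: "hnorm n f = 0"
  shows "f = 0"
proof (rule ccontr)
  assume "f \<noteq> 0"
  then obtain a where a: "f a \<noteq> 0" by (auto simp: fun_eq_iff)
  then have ab: "a \<in> ball 0 1" using bergman_outside[OF f] by blast
  let ?U = "{z \<in> ball 0 1. f z \<in> - {0}}"
  have "continuous_on (ball 0 1) f" by (intro analytic_on_ball_continuous bergman_analytic[OF f])
  then have "open (ball 0 1 \<inter> f -` (- {0}))" by (rule continuous_open_preimage) auto
  moreover have "ball 0 1 \<inter> f -` (- {0}) = ?U" by auto
  ultimately have oU: "open ?U" by simp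
  have "emeasure (dV n) ?U > 0"
    using a ab by (intro emeasure_dV_pos oU) auto
  moreover have "AE z in dV n. (cmod (f z))\<^sup>2 = 0"
    using bergman_L2[OF f] 0 integral_nonneg_eq_0_iff_AE[of "dV n" "\<lambda>z. (cmod (f z))\<^sup>2"]
    by (simp add: L2_def hnorm_sq[symmetric])
  then have "AE z in dV n. z \<notin> ?U" by eventually_elim auto
  then have "emeasure (dV n) ?U = 0"
    using oU by (subst (asm) AE_iff_measurable[where N = ?U]) auto
  ultimately show False by simp
qed

section \<open>The monomial basis\<close>

lemma monomial_basis_eq:
  "monomial_basis n k = on_ball (\<lambda>z. of_real (sqrt (fact ((\<Sum>i\<in>UNIV. k i) + n) / ((\<Prod>i\<in>UNIV. fact (k i)) * fact n))) * zpow k z)"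
  by (simp add: monomial_basis_def on_ball_def zpow_def)

lemma monomial_basis_bergman:
  fixes k :: "'d::finite \<Rightarrow> nat"
  assumes n: "n \<ge> CARD('d)"
  shows "monomial_basis n k \<in> bergman n"
proof -
  let ?c = "sqrt (fact ((\<Sum>i\<in>UNIV. k i) + n) / ((\<Prod>i\<in>UNIV. fact (k i)) * fact n))"
  have "cmod (of_real ?c * zpow k z) \<le> \<bar>?c\<bar> * 1" if "z \<in> ball 0 1" for z
    unfolding norm_mult norm_of_real
    using that cmod_zpow_le_1[of z k] by (intro mult_left_mono) auto
  then show ?thesis unfolding monomial_basis_eq
    by (intro on_ball_bergman[OF n] analytic_on_ball_mult analytic_on_ball_const analytic_on_ball_zpow)
qed

lemma AE_dV_ball: "AE z in dV n. z \<in> ball (0 :: complex ^ 'd::finite) 1"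
  unfolding dV_def by (subst AE_density, measurable) (auto simp: indicator_def)

lemma ip_on_ball: "ip n (on_ball f) (on_ball g) = (\<integral>z. f z * cnj (g z) \<partial>dV n)"
  if [measurable]: "f \<in> borel_measurable borel" "g \<in> borel_measurable borel" for f g :: "'d::finite hfun"
proof -
  have "cnj \<in> borel_measurable borel"
    by (intro borel_measurable_continuous_onI continuous_intros)
  then have [measurable]: "(\<lambda>z. cnj (g z)) \<in> borel_measurable borel"
    by (rule measurable_compose[rotated]) fact
  have [measurable]: "(\<lambda>z. cnj (on_ball g z)) \<in> borel_measurable borel"
  proof -
    have "(\<lambda>z. if z \<in> ball 0 1 then cnj (g z) else 0) \<in> borel_measurable borel" by measurable
    then show ?thesis by (simp add: on_ball_def if_distrib cong: if_cong)
  qed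
  have [measurable]: "on_ball f \<in> borel_measurable borel" unfolding on_ball_def by measurable
  have "AE z in dV n. on_ball f z * cnj (on_ball g z) = f z * cnj (g z)"
    using AE_dV_ball by eventually_elim (simp add: on_ball_def)
  then show ?thesis
    unfolding ip_def by (intro integral_cong_AE) (simp_all add: measurable_dV_iff)
qed

lemma ip_monomial_basis:
  fixes j k :: "'d::finite \<Rightarrow> nat"
  assumes n: "n \<ge> CARD('d)"
  shows "ip n (monomial_basis n j) (monomial_basis n k) = (if j = k then 1 else 0)"
proof -
  define c where "c = (\<lambda>k::'d \<Rightarrow> nat. sqrt (fact ((\<Sum>i\<in>UNIV. k i) + n) / ((\<Prod>i\<in>UNIV. fact (k i)) * fact n)))"
  have basis: "monomial_basis n k = on_ball (\<lambda>z. of_real (c k) * zpow k z)" for k :: "'d \<Rightarrow> nat"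
    by (simp add: monomial_basis_eq c_def)
  have "ip n (monomial_basis n j) (monomial_basis n k)
      = (\<integral>z. (of_real (c j) * zpow j z) * cnj (of_real (c k) * zpow k z) \<partial>dV n)"
    unfolding basis by (intro ip_on_ball) measurable
  also have "\<dots> = of_real (c j * c k) * (\<integral>z. zpow j z * cnj (zpow k z) \<partial>dV n)"
    by (subst integral_mult_right_zero[symmetric]) (simp add: mult_ac)
  also have "\<dots> = (if j = k then 1 else 0)"
  proof (cases "j = k")
    case True
    have pos: "(\<Prod>i\<in>UNIV. fact (k i) :: real) > 0" by (intro prod_pos) auto
    have "(\<integral>z. zpow k z * cnj (zpow k z) \<partial>dV n) = of_real (\<integral>z. (cmod (zpow k z))\<^sup>2 \<partial>dV n)"
      by (simp add: complex_norm_square[symmetric] flip: of_real_power)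
    also have "(\<integral>z. (cmod (zpow k z))\<^sup>2 \<partial>dV n) = enn2real (\<integral>\<^sup>+z. ennreal ((cmod (zpow k z))\<^sup>2) \<partial>dV n)"
      by (rule integral_eq_nn_integral) (auto simp: measurable_dV_iff)
    also have "\<dots> = fact n * (\<Prod>i\<in>UNIV. fact (k i)) / fact ((\<Sum>i\<in>UNIV. k i) + n)"
      unfolding nn_integral_dV_zpow[OF n] using pos by (intro enn2real_ennreal) auto
    finally have "(\<integral>z. zpow k z * cnj (zpow k z) \<partial>dV n) =
      of_real (fact n * (\<Prod>i\<in>UNIV. fact (k i)) / fact ((\<Sum>i\<in>UNIV. k i) + n))" .
    moreover have "c k * c k = fact ((\<Sum>i\<in>UNIV. k i) + n) / ((\<Prod>i\<in>UNIV. fact (k i)) * fact n)"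
      unfolding c_def using pos by (intro real_sqrt_mult_self[THEN trans] abs_of_nonneg) auto
    ultimately show ?thesis using True pos by (simp flip: of_real_mult)
  next
    case False
    then show ?thesis by (simp add: integral_dV_zpow_orthogonal)
  qed
  finally show ?thesis .
qed

lemma hnorm_le_bound:
  fixes h :: "'d::finite hfun"
  assumes n: "n \<ge> CARD('d)" and h: "L2 n h" and b: "\<And>z. cmod (h z) \<le> \<epsilon>"
  shows "hnorm n h \<le> \<epsilon>"
proof (rule power2_le_imp_le)
  interpret finite_measure "dV n :: (complex ^ 'd) measure" by (rule dV_finite[OF n])
  have [simp]: "measure (dV n) (UNIV :: (complex ^ 'd) set) = 1"
    by (simp add: measure_def emeasure_dV_UNIV[OF n])
  have "(hnorm n h)\<^sup>2 \<le> (\<integral>z. \<epsilon>\<^sup>2 \<partial>(dV n :: (complex ^ 'd) measure))"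
    unfolding hnorm_sq using h b by (intro integral_mono) (auto simp: L2_def power_mono)
  then show "(hnorm n h)\<^sup>2 \<le> \<epsilon>\<^sup>2" by simp
  show "0 \<le> \<epsilon>" using order_trans[OF norm_ge_zero b] .
qed

text \<open>The weight decreases with the norm, so its value at \<open>z\<close> is at most its
  value at \<open>r z\<close>. A change of variables then costs only a Jacobian factor, which tends
  to 1 as \<open>r\<close> tends to 1; this is what \<open>dilation_close\<close> needs.\<close>

lemma dilation_L2:
  fixes f :: "'d::finite hfun"
  assumes f: "f \<in> bergman n" and r: "0 < r" "r < 1"
  shows "L2 n (on_ball (\<lambda>z. f (r *\<^sub>R z)))"
    and "(hnorm n (on_ball (\<lambda>z. f (r *\<^sub>R z))))\<^sup>2 \<le> (1 / r) ^ DIM(complex ^ 'd) * (hnorm n f)\<^sup>2"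
proof -
  define w where "w = (\<lambda>z::complex^'d. ennreal (indicator (ball 0 1) z *
     (fact n / (fact (n - CARD('d)) * pi ^ CARD('d)) * (1 - (norm z)\<^sup>2) ^ (n - CARD('d)))))"
  have dV: "dV n = density lborel w" by (simp add: dV_def w_def)
  have [measurable]: "w \<in> borel_measurable borel" unfolding w_def by measurable
  have [measurable]: "f \<in> borel_measurable borel" using bergman_L2[OF f] by (simp add: L2_def)
  let ?g = "on_ball (\<lambda>z. f (r *\<^sub>R z))"
  have meas [measurable]: "?g \<in> borel_measurable borel"
  proof -
    have [measurable]: "(\<lambda>z. f (r *\<^sub>R z)) \<in> borel_measurable borel" by measurable
    show ?thesis unfolding on_ball_def by measurable
  qed
  have w_mono: "w z \<le> w (r *\<^sub>R z)" if z: "z \<in> ball 0 1" for z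
  proof -
    have le: "norm (r *\<^sub>R z) \<le> norm z"
      using r by (simp add: mult_left_le_one_le)
    then have "(norm (r *\<^sub>R z))\<^sup>2 \<le> (norm z)\<^sup>2" by (intro power_mono) auto
    moreover have "(norm z)\<^sup>2 \<le> 1" using z by (simp add: abs_square_le_1)
    ultimately have "(1 - (norm z)\<^sup>2) ^ (n - CARD('d)) \<le> (1 - (norm (r *\<^sub>R z))\<^sup>2) ^ (n - CARD('d))"
      by (intro power_mono) auto
    moreover have "r *\<^sub>R z \<in> ball 0 1" using le z by simp
    ultimately show ?thesis using z unfolding w_def
      by (intro ennreal_leI) (simp add: mult_left_mono divide_right_mono)
  qed
  have int: "(\<integral>\<^sup>+z. ennreal ((cmod (f z))\<^sup>2) \<partial>dV n) = ennreal ((hnorm n f)\<^sup>2)"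
    using bergman_L2[OF f] unfolding hnorm_sq L2_def by (intro nn_integral_eq_integral) auto
  have "(\<integral>\<^sup>+z. ennreal ((cmod (?g z))\<^sup>2) \<partial>dV n) = (\<integral>\<^sup>+z. w z * ennreal ((cmod (?g z))\<^sup>2) \<partial>lborel)"
    unfolding dV by (subst nn_integral_density) auto
  also have "\<dots> \<le> (\<integral>\<^sup>+z. w (r *\<^sub>R z) * ennreal ((cmod (f (r *\<^sub>R z)))\<^sup>2) \<partial>lborel)"
    using w_mono by (intro nn_integral_mono) (auto simp: on_ball_def intro: mult_right_mono)
  also have "\<dots> = ennreal ((1 / r) ^ DIM(complex ^ 'd)) *
      (ennreal (r ^ DIM(complex ^ 'd)) * (\<integral>\<^sup>+z. w (r *\<^sub>R z) * ennreal ((cmod (f (r *\<^sub>R z)))\<^sup>2) \<partial>lborel))"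
    using r by (simp add: mult.assoc[symmetric] ennreal_mult[symmetric] power_mult_distrib[symmetric])
  also have "ennreal (r ^ DIM(complex ^ 'd)) * (\<integral>\<^sup>+z. w (r *\<^sub>R z) * ennreal ((cmod (f (r *\<^sub>R z)))\<^sup>2) \<partial>lborel)
      = (\<integral>\<^sup>+z. w z * ennreal ((cmod (f z))\<^sup>2) \<partial>lborel)"
    using r by (intro nn_integral_lborel_scale[symmetric]) auto
  also have "\<dots> = ennreal ((hnorm n f)\<^sup>2)"
    unfolding int[symmetric] dV by (subst nn_integral_density) auto
  finally have le: "(\<integral>\<^sup>+z. ennreal ((cmod (?g z))\<^sup>2) \<partial>dV n) \<le> ennreal ((1 / r) ^ DIM(complex ^ 'd) * (hnorm n f)\<^sup>2)"
    using r by (simp add: ennreal_mult)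
  have "integrable (dV n) (\<lambda>z. (cmod (?g z))\<^sup>2)"
  proof (rule integrableI_bounded)
    show "(\<lambda>z. (cmod (?g z))\<^sup>2) \<in> borel_measurable (dV n)" unfolding measurable_dV_iff by measurable
    show "(\<integral>\<^sup>+z. ennreal (norm ((cmod (?g z))\<^sup>2)) \<partial>dV n) < \<infinity>"
      using le_less_trans[OF le] by simp
  qed
  with meas show L: "L2 n ?g" by (simp add: L2_def)
  have "ennreal ((hnorm n ?g)\<^sup>2) = (\<integral>\<^sup>+z. ennreal ((cmod (?g z))\<^sup>2) \<partial>dV n)"
    using L unfolding hnorm_sq L2_def by (intro nn_integral_eq_integral[symmetric]) auto
  with le have "ennreal ((hnorm n ?g)\<^sup>2) \<le> ennreal ((1 / r) ^ DIM(complex ^ 'd) * (hnorm n f)\<^sup>2)" by simp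
  then show "(hnorm n ?g)\<^sup>2 \<le> (1 / r) ^ DIM(complex ^ 'd) * (hnorm n f)\<^sup>2"
    using r by (subst (asm) ennreal_le_iff) auto
qed

text \<open>Fatou's lemma, applied to \<open>2 |f\<^sub>r|\<^sup>2 + 2 |f|\<^sup>2 - |f\<^sub>r - f|\<^sup>2 \<ge> 0\<close> for the dilations \<open>f\<^sub>r z = f (r z)\<close>.\<close>

lemma dilation_close:
  fixes f :: "'d::finite hfun"
  assumes f: "f \<in> bergman n" and \<epsilon>: "\<epsilon> > 0"
  shows "\<exists>r. 0 < r \<and> r < 1 \<and> hnorm n (on_ball (\<lambda>z. f (r *\<^sub>R z)) - f) < \<epsilon>"
proof (rule ccontr)
  assume contra: "\<not> ?thesis"
  define r where "r = (\<lambda>m. 1 - inverse (real (Suc (Suc m))))"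
  have r: "0 < r m" "r m < 1" for m by (auto simp: r_def field_simps)
  have r1: "r \<longlonglongrightarrow> 1"
    using tendsto_diff[OF tendsto_const LIMSEQ_Suc[OF LIMSEQ_inverse_real_of_nat], of 1] by (simp add: r_def)
  define F where "F = (\<lambda>m. on_ball (\<lambda>z. f (r m *\<^sub>R z)))"
  have fL: "L2 n f" by (rule bergman_L2[OF f])
  have FL: "L2 n (F m)" and Fn: "(hnorm n (F m))\<^sup>2 \<le> (1 / r m) ^ DIM(complex ^ 'd) * (hnorm n f)\<^sup>2" for m
    unfolding F_def using dilation_L2[OF f r] by auto
  have big: "\<epsilon> \<le> hnorm n (F m - f)" for m
    using contra r[of m] unfolding F_def by (meson not_le)
  define u where "u = (\<lambda>m z. 2 * (cmod (F m z))\<^sup>2 + 2 * (cmod (f z))\<^sup>2 - (cmod (F m z - f z))\<^sup>2)"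
  define b where "b = (\<lambda>m. 2 * ((1 / r m) ^ DIM(complex ^ 'd) * (hnorm n f)\<^sup>2) + 2 * (hnorm n f)\<^sup>2 - \<epsilon>\<^sup>2)"
  have u0: "0 \<le> u m z" for m z
  proof -
    have "(cmod (F m z - f z))\<^sup>2 \<le> (cmod (F m z) + cmod (f z))\<^sup>2"
      by (intro power_mono norm_triangle_ineq4) simp
    also have "\<dots> \<le> 2 * (cmod (F m z))\<^sup>2 + 2 * (cmod (f z))\<^sup>2"
      using sum_squares_bound[of "cmod (F m z)" "cmod (f z)"] by (simp add: power2_eq_square algebra_simps)
    finally show ?thesis by (simp add: u_def)
  qed
  have dL: "integrable (dV n) (\<lambda>z. (cmod (F m z - f z))\<^sup>2)" for m
    using L2_diff[OF FL fL] by (simp add: L2_def)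
  have ui: "integrable (dV n) (u m)" for m
    unfolding u_def using FL[of m] fL dL[of m] by (auto simp: L2_def)
  have "(\<integral>z. u m z \<partial>dV n) = 2 * (hnorm n (F m))\<^sup>2 + 2 * (hnorm n f)\<^sup>2 - (hnorm n (F m - f))\<^sup>2" for m
    unfolding u_def hnorm_sq using FL[of m] fL dL[of m] by (simp add: L2_def)
  then have ub: "(\<integral>z. u m z \<partial>dV n) \<le> b m" for m
    using Fn[of m] power_mono[OF big[of m] less_imp_le[OF \<epsilon>], of 2] by (simp add: b_def)
  have um: "u m \<in> borel_measurable borel" for m
    using borel_measurable_integrable[OF ui[of m]] by (simp add: measurable_dV_iff)
  have lim: "(\<lambda>m. u m z) \<longlonglongrightarrow> 4 * (cmod (f z))\<^sup>2" for z
  proof -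
    have "(\<lambda>m. F m z) \<longlonglongrightarrow> f z"
    proof (cases "z \<in> ball 0 1")
      case True
      have "isCont f z"
        using True analytic_on_ball_continuous[OF bergman_analytic[OF f]]
        by (simp add: continuous_on_eq_continuous_at)
      moreover have "(\<lambda>m. r m *\<^sub>R z) \<longlonglongrightarrow> z"
        using tendsto_scaleR[OF r1 tendsto_const, of z] by simp
      ultimately have "(\<lambda>m. f (r m *\<^sub>R z)) \<longlonglongrightarrow> f z"
        by (rule isCont_tendsto_compose)
      with True show ?thesis by (simp add: F_def on_ball_def)
    next
      case False
      then show ?thesis using bergman_outside[OF f] by (simp add: F_def on_ball_def)
    qed
    then have "(\<lambda>m. u m z) \<longlonglongrightarrow> 2 * (cmod (f z))\<^sup>2 + 2 * (cmod (f z))\<^sup>2 - (cmod (f z - f z))\<^sup>2"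
      unfolding u_def by (intro tendsto_intros)
    then show ?thesis by simp
  qed
  have "b \<longlonglongrightarrow> 2 * ((1 / 1) ^ DIM(complex ^ 'd) * (hnorm n f)\<^sup>2) + 2 * (hnorm n f)\<^sup>2 - \<epsilon>\<^sup>2"
    unfolding b_def by (intro tendsto_intros r1) simp
  then have blim: "b \<longlonglongrightarrow> 4 * (hnorm n f)\<^sup>2 - \<epsilon>\<^sup>2" by simp
  have "ennreal (4 * (hnorm n f)\<^sup>2) = (\<integral>\<^sup>+z. ennreal (4 * (cmod (f z))\<^sup>2) \<partial>dV n)"
    using fL unfolding hnorm_sq L2_def by (subst nn_integral_eq_integral) auto
  also have "\<dots> = (\<integral>\<^sup>+z. liminf (\<lambda>m. ennreal (u m z)) \<partial>dV n)"
  proof (rule nn_integral_cong)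
    fix z :: "complex ^ 'd"
    have "(\<lambda>m. ennreal (u m z)) \<longlonglongrightarrow> ennreal (4 * (cmod (f z))\<^sup>2)" by (intro tendsto_ennrealI lim)
    then show "ennreal (4 * (cmod (f z))\<^sup>2) = liminf (\<lambda>m. ennreal (u m z))"
      by (rule lim_imp_Liminf[symmetric, rotated]) simp
  qed
  also have "\<dots> \<le> liminf (\<lambda>m. \<integral>\<^sup>+z. ennreal (u m z) \<partial>dV n)"
    by (rule nn_integral_liminf) (simp only: measurable_dV_iff measurable_compose[OF um measurable_ennreal])
  also have "\<dots> \<le> liminf (\<lambda>m. ennreal (b m))"
    using ub u0 ui by (intro Liminf_mono always_eventually allI) (simp add: nn_integral_eq_integral ennreal_leI)
  also have "\<dots> = ennreal (4 * (hnorm n f)\<^sup>2 - \<epsilon>\<^sup>2)"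
    by (rule lim_imp_Liminf) (auto intro: tendsto_ennrealI blim)
  finally have le: "ennreal (4 * (hnorm n f)\<^sup>2) \<le> ennreal (4 * (hnorm n f)\<^sup>2 - \<epsilon>\<^sup>2)" .
  \<comment> \<open>Conversion to \<open>ennreal\<close> truncates negative numbers, so
    nonnegativity of the bound must be known before the inequality can be read in the reals.\<close>
  have "0 \<le> 4 * (hnorm n f)\<^sup>2 - \<epsilon>\<^sup>2"
    by (rule LIMSEQ_le_const[OF blim]) (auto intro!: exI[of _ 0] order_trans[OF integral_nonneg_AE ub] simp: u0)
  with le have "4 * (hnorm n f)\<^sup>2 \<le> 4 * (hnorm n f)\<^sup>2 - \<epsilon>\<^sup>2" by (subst (asm) ennreal_le_iff) auto
  with \<epsilon> show False by simp
qed

section \<open>Finite combinations and density of the basis\<close>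

definition lincomb :: "(nat \<Rightarrow> 'd::finite hfun) \<Rightarrow> (nat \<Rightarrow> complex) \<Rightarrow> nat \<Rightarrow> 'd hfun" where
  "lincomb v c N = (\<lambda>z. \<Sum>j\<in>{1..N}. c j * v j z)"

lemma lincomb_0: "lincomb v c 0 = 0"
  by (simp add: lincomb_def fun_eq_iff)

lemma lincomb_Suc: "lincomb v c (Suc N) = lincomb v c N + (\<lambda>z. c (Suc N) * v (Suc N) z)"
  by (simp add: lincomb_def fun_eq_iff)

lemma lincomb_bergman:
  "(\<And>j. j \<ge> 1 \<Longrightarrow> v j \<in> bergman n) \<Longrightarrow> lincomb v c N \<in> bergman n"
  by (induction N) (simp_all add: lincomb_0 lincomb_Suc bergman_zero bergman_add bergman_scale)

lemma ip_lincomb_left: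
  assumes v: "\<And>j. j \<ge> 1 \<Longrightarrow> v j \<in> bergman n" and h: "L2 n h"
  shows "ip n (lincomb v c N) h = (\<Sum>j\<in>{1..N}. c j * ip n (v j) h)"
proof (induction N)
  case (Suc N)
  have "ip n (lincomb v c (Suc N)) h = ip n (lincomb v c N) h + ip n (\<lambda>z. c (Suc N) * v (Suc N) z) h"
    unfolding lincomb_Suc
    by (rule ip_add_left) (simp_all add: v h bergman_L2 bergman_scale lincomb_bergman)
  with Suc show ?case by (simp add: ip_scale_left)
qed (simp add: lincomb_def ip_def)

lemma ip_lincomb_right:
  assumes v: "\<And>j. j \<ge> 1 \<Longrightarrow> v j \<in> bergman n" and h: "L2 n h"
  shows "ip n h (lincomb v c N) = (\<Sum>j\<in>{1..N}. cnj (c j) * ip n h (v j))"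
  by (subst ip_cnj) (simp add: ip_lincomb_left[OF v h] ip_cnj[of n h])

locale bergman_basis =
  fixes n :: nat and e :: "nat \<Rightarrow> 'd::finite hfun" and \<kappa> :: "nat \<Rightarrow> ('d \<Rightarrow> nat)"
  assumes n: "n \<ge> CARD('d)"
    and enum: "bij_betw \<kappa> {1..} UNIV"
    and e: "\<And>j. j \<ge> 1 \<Longrightarrow> e j = monomial_basis n (\<kappa> j)"
begin

lemma e_bergman: "j \<ge> 1 \<Longrightarrow> e j \<in> bergman n"
  by (simp add: e monomial_basis_bergman[OF n])

lemma ip_e: "i \<ge> 1 \<Longrightarrow> j \<ge> 1 \<Longrightarrow> ip n (e i) (e j) = (if i = j then 1 else 0)"
  using enum by (auto simp: e ip_monomial_basis[OF n] bij_betw_def inj_on_def)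

lemma hnorm_e: "j \<ge> 1 \<Longrightarrow> hnorm n (e j) = 1"
  by (simp add: hnorm_def ip_e)

lemma zpolys_lincomb: "p \<in> zpolys \<Longrightarrow> \<exists>c N. on_ball p = lincomb e c N"
proof (induction p rule: zpolys.induct)
  case zero
  show ?case by (intro exI[of _ "\<lambda>_. 0"] exI[of _ 0]) (simp add: lincomb_0 on_ball_def fun_eq_iff)
next
  case (add p c k)
  then obtain a N where a: "on_ball p = lincomb e a N" by blast
  obtain j where j: "j \<ge> 1" "\<kappa> j = k" using enum by (metis UNIV_I atLeast_iff bij_betw_iff_bijections)
  define s where "s = sqrt (fact ((\<Sum>i\<in>UNIV. k i) + n) / ((\<Prod>i\<in>UNIV. fact (k i)) * fact n))"
  have s: "s \<noteq> 0" by (simp add: s_def prod_zero_iff)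
  have ej: "e j = on_ball (\<lambda>z. of_real s * zpow k z)"
    using j by (simp add: e monomial_basis_eq s_def)
  \<comment> \<open>The new coefficient is added to whatever stands at index \<open>j\<close>.
    Padding to length \<open>N + j\<close> treats \<open>j \<le> N\<close> and \<open>j > N\<close>
    alike.\<close>
  define a' where "a' = (\<lambda>i. (if i \<le> N then a i else 0) + (if i = j then c / of_real s else 0))"
  have "on_ball (\<lambda>z. p z + c * zpow k z) = lincomb e a' (N + j)"
  proof
    fix z
    have "lincomb e a' (N + j) z = (\<Sum>i\<in>{1..N + j}. (if i \<le> N then a i * e i z else 0)) +
        (\<Sum>i\<in>{1..N + j}. (if i = j then c / of_real s * e j z else 0))"
      unfolding lincomb_def a'_def sum.distrib[symmetric] by (intro sum.cong) (auto simp: distrib_right)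
    also have "(\<Sum>i\<in>{1..N + j}. (if i \<le> N then a i * e i z else 0)) = (\<Sum>i\<in>{1..N}. a i * e i z)"
      by (intro sum.mono_neutral_cong_right) auto
    also have "(\<Sum>i\<in>{1..N + j}. (if i = j then c / of_real s * e j z else 0)) = c / of_real s * e j z"
      using j by simp
    also have "(\<Sum>i\<in>{1..N}. a i * e i z) = on_ball p z" by (simp add: a lincomb_def)
    also have "on_ball p z + c / of_real s * e j z = on_ball (\<lambda>z. p z + c * zpow k z) z"
      using s by (simp add: ej on_ball_def)
    finally show "on_ball (\<lambda>z. p z + c * zpow k z) z = lincomb e a' (N + j) z" ..
  qed
  then show ?case by blast
qed

lemma lincomb_dense:
  assumes f: "f \<in> bergman n" and \<epsilon>: "\<epsilon> > 0"
  shows "\<exists>c N. hnorm n (f - lincomb e c N) < \<epsilon>"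
proof -
  obtain r where r: "0 < r" "r < 1" and cl: "hnorm n (on_ball (\<lambda>z. f (r *\<^sub>R z)) - f) < \<epsilon> / 2"
    using dilation_close[OF f, of "\<epsilon> / 2"] \<epsilon> by auto
  obtain p where p: "p \<in> zpolys" "\<And>z. z \<in> ball 0 1 \<Longrightarrow> cmod (f (r *\<^sub>R z) - p z) \<le> \<epsilon> / 4"
    using zpolys_approx_dilation[OF bergman_analytic[OF f] r, of "\<epsilon> / 4"] \<epsilon> by auto
  obtain c N where c: "on_ball p = lincomb e c N" using zpolys_lincomb[OF p(1)] by blast
  let ?g = "on_ball (\<lambda>z. f (r *\<^sub>R z))"
  have gL: "L2 n ?g" by (rule dilation_L2(1)[OF f r])
  have pL: "L2 n (lincomb e c N)" by (intro bergman_L2 lincomb_bergman e_bergman)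
  have fL: "L2 n f" by (rule bergman_L2[OF f])
  have "hnorm n (?g - lincomb e c N) \<le> \<epsilon> / 4"
    using p(2) \<epsilon> by (intro hnorm_le_bound[OF n] L2_diff gL pL) (auto simp: c[symmetric] on_ball_def)
  moreover have "f - lincomb e c N = (f - ?g) + (?g - lincomb e c N)" by simp
  then have "hnorm n (f - lincomb e c N) \<le> hnorm n (f - ?g) + hnorm n (?g - lincomb e c N)"
    using hnorm_triangle[OF L2_diff[OF fL gL] L2_diff[OF gL pL]] by simp
  ultimately have "hnorm n (f - lincomb e c N) < \<epsilon>"
    using cl hnorm_minus_commute[of n f ?g] \<epsilon> by simp
  then show ?thesis by blast
qed

end

section \<open>Bounded operators\<close>

lemma bounded_opsI:
  assumes "\<And>f. f \<in> bergman n \<Longrightarrow> T f \<in> bergman n" "\<And>f. f \<notin> bergman n \<Longrightarrow> T f = 0"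
    "\<And>f g. f \<in> bergman n \<Longrightarrow> g \<in> bergman n \<Longrightarrow> T (f + g) = T f + T g"
    "\<And>f c. f \<in> bergman n \<Longrightarrow> T (\<lambda>z. c * f z) = (\<lambda>z. c * T f z)"
    "\<And>f. f \<in> bergman n \<Longrightarrow> hnorm n (T f) \<le> C * hnorm n f"
  shows "T \<in> bounded_ops n"
  unfolding bounded_ops_def using assms by blast

lemma bounded_opsD:
  assumes "T \<in> bounded_ops n"
  shows "f \<in> bergman n \<Longrightarrow> T f \<in> bergman n" "f \<notin> bergman n \<Longrightarrow> T f = 0"
    "f \<in> bergman n \<Longrightarrow> g \<in> bergman n \<Longrightarrow> T (f + g) = T f + T g"
    "f \<in> bergman n \<Longrightarrow> T (\<lambda>z. c * f z) = (\<lambda>z. c * T f z)"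
  using assms unfolding bounded_ops_def by blast+

lemma bounded_ops_bound:
  assumes "T \<in> bounded_ops n"
  obtains C where "C \<ge> 0" "\<And>f. f \<in> bergman n \<Longrightarrow> hnorm n (T f) \<le> C * hnorm n f"
proof -
  obtain C where C: "\<forall>f\<in>bergman n. hnorm n (T f) \<le> C * hnorm n f"
    using assms unfolding bounded_ops_def by blast
  have "hnorm n (T f) \<le> \<bar>C\<bar> * hnorm n f" if "f \<in> bergman n" for f
    using C[rule_format, OF that] mult_right_mono[OF abs_ge_self[of C] hnorm_nonneg[of n f]] by linarith
  then show ?thesis by (intro that[of "\<bar>C\<bar>"]) auto
qed

lemma bounded_ops_L2: "T \<in> bounded_ops n \<Longrightarrow> f \<in> bergman n \<Longrightarrow> L2 n (T f)"
  by (simp add: bergman_L2 bounded_opsD)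

lemma bounded_ops_diff:
  assumes T: "T \<in> bounded_ops n" and f: "f \<in> bergman n" and g: "g \<in> bergman n"
  shows "T (f - g) = T f - T g"
proof -
  have eq: "f - g = f + (\<lambda>z. (-1) * g z)" by (simp add: fun_eq_iff)
  show ?thesis
    unfolding eq bounded_opsD(3)[OF T f bergman_scale[OF g]] bounded_opsD(4)[OF T g]
    by (simp add: fun_eq_iff)
qed

lemma bounded_ops_zero: "0 \<in> bounded_ops n"
  by (rule bounded_opsI[where C = 0]) (auto simp: bergman_zero fun_eq_iff)

lemma bounded_ops_op_id: "op_id n \<in> bounded_ops n"
  by (rule bounded_opsI[where C = 1]) (auto simp: op_id_def bergman_add bergman_scale)

lemma bounded_ops_add:
  fixes S T :: "'d::finite hop"
  assumes S: "S \<in> bounded_ops n" and T: "T \<in> bounded_ops n"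
  shows "S + T \<in> bounded_ops n"
proof -
  obtain C where "0 \<le> C" and C: "\<And>f. f \<in> bergman n \<Longrightarrow> hnorm n (S f) \<le> C * hnorm n f"
    using S by (rule bounded_ops_bound) auto
  obtain D where "0 \<le> D" and D: "\<And>f. f \<in> bergman n \<Longrightarrow> hnorm n (T f) \<le> D * hnorm n f"
    using T by (rule bounded_ops_bound) auto
  show ?thesis
  proof (rule bounded_opsI[where C = "C + D"])
    fix f :: "'d hfun" assume f: "f \<in> bergman n"
    show "hnorm n ((S + T) f) \<le> (C + D) * hnorm n f"
      using hnorm_triangle[OF bounded_ops_L2[OF S f] bounded_ops_L2[OF T f]] C[OF f] D[OF f]
      by (simp add: distrib_right)
  qed (simp_all add: bounded_opsD[OF S] bounded_opsD[OF T] bergman_add fun_eq_iff distrib_left)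
qed

lemma bounded_ops_scale:
  fixes T :: "'d::finite hop"
  assumes T: "T \<in> bounded_ops n"
  shows "(\<lambda>f z. c * T f z) \<in> bounded_ops n"
proof -
  obtain C where "0 \<le> C" and C: "\<And>f. f \<in> bergman n \<Longrightarrow> hnorm n (T f) \<le> C * hnorm n f"
    using T by (rule bounded_ops_bound) auto
  show ?thesis
  proof (rule bounded_opsI[where C = "cmod c * C"])
    fix f :: "'d hfun" assume f: "f \<in> bergman n"
    show "hnorm n (\<lambda>z. c * T f z) \<le> cmod c * C * hnorm n f"
      unfolding hnorm_scale using mult_left_mono[OF C[OF f], of "cmod c"] by (simp add: mult.assoc)
  qed (simp_all add: bounded_opsD[OF T] bergman_scale fun_eq_iff distrib_left mult_ac)
qed

lemma scaleR_op_conv: "r *\<^sub>R (T :: 'd::finite hop) = (\<lambda>f z. of_real r * T f z)"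
  by (simp add: scaleR_fun_def fun_eq_iff scaleR_conv_of_real)

lemma bounded_ops_scaleR: "T \<in> bounded_ops n \<Longrightarrow> r *\<^sub>R T \<in> bounded_ops n"
  unfolding scaleR_op_conv by (rule bounded_ops_scale)

lemma bounded_ops_subspace: "subspace (bounded_ops n)"
  by (simp add: subspace_def bounded_ops_zero bounded_ops_add bounded_ops_scaleR)

lemma bounded_ops_minus: "S \<in> bounded_ops n \<Longrightarrow> T \<in> bounded_ops n \<Longrightarrow> S - T \<in> bounded_ops n"
  by (rule subspace_diff[OF bounded_ops_subspace])

lemma bounded_ops_lincomb:
  assumes T: "T \<in> bounded_ops n" and v: "\<And>j. j \<ge> 1 \<Longrightarrow> v j \<in> bergman n"
  shows "T (lincomb v c N) = lincomb (\<lambda>j. T (v j)) c N"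
proof (induction N)
  case 0
  have "T (\<lambda>z. 0 * (0 :: 'a hfun) z) = (\<lambda>z. 0 * T 0 z)" by (rule bounded_opsD(4)[OF T bergman_zero])
  then show ?case by (simp add: lincomb_0 zero_fun_def)
next
  case (Suc N)
  then show ?case
    unfolding lincomb_Suc using v
    by (subst bounded_opsD(3)[OF T]) (simp_all add: lincomb_bergman bergman_scale bounded_opsD(4)[OF T])
qed

lemma quadratic_form_diff:
  assumes T: "T \<in> bounded_ops n" and C: "\<And>f. f \<in> bergman n \<Longrightarrow> hnorm n (T f) \<le> C * hnorm n f"
    and f: "f \<in> bergman n" and g: "g \<in> bergman n"
  shows "cmod (ip n (T f) f - ip n (T g) g) \<le> C * (hnorm n f + hnorm n g) * hnorm n (f - g)"
proof -
  have fg: "f - g \<in> bergman n" using f g by (rule bergman_diff)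
  note L = bergman_L2[OF f] bergman_L2[OF g] bergman_L2[OF fg]
    bounded_ops_L2[OF T f] bounded_ops_L2[OF T g] bounded_ops_L2[OF T fg]
  have "ip n (T f) f - ip n (T g) g = ip n (T f) (f - g) + ip n (T (f - g)) g"
    using L by (simp add: bounded_ops_diff[OF T f g] ip_diff_left ip_diff_right)
  then have "cmod (ip n (T f) f - ip n (T g) g) \<le> cmod (ip n (T f) (f - g)) + cmod (ip n (T (f - g)) g)"
    by (simp add: norm_triangle_ineq)
  also have "\<dots> \<le> hnorm n (T f) * hnorm n (f - g) + hnorm n (T (f - g)) * hnorm n g"
    using L by (intro add_mono Cauchy_Schwarz)
  also have "\<dots> \<le> (C * hnorm n f) * hnorm n (f - g) + (C * hnorm n (f - g)) * hnorm n g"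
    using C[OF f] C[OF fg] by (intro add_mono mult_right_mono) auto
  finally show ?thesis by (simp add: algebra_simps)
qed

context bergman_basis
begin

lemma lincomb_coeff:
  assumes "i \<in> {1..N}"
  shows "cmod (c i) \<le> hnorm n (lincomb e c N)"
proof -
  have "ip n (lincomb e c N) (e i) = (\<Sum>j\<in>{1..N}. c j * ip n (e j) (e i))"
    using assms by (intro ip_lincomb_left e_bergman bergman_L2) auto
  also have "\<dots> = (\<Sum>j\<in>{1..N}. if j = i then c i else 0)"
    using assms by (intro sum.cong) (auto simp: ip_e)
  also have "\<dots> = c i" using assms by simp
  finally have "cmod (c i) \<le> hnorm n (lincomb e c N) * hnorm n (e i)"
    using Cauchy_Schwarz[of n "lincomb e c N" "e i"] assms
    by (simp add: bergman_L2 lincomb_bergman e_bergman)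
  then show ?thesis using assms by (simp add: hnorm_e)
qed

text \<open>By orthonormality each coefficient of a finite combination is at most its norm, so the
  sum of all entry bounds dominates the quadratic form there. Density of the combinations and
  continuity of the form of a bounded operator give the general case.\<close>

lemma quadratic_form_le_matrix:
  assumes T: "T \<in> bounded_ops n"
    and b: "\<And>i j. i \<ge> 1 \<Longrightarrow> j \<ge> 1 \<Longrightarrow> cmod (ip n (T (e i)) (e j)) \<le> b i j"
    and B: "\<And>N. (\<Sum>i\<in>{1..N}. \<Sum>j\<in>{1..N}. b i j) \<le> B"
    and f: "f \<in> bergman n"
  shows "cmod (ip n (T f) f) \<le> B * (hnorm n f)\<^sup>2"
proof -
  have fin: "cmod (ip n (T (lincomb e c N)) (lincomb e c N)) \<le> B * (hnorm n (lincomb e c N))\<^sup>2" for c N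
  proof -
    let ?g = "lincomb e c N"
    have g: "?g \<in> bergman n" by (intro lincomb_bergman e_bergman)
    have Te: "T (e j) \<in> bergman n" if "j \<ge> 1" for j using that by (intro bounded_opsD[OF T] e_bergman)
    have eq: "T ?g = lincomb (\<lambda>j. T (e j)) c N"
      by (rule bounded_ops_lincomb[OF T]) (rule e_bergman)
    have "ip n (T ?g) ?g = (\<Sum>i\<in>{1..N}. c i * ip n (T (e i)) ?g)"
      unfolding eq
      by (rule ip_lincomb_left) (simp_all add: Te bergman_L2[OF g])
    also have "\<dots> = (\<Sum>i\<in>{1..N}. c i * (\<Sum>j\<in>{1..N}. cnj (c j) * ip n (T (e i)) (e j)))"
      by (intro sum.cong refl arg_cong2[where f = "(*)"] ip_lincomb_right) (simp_all add: e_bergman Te bergman_L2)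
    finally have "cmod (ip n (T ?g) ?g) \<le> (\<Sum>i\<in>{1..N}. \<Sum>j\<in>{1..N}. cmod (c i) * (cmod (c j) * cmod (ip n (T (e i)) (e j))))"
      by (simp add: sum_distrib_left) (intro order_trans[OF norm_sum] sum_mono, simp add: norm_mult)
    also have "\<dots> \<le> (\<Sum>i\<in>{1..N}. \<Sum>j\<in>{1..N}. hnorm n ?g * (hnorm n ?g * b i j))"
      using lincomb_coeff b by (intro sum_mono mult_mono) auto
    also have "\<dots> = (\<Sum>i\<in>{1..N}. \<Sum>j\<in>{1..N}. b i j) * (hnorm n ?g)\<^sup>2"
      by (simp add: sum_distrib_right sum_distrib_left power2_eq_square mult_ac)
    also have "\<dots> \<le> B * (hnorm n ?g)\<^sup>2" using B by (intro mult_right_mono) auto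
    finally show ?thesis .
  qed
  obtain C where C: "C \<ge> 0" "\<And>f. f \<in> bergman n \<Longrightarrow> hnorm n (T f) \<le> C * hnorm n f"
    using T by (rule bounded_ops_bound) auto
  have "\<exists>g. g \<in> bergman n \<and> cmod (ip n (T g) g) \<le> B * (hnorm n g)\<^sup>2 \<and> hnorm n (f - g) < inverse (real (Suc m))" for m
    using lincomb_dense[OF f, of "inverse (real (Suc m))"] fin lincomb_bergman[of e n] e_bergman
    by (metis inverse_positive_iff_positive of_nat_0_less_iff zero_less_Suc)
  then obtain g where g: "\<And>m. g m \<in> bergman n" "\<And>m. cmod (ip n (T (g m)) (g m)) \<le> B * (hnorm n (g m))\<^sup>2"
    "\<And>m. hnorm n (f - g m) < inverse (real (Suc m))" by metis
  have d0: "(\<lambda>m. hnorm n (f - g m)) \<longlonglongrightarrow> 0"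
    by (rule tendsto_sandwich[OF _ _ tendsto_const LIMSEQ_inverse_real_of_nat])
      (intro always_eventually allI hnorm_nonneg less_imp_le[OF g(3)])+
  have "\<bar>hnorm n (g m) - hnorm n f\<bar> \<le> hnorm n (f - g m)" for m
  proof -
    note L = bergman_L2[OF f] bergman_L2[OF g(1)[of m]]
    have "f = (f - g m) + g m" "g m = f - (f - g m)" by simp_all
    then have "hnorm n f \<le> hnorm n (f - g m) + hnorm n (g m)" "hnorm n (g m) \<le> hnorm n f + hnorm n (f - g m)"
      using hnorm_triangle[OF L2_diff[OF L] L(2)] hnorm_triangle_diff[OF L(1) L2_diff[OF L]] by simp_all
    then show ?thesis by linarith
  qed
  then have "(\<lambda>m. hnorm n (g m) - hnorm n f) \<longlonglongrightarrow> 0"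
    by (intro Lim_null_comparison[OF always_eventually d0]) auto
  then have hg: "(\<lambda>m. hnorm n (g m)) \<longlonglongrightarrow> hnorm n f" by (rule LIM_zero_cancel)
  have "(\<lambda>m. C * (hnorm n f + hnorm n (g m)) * hnorm n (f - g m)) \<longlonglongrightarrow> C * (hnorm n f + hnorm n f) * 0"
    by (intro tendsto_intros hg d0)
  then have null: "(\<lambda>m. C * (hnorm n f + hnorm n (g m)) * hnorm n (f - g m)) \<longlonglongrightarrow> 0" by simp
  have "(\<lambda>m. ip n (T f) f - ip n (T (g m)) (g m)) \<longlonglongrightarrow> 0"
    by (rule Lim_null_comparison[OF always_eventually null]) (intro allI quadratic_form_diff[OF T C(2) f g(1)])
  from tendsto_diff[OF tendsto_const this, of "ip n (T f) f"]
  have "(\<lambda>m. ip n (T (g m)) (g m)) \<longlonglongrightarrow> ip n (T f) f" by simp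
  then have 1: "(\<lambda>m. cmod (ip n (T (g m)) (g m))) \<longlonglongrightarrow> cmod (ip n (T f) f)" by (rule tendsto_norm)
  have 2: "(\<lambda>m. B * (hnorm n (g m))\<^sup>2) \<longlonglongrightarrow> B * (hnorm n f)\<^sup>2"
    by (intro tendsto_intros hg)
  show ?thesis by (rule LIMSEQ_le[OF 1 2]) (use g(2) in auto)
qed

end

section \<open>Positive and compact operators\<close>

lemma ip_add_op: "ip n ((S + T) f) g = ip n (S f) g + ip n (T f) g"
  if "S \<in> bounded_ops n" "T \<in> bounded_ops n" "f \<in> bergman n" "L2 n g"
  using that by (simp add: ip_add_left bounded_ops_L2)

lemma ip_scaleR_op:
  fixes T :: "'d::finite hop"
  shows "ip n ((r *\<^sub>R T) f) g = of_real r * ip n (T f) g"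
  by (simp add: scaleR_op_conv ip_scale_left)

lemma ip_op_id: "f \<in> bergman n \<Longrightarrow> ip n (op_id n f) f = of_real ((hnorm n f)\<^sup>2)"
  by (simp add: op_id_def ip_self_hnorm)

lemma positive_op_bounded: "positive_op n T \<Longrightarrow> T \<in> bounded_ops n"
  by (simp add: positive_op_def)

lemma positive_opD:
  "positive_op n T \<Longrightarrow> f \<in> bergman n \<Longrightarrow> Im (ip n (T f) f) = 0"
  "positive_op n T \<Longrightarrow> f \<in> bergman n \<Longrightarrow> 0 \<le> Re (ip n (T f) f)"
  by (auto simp: positive_op_def complex_is_Real_iff)

lemma positive_opI:
  "T \<in> bounded_ops n \<Longrightarrow> (\<And>f. f \<in> bergman n \<Longrightarrow> Im (ip n (T f) f) = 0) \<Longrightarrow>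
    (\<And>f. f \<in> bergman n \<Longrightarrow> 0 \<le> Re (ip n (T f) f)) \<Longrightarrow> positive_op n T"
  by (auto simp: positive_op_def complex_is_Real_iff)

lemma positive_op_zero: "positive_op n 0"
  by (rule positive_opI) (simp_all add: bounded_ops_zero ip_def)

lemma positive_op_add:
  assumes S: "positive_op n S" and T: "positive_op n T"
  shows "positive_op n (S + T)"
proof -
  note b = positive_op_bounded[OF S] positive_op_bounded[OF T]
  show ?thesis
    by (rule positive_opI)
      (simp_all only: bounded_ops_add[OF b] ip_add_op[OF b _ bergman_L2] plus_complex.simps
        positive_opD[OF S] positive_opD[OF T] add_nonneg_nonneg add_0_right)
qed

lemma positive_op_scaleR:
  assumes T: "positive_op n T" and r: "0 \<le> r"
  shows "positive_op n (r *\<^sub>R T)"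
  by (rule positive_opI)
    (simp_all add: bounded_ops_scaleR positive_op_bounded[OF T] ip_scaleR_op positive_opD[OF T] r)

text \<open>The quadratic form vanishes, so by polarisation
  \<open>ip n (T f) g + ip n (T g) f = 0\<close> for all \<open>f\<close> and \<open>g\<close>.
  Taking \<open>g\<close> to be \<open>T f\<close> and then \<open>\<i>\<close> times
  \<open>T f\<close> isolates \<open>ip n (T f) (T f)\<close>.\<close>

lemma positive_op_antisym:
  assumes T: "positive_op n T" and mT: "positive_op n (- T)"
  shows "T = 0"
proof -
  note b = positive_op_bounded[OF T]
  have q0: "ip n (T f) f = 0" if f: "f \<in> bergman n" for f
  proof -
    have "ip n ((- T) f) f = - ip n (T f) f" by (simp add: ip_def)
    then show ?thesis
      using positive_opD[OF T f] positive_opD[OF mT f] by (simp add: complex_eq_iff)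
  qed
  have pol: "ip n (T f) g + ip n (T g) f = 0" if f: "f \<in> bergman n" and g: "g \<in> bergman n" for f g
  proof -
    note L = bergman_L2[OF f] bergman_L2[OF g] bounded_ops_L2[OF b f] bounded_ops_L2[OF b g]
    have "ip n (T (f + g)) (f + g) = ip n (T f) f + ip n (T f) g + (ip n (T g) f + ip n (T g) g)"
      using L by (simp add: bounded_opsD(3)[OF b f g] ip_add_left ip_add_right L2_add)
    then show ?thesis using q0[OF bergman_add[OF f g]] q0[OF f] q0[OF g] by simp
  qed
  have "hnorm n (T f) = 0" if f: "f \<in> bergman n" for f
  proof -
    note g = bounded_opsD(1)[OF b f]
    have "ip n (T f) (\<lambda>z. \<i> * T f z) + ip n (T (\<lambda>z. \<i> * T f z)) f = 0"
      by (rule pol[OF f bergman_scale[OF g]])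
    then have "- \<i> * ip n (T f) (T f) + \<i> * ip n (T (T f)) f = 0"
      by (simp add: bounded_opsD(4)[OF b g] ip_scale_left ip_scale_right)
    then have "\<i> * (ip n (T (T f)) f - ip n (T f) (T f)) = 0"
      by (simp add: algebra_simps)
    then have "ip n (T (T f)) f = ip n (T f) (T f)" by simp
    with pol[OF f g] have "ip n (T f) (T f) = 0" by simp
    then show ?thesis by (simp add: hnorm_def)
  qed
  then have "T f = 0" for f
    using bounded_opsD(1,2)[OF b, of f] bergman_definite[of "T f" n] by blast
  then show ?thesis by (simp add: fun_eq_iff)
qed

section \<open>Compact operators\<close>

lemma compact_ops_bounded: "T \<in> compact_ops n \<Longrightarrow> T \<in> bounded_ops n"
  by (simp add: compact_ops_def)

lemma compact_opsD:
  assumes "T \<in> compact_ops n" "\<And>k::nat. s k \<in> bergman n" "\<And>k. hnorm n (s k) \<le> 1"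
  obtains r g where "strict_mono (r :: nat \<Rightarrow> nat)" "g \<in> bergman n" "(\<lambda>k. hnorm n (T (s (r k)) - g)) \<longlonglongrightarrow> 0"
  using assms unfolding compact_ops_def by blast

lemma compact_opsI:
  assumes "T \<in> bounded_ops n"
    and "\<And>s. (\<And>k::nat. s k \<in> bergman n) \<Longrightarrow> (\<And>k. hnorm n (s k) \<le> 1) \<Longrightarrow>
      \<exists>r g. strict_mono (r :: nat \<Rightarrow> nat) \<and> g \<in> bergman n \<and> (\<lambda>k. hnorm n (T (s (r k)) - g)) \<longlonglongrightarrow> 0"
  shows "T \<in> compact_ops n"
  unfolding compact_ops_def using assms by blast

lemma compact_ops_zero: "0 \<in> compact_ops n"
proof (rule compact_opsI[OF bounded_ops_zero])
  fix s :: "nat \<Rightarrow> 'a hfun"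
  show "\<exists>r g. strict_mono (r :: nat \<Rightarrow> nat) \<and> g \<in> bergman n \<and> (\<lambda>k. hnorm n (0 (s (r k)) - g)) \<longlonglongrightarrow> 0"
    by (intro exI[of _ "\<lambda>k. k"] exI[of _ 0]) (simp add: strict_mono_def bergman_zero hnorm_def ip_def)
qed

lemma compact_ops_add:
  fixes S T :: "'d::finite hop"
  assumes S: "S \<in> compact_ops n" and T: "T \<in> compact_ops n"
  shows "S + T \<in> compact_ops n"
proof (rule compact_opsI)
  note b = compact_ops_bounded[OF S] compact_ops_bounded[OF T]
  show "S + T \<in> bounded_ops n" by (rule bounded_ops_add[OF b])
  fix s :: "nat \<Rightarrow> 'd hfun" assume s: "\<And>k. s k \<in> bergman n" "\<And>k. hnorm n (s k) \<le> 1"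
  obtain r g where r: "strict_mono (r :: nat \<Rightarrow> nat)" "g \<in> bergman n" "(\<lambda>k. hnorm n (S (s (r k)) - g)) \<longlonglongrightarrow> 0"
    using compact_opsD[OF S s] .
  obtain q h where q: "strict_mono (q :: nat \<Rightarrow> nat)" "h \<in> bergman n" "(\<lambda>k. hnorm n (T (s (r (q k))) - h)) \<longlonglongrightarrow> 0"
    using compact_opsD[OF T, of "\<lambda>k. s (r k)"] s by auto
  have 1: "(\<lambda>k. hnorm n (S (s (r (q k))) - g)) \<longlonglongrightarrow> 0"
    using LIMSEQ_subseq_LIMSEQ[OF r(3) q(1)] by (simp add: o_def)
  have le: "hnorm n ((S + T) (s (r (q k))) - (g + h)) \<le> hnorm n (S (s (r (q k))) - g) + hnorm n (T (s (r (q k))) - h)" for k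
  proof -
    have eq: "(S + T) (s (r (q k))) - (g + h) = (S (s (r (q k))) - g) + (T (s (r (q k))) - h)"
      by (simp add: fun_eq_iff)
    show ?thesis unfolding eq
      by (intro hnorm_triangle L2_diff bounded_ops_L2[OF b(1)] bounded_ops_L2[OF b(2)] s bergman_L2[OF r(2)] bergman_L2[OF q(2)])
  qed
  have 2: "(\<lambda>k. hnorm n (S (s (r (q k))) - g) + hnorm n (T (s (r (q k))) - h)) \<longlonglongrightarrow> 0"
    using tendsto_add[OF 1 q(3)] by simp
  have "(\<lambda>k. hnorm n ((S + T) (s (r (q k))) - (g + h))) \<longlonglongrightarrow> 0"
    by (rule tendsto_sandwich[OF _ _ tendsto_const 2]) (use le in auto)
  moreover have "strict_mono (\<lambda>k. r (q k))"
    using strict_mono_o[OF r(1) q(1)] by (simp add: o_def)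
  ultimately show "\<exists>r g. strict_mono (r :: nat \<Rightarrow> nat) \<and> g \<in> bergman n \<and> (\<lambda>k. hnorm n ((S + T) (s (r k)) - g)) \<longlonglongrightarrow> 0"
    using bergman_add[OF r(2) q(2)] by blast
qed

lemma compact_ops_scale:
  fixes T :: "'d::finite hop"
  assumes T: "T \<in> compact_ops n"
  shows "(\<lambda>f z. c * T f z) \<in> compact_ops n"
proof (rule compact_opsI)
  show "(\<lambda>f z. c * T f z) \<in> bounded_ops n" by (intro bounded_ops_scale compact_ops_bounded[OF T])
  fix s :: "nat \<Rightarrow> 'd hfun" assume s: "\<And>k. s k \<in> bergman n" "\<And>k. hnorm n (s k) \<le> 1"
  obtain r g where r: "strict_mono (r :: nat \<Rightarrow> nat)" "g \<in> bergman n" "(\<lambda>k. hnorm n (T (s (r k)) - g)) \<longlonglongrightarrow> 0"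
    using compact_opsD[OF T s] .
  have eq: "(\<lambda>z. c * T (s (r k)) z) - (\<lambda>z. c * g z) = (\<lambda>z. c * (T (s (r k)) - g) z)" for k
    by (simp add: fun_eq_iff right_diff_distrib)
  have "(\<lambda>k. hnorm n ((\<lambda>z. c * T (s (r k)) z) - (\<lambda>z. c * g z))) \<longlonglongrightarrow> 0"
    unfolding eq hnorm_scale by (rule tendsto_mult_right_zero[OF r(3)])
  with r(1) bergman_scale[OF r(2), of c]
  show "\<exists>r g. strict_mono (r :: nat \<Rightarrow> nat) \<and> g \<in> bergman n \<and> (\<lambda>k. hnorm n ((\<lambda>z. c * T (s (r k)) z) - g)) \<longlonglongrightarrow> 0"
    by blast
qed

lemma compact_ops_subspace: "subspace (compact_ops n)"
  by (simp add: subspace_def compact_ops_zero compact_ops_add scaleR_op_conv compact_ops_scale)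

section \<open>Peaking sequences and symbols\<close>

lemma hnorm_normalize:
  assumes f: "hnorm n f \<noteq> 0"
  shows "hnorm n (\<lambda>z. of_real (1 / hnorm n f) * f z) = 1"
  using f unfolding hnorm_scale by (simp add: norm_divide abs_of_nonneg)

text \<open>One plus the inner product of \<open>z\<close> with \<open>\<zeta>\<close>. For a unit
  vector \<open>\<zeta>\<close> its modulus on the closed ball reaches the maximum 2 only at
  \<open>\<zeta>\<close>.\<close>

definition peak :: "complex ^ 'd::finite \<Rightarrow> 'd hfun" where
  "peak \<zeta> z = 1 + (\<Sum>i\<in>UNIV. z $ i * cnj (\<zeta> $ i))"

lemma analytic_on_ball_peak: "analytic_on_ball (peak \<zeta>)"
proof -
  have "analytic_on_ball (\<lambda>z. \<Sum>i\<in>UNIV. z $ i * cnj (\<zeta> $ i))"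
    by (intro analytic_on_ball_sum analytic_on_ball_mult analytic_on_ball_nth analytic_on_ball_const) simp
  from analytic_on_ball_add[OF analytic_on_ball_const[of 1] this] show ?thesis
    by (simp add: plus_fun_def peak_def[abs_def])
qed

text \<open>With \<open>w\<close> the inner product of \<open>z\<close> and \<open>\<zeta>\<close>,
  the left side is at most \<open>2 + 2 * Re w\<close>, while the squared distance is at most
  \<open>2 - 2 * Re w\<close>.\<close>

lemma peak_bound:
  fixes \<zeta> z :: "complex ^ 'd::finite"
  assumes \<zeta>: "norm \<zeta> = 1" and z: "norm z \<le> 1"
  shows "(cmod (peak \<zeta> z))\<^sup>2 \<le> 4 - (norm (z - \<zeta>))\<^sup>2"
proof -
  define w where "w = (\<Sum>i\<in>UNIV. z $ i * cnj (\<zeta> $ i))"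
  have Re: "Re w = z \<bullet> \<zeta>"
    by (simp add: w_def inner_vec_def inner_complex_def)
  have "cmod w \<le> (\<Sum>i\<in>UNIV. cmod (z $ i) * cmod (\<zeta> $ i))"
    unfolding w_def by (intro order_trans[OF norm_sum] sum_mono) (simp add: norm_mult)
  also have "\<dots> \<le> norm z * norm \<zeta>"
    unfolding norm_vec_def by (rule order_trans[OF _ L2_set_mult_ineq]) simp
  finally have "(cmod w)\<^sup>2 \<le> 1" using \<zeta> z by (simp add: abs_square_le_1)
  moreover have "(cmod (1 + w))\<^sup>2 = 1 + 2 * Re w + (cmod w)\<^sup>2"
    unfolding cmod_power2 by (simp add: power2_eq_square algebra_simps)
  moreover have "(norm (z - \<zeta>))\<^sup>2 = (norm z)\<^sup>2 + (norm \<zeta>)\<^sup>2 - 2 * (z \<bullet> \<zeta>)"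
    by (simp add: power2_norm_eq_inner inner_diff_left inner_diff_right inner_commute)
  moreover have "(norm z)\<^sup>2 \<le> 1" using z by (simp add: abs_square_le_1)
  ultimately show ?thesis using \<zeta> Re by (simp add: peak_def w_def[symmetric])
qed

lemma peak_scaled:
  assumes "norm \<zeta> = 1"
  shows "peak \<zeta> (t *\<^sub>R \<zeta>) = of_real (1 + t)"
proof -
  have "(\<Sum>i\<in>UNIV. \<zeta> $ i * cnj (\<zeta> $ i)) = of_real ((norm \<zeta>)\<^sup>2)"
    by (simp add: norm_vec_sq complex_norm_square del: of_real_power)
  then show ?thesis using assms
    by (simp add: peak_def scaleR_conv_of_real[where 'a = complex] mult.assoc flip: sum_distrib_left)
qed

text \<open>Normalised powers of \<open>peak \<zeta>\<close>. At distance at least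
  \<open>\<delta>\<close> from \<open>\<zeta>\<close> the squared modulus is at most some
  \<open>a < 4\<close>, whereas it exceeds a number \<open>c\<close> between \<open>a\<close> and 4
  on an open set of positive mass. The share of mass away from \<open>\<zeta>\<close> is therefore
  of order \<open>(a / c) ^ m\<close>.\<close>

lemma peaking_sequence:
  fixes \<zeta> :: "complex ^ 'd::finite"
  assumes n: "n \<ge> CARD('d)" and \<zeta>: "\<zeta> \<in> sphere 0 1"
  obtains h :: "nat \<Rightarrow> 'd hfun"
  where "\<And>m. h m \<in> bergman n" "\<And>m. hnorm n (h m) = 1"
    "\<And>\<delta>. \<delta> > 0 \<Longrightarrow> (\<lambda>m. \<integral>z. indicator {z. \<delta> \<le> norm (z - \<zeta>)} z * (cmod (h m z))\<^sup>2 \<partial>dV n) \<longlonglongrightarrow> 0"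
proof -
  have nz: "norm \<zeta> = 1" using \<zeta> by simp
  interpret fm: finite_measure "dV n :: (complex ^ 'd) measure" by (rule dV_finite[OF n])
  have [simp]: "measure (dV n) (UNIV :: (complex ^ 'd) set) = 1"
    by (simp add: measure_def emeasure_dV_UNIV[OF n])
  define q where "q = (\<lambda>m. on_ball (\<lambda>z. peak \<zeta> z ^ m))"
  have peak2: "cmod (peak \<zeta> z) \<le> 2" if "z \<in> ball 0 1" for z
  proof (rule power2_le_imp_le)
    have "(cmod (peak \<zeta> z))\<^sup>2 \<le> 4 - (norm (z - \<zeta>))\<^sup>2" using that by (intro peak_bound nz) simp
    also have "\<dots> \<le> 2\<^sup>2" by simp
    finally show "(cmod (peak \<zeta> z))\<^sup>2 \<le> 2\<^sup>2" .
  qed simp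
  have q: "q m \<in> bergman n" for m
    unfolding q_def using peak2
    by (intro on_ball_bergman[OF n, where M = "2 ^ m"] analytic_on_ball_power analytic_on_ball_peak)
      (auto simp: norm_power intro!: power_mono)
  have qL: "L2 n (q m)" for m by (rule bergman_L2[OF q])
  have cont: "continuous_on (ball 0 1) (peak \<zeta>)"
    by (rule analytic_on_ball_continuous[OF analytic_on_ball_peak])
  define V where "V = (\<lambda>c. {z \<in> ball 0 1. c < (cmod (peak \<zeta> z))\<^sup>2})"
  have V: "open (V c)" for c
  proof -
    have "open (ball 0 1 \<inter> (\<lambda>z. (cmod (peak \<zeta> z))\<^sup>2) -` {c<..})"
      by (intro continuous_open_preimage continuous_intros cont) auto
    moreover have "ball 0 1 \<inter> (\<lambda>z. (cmod (peak \<zeta> z))\<^sup>2) -` {c<..} = V c" by (auto simp: V_def)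
    ultimately show ?thesis by simp
  qed
  have Vne: "V c \<noteq> {}" if c: "0 \<le> c" "c < 4" for c
  proof -
    have "sqrt c < 2" using c real_sqrt_less_mono[of c 4] by simp
    then obtain t where t: "max 0 (sqrt c - 1) < t" "t < 1" using dense[of "max 0 (sqrt c - 1)" 1] by auto
    have "c = (sqrt c)\<^sup>2" using c by simp
    also have "\<dots> < (1 + t)\<^sup>2" using t c by (intro power_strict_mono) auto
    also have "\<dots> = (cmod (peak \<zeta> (t *\<^sub>R \<zeta>)))\<^sup>2" unfolding peak_scaled[OF nz] norm_of_real by simp
    finally have "t *\<^sub>R \<zeta> \<in> V c" using t nz by (simp add: V_def)
    then show ?thesis by blast
  qed
  have lower: "c ^ m * measure (dV n) (V c) \<le> (hnorm n (q m))\<^sup>2" if c: "0 \<le> c" for c m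
  proof -
    have [measurable]: "V c \<in> sets borel" using V by simp
    have "c ^ m * measure (dV n) (V c) = (\<integral>z. c ^ m * indicator (V c) z \<partial>dV n)" by simp
    also have "\<dots> \<le> (\<integral>z. (cmod (q m z))\<^sup>2 \<partial>dV n)"
    proof (rule integral_mono)
      show "integrable (dV n) (\<lambda>z. c ^ m * indicator (V c) z)"
        by (intro integrable_mult_right integrable_real_indicator) (simp_all add: fm.emeasure_finite less_top[symmetric])
      show "integrable (dV n) (\<lambda>z. (cmod (q m z))\<^sup>2)" using qL by (simp add: L2_def)
      fix z :: "complex ^ 'd"
      show "c ^ m * indicator (V c) z \<le> (cmod (q m z))\<^sup>2"
      proof (cases "z \<in> V c")
        case True
        then have "c ^ m \<le> ((cmod (peak \<zeta> z))\<^sup>2) ^ m" using c by (intro power_mono) (auto simp: V_def)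
        also have "\<dots> = (cmod (q m z))\<^sup>2"
          using True by (simp add: V_def q_def on_ball_def norm_power power_mult[symmetric] mult.commute)
        finally show ?thesis using True by simp
      qed simp
    qed
    finally show ?thesis by (simp add: hnorm_sq)
  qed
  have Vpos: "measure (dV n) (V c) > 0" if c: "0 \<le> c" "c < 4" for c
  proof -
    have "emeasure (dV n) (V c) > 0" using V Vne[OF c] by (intro emeasure_dV_pos) (auto simp: V_def)
    then show ?thesis by (simp add: fm.emeasure_eq_measure)
  qed
  have q0: "hnorm n (q m) \<noteq> 0" for m
    using lower[of 1 m] Vpos[of 1] by (cases "hnorm n (q m) = 0") auto
  define h where "h = (\<lambda>m z. of_real (1 / hnorm n (q m)) * q m z)"
  show ?thesis
  proof (rule that[of h])
    show "h m \<in> bergman n" for m unfolding h_def by (rule bergman_scale[OF q])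
    show "hnorm n (h m) = 1" for m unfolding h_def by (rule hnorm_normalize[OF q0])
    fix \<delta> :: real assume \<delta>: "\<delta> > 0"
    \<comment> \<open>The cap at 1 keeps \<open>a = 4 - \<eta>\<^sup>2\<close> positive;
      \<open>c\<close> is then taken halfway between \<open>a\<close> and 4.\<close>
    define \<eta> where "\<eta> = min \<delta> 1"
    have \<eta>: "0 < \<eta>" "\<eta> \<le> 1" "\<eta> \<le> \<delta>" using \<delta> by (auto simp: \<eta>_def)
    have \<eta>1: "\<eta>\<^sup>2 \<le> 1" using \<eta> by (simp add: abs_square_le_1)
    define a where "a = 4 - \<eta>\<^sup>2"
    define c where "c = 4 - \<eta>\<^sup>2 / 2"
    have ac: "0 < a" "a < c" "0 \<le> c" "c < 4" using \<eta> \<eta>1 by (auto simp: a_def c_def)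
    let ?A = "{z :: complex ^ 'd. \<delta> \<le> norm (z - \<zeta>)}"
    have [measurable]: "?A \<in> sets borel" by measurable
    have upper: "(\<integral>z. indicator ?A z * (cmod (q m z))\<^sup>2 \<partial>dV n) \<le> a ^ m" for m
    proof -
      have le: "indicator ?A z * (cmod (q m z))\<^sup>2 \<le> a ^ m" for z
      proof (cases "z \<in> ?A \<and> z \<in> ball 0 1")
        case True
        have "(cmod (peak \<zeta> z))\<^sup>2 \<le> 4 - (norm (z - \<zeta>))\<^sup>2" using True by (intro peak_bound nz) auto
        also have "\<dots> \<le> a" unfolding a_def using True \<eta> by (intro diff_left_mono power_mono) auto
        finally have "((cmod (peak \<zeta> z))\<^sup>2) ^ m \<le> a ^ m" by (intro power_mono) auto
        then show ?thesis
          using True by (simp add: q_def on_ball_def norm_power power_mult[symmetric] mult.commute)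
      next
        case False
        then show ?thesis using ac by (auto simp: q_def on_ball_def indicator_def)
      qed
      have "(\<integral>z. indicator ?A z * (cmod (q m z))\<^sup>2 \<partial>dV n) \<le> (\<integral>z. a ^ m \<partial>(dV n :: (complex ^ 'd) measure))"
      proof (rule integral_mono)
        show "integrable (dV n) (\<lambda>z. indicator ?A z * (cmod (q m z))\<^sup>2)"
          using integrable_mult_indicator[of ?A "dV n" "\<lambda>z. (cmod (q m z))\<^sup>2"] qL[of m] by (simp add: L2_def)
      qed (use le in auto)
      then show ?thesis by simp
    qed
    define K where "K = measure (dV n) (V c)"
    have K: "K > 0" unfolding K_def using ac by (intro Vpos) auto
    have bound: "(\<integral>z. indicator ?A z * (cmod (h m z))\<^sup>2 \<partial>dV n) \<le> (a / c) ^ m / K" for m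
    proof -
      have eq: "indicator ?A z * (cmod (h m z))\<^sup>2 = (indicator ?A z * (cmod (q m z))\<^sup>2) / (hnorm n (q m))\<^sup>2" for z
        by (simp add: h_def norm_mult norm_divide power_mult_distrib power_divide)
      have "(\<integral>z. indicator ?A z * (cmod (h m z))\<^sup>2 \<partial>dV n) = (\<integral>z. indicator ?A z * (cmod (q m z))\<^sup>2 \<partial>dV n) / (hnorm n (q m))\<^sup>2"
        unfolding eq by (rule integral_divide_zero)
      also have "\<dots> \<le> a ^ m / (c ^ m * K)"
        using upper[of m] lower[OF ac(3), of m] K ac unfolding K_def[symmetric]
        by (intro frac_le) auto
      finally show ?thesis by (simp add: power_divide)
    qed
    have "(\<lambda>m. (a / c) ^ m / K) \<longlonglongrightarrow> 0 / K"
      using ac K by (intro tendsto_intros LIMSEQ_power_zero) auto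
    then have "(\<lambda>m. (a / c) ^ m / K) \<longlonglongrightarrow> 0" by simp
    then show "(\<lambda>m. \<integral>z. indicator ?A z * (cmod (h m z))\<^sup>2 \<partial>dV n) \<longlonglongrightarrow> 0"
      by (rule tendsto_sandwich[OF _ _ tendsto_const, rotated 2])
        (use bound in \<open>auto intro!: always_eventually integral_nonneg_AE\<close>)
  qed
qed

lemma L2_indicator:
  fixes g :: "'d::finite hfun"
  assumes g: "L2 n g" and [measurable]: "A \<in> sets borel"
  shows "L2 n (\<lambda>z. indicator A z * g z)"
    and "(hnorm n (\<lambda>z. indicator A z * g z))\<^sup>2 = (\<integral>z. indicator A z * (cmod (g z))\<^sup>2 \<partial>dV n)"
proof -
  have [measurable]: "g \<in> borel_measurable borel" by (rule L2_measurable[OF g])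
  have eq: "(cmod (indicator A z * g z))\<^sup>2 = indicator A z * (cmod (g z))\<^sup>2" for z
    by (simp add: indicator_def)
  have "integrable (dV n) (\<lambda>z. indicator A z * (cmod (g z))\<^sup>2)"
    using integrable_mult_indicator[of A "dV n" "\<lambda>z. (cmod (g z))\<^sup>2"] g by (simp add: L2_def)
  moreover have "(\<lambda>z. indicator A z * g z) \<in> borel_measurable borel" by measurable
  ultimately show "L2 n (\<lambda>z. indicator A z * g z)" unfolding L2_def eq by simp
  show "(hnorm n (\<lambda>z. indicator A z * g z))\<^sup>2 = (\<integral>z. indicator A z * (cmod (g z))\<^sup>2 \<partial>dV n)"
    unfolding hnorm_sq eq ..
qed

lemma L2_mult_continuous:
  fixes f :: "'d::finite hfun"
  assumes \<phi>: "continuous_on (cball 0 1) \<phi>" and f: "f \<in> bergman n"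
  shows "L2 n (\<lambda>z. \<phi> z * f z)"
proof -
  have "compact (\<phi> ` cball 0 1)" by (intro compact_continuous_image \<phi>) simp
  then obtain M where M: "\<And>z. z \<in> cball 0 1 \<Longrightarrow> cmod (\<phi> z) \<le> M"
    by (meson bounded_iff compact_imp_bounded image_eqI)
  have cont: "continuous_on (ball 0 1) (\<lambda>z. \<phi> z * f z)"
    by (intro continuous_intros analytic_on_ball_continuous bergman_analytic[OF f] continuous_on_subset[OF \<phi>]) auto
  have meas: "(\<lambda>z. \<phi> z * f z) \<in> borel_measurable borel"
    by (rule continuous_on_ball_measurable[OF cont]) (simp add: bergman_outside[OF f])
  have "integrable (dV n) (\<lambda>z. (cmod (\<phi> z * f z))\<^sup>2)"
  proof (rule Bochner_Integration.integrable_bound)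
    show "integrable (dV n) (\<lambda>z. M\<^sup>2 * (cmod (f z))\<^sup>2)"
      using bergman_L2[OF f] by (intro integrable_mult_right) (simp add: L2_def)
    have [measurable]: "(\<lambda>z. \<phi> z * f z) \<in> borel_measurable borel" by (rule meas)
    show "(\<lambda>z. (cmod (\<phi> z * f z))\<^sup>2) \<in> borel_measurable (dV n)" unfolding measurable_dV_iff by measurable
    have "(cmod (\<phi> z * f z))\<^sup>2 \<le> M\<^sup>2 * (cmod (f z))\<^sup>2" for z
    proof (cases "z \<in> ball 0 1")
      case True
      then have "(cmod (\<phi> z))\<^sup>2 \<le> M\<^sup>2" using M[of z] by (intro power_mono) auto
      then show ?thesis by (simp add: norm_mult power_mult_distrib mult_right_mono)
    next
      case False
      then show ?thesis by (simp add: bergman_outside[OF f])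
    qed
    then show "AE z in dV n. norm ((cmod (\<phi> z * f z))\<^sup>2) \<le> norm (M\<^sup>2 * (cmod (f z))\<^sup>2)"
      by (intro AE_I2) simp
  qed
  with meas show ?thesis by (simp add: L2_def)
qed

locale peaking =
  fixes n :: nat and \<zeta> :: "complex ^ 'd::finite" and h :: "nat \<Rightarrow> 'd hfun"
  assumes \<zeta>: "\<zeta> \<in> sphere 0 1"
    and h: "\<And>m. h m \<in> bergman n" and h1: "\<And>m. hnorm n (h m) = 1"
    and tail: "\<And>\<delta>. \<delta> > 0 \<Longrightarrow> (\<lambda>m. \<integral>z. indicator {z. \<delta> \<le> norm (z - \<zeta>)} z * (cmod (h m z))\<^sup>2 \<partial>dV n) \<longlonglongrightarrow> 0"
begin

lemma hL: "L2 n (h m)"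
  by (rule bergman_L2[OF h])

text \<open>Since \<open>\<zeta>\<close> is on the sphere, every point of the open ball eventually
  leaves the shrinking neighbourhoods, and \<open>dV n\<close> is carried by the ball; dominated
  convergence applies.\<close>

lemma near_null:
  assumes g: "L2 n g"
  shows "(\<lambda>k. hnorm n (\<lambda>z. indicator {z. norm (z - \<zeta>) < inverse (real (Suc k))} z * g z)) \<longlonglongrightarrow> 0"
proof -
  let ?A = "\<lambda>k. {z. norm (z - \<zeta>) < inverse (real (Suc k))}"
  have A [measurable]: "?A k \<in> sets borel" for k by measurable
  have [measurable]: "g \<in> borel_measurable borel" by (rule L2_measurable[OF g])
  have "(\<lambda>k. \<integral>z. indicator (?A k) z * (cmod (g z))\<^sup>2 \<partial>dV n) \<longlonglongrightarrow> (\<integral>z. 0 \<partial>(dV n :: (complex ^ 'd) measure))"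
  proof (rule integral_dominated_convergence)
    show "integrable (dV n) (\<lambda>z. (cmod (g z))\<^sup>2)" using g by (simp add: L2_def)
    show "(\<lambda>z. indicat_real (?A k) z * (cmod (g z))\<^sup>2) \<in> borel_measurable (dV n)" for k
      unfolding measurable_dV_iff by measurable
    have ptw: "(\<lambda>k. indicat_real (?A k) z * (cmod (g z))\<^sup>2) \<longlonglongrightarrow> 0" if z: "z \<in> ball 0 1" for z
    proof -
      have "norm (z - \<zeta>) > 0" using z \<zeta> by auto
      then obtain N where N: "inverse (real (Suc N)) < norm (z - \<zeta>)" using reals_Archimedean by blast
      have "indicat_real (?A k) z * (cmod (g z))\<^sup>2 = 0" if "k \<ge> N" for k
      proof -
        have "inverse (real (Suc k)) \<le> inverse (real (Suc N))" using that by (simp add: field_simps)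
        then have "\<not> norm (z - \<zeta>) < inverse (real (Suc k))" using N by linarith
        then have "z \<notin> ?A k" by simp
        then have "indicat_real (?A k) z = 0" by (rule indicator_simps(2))
        then show ?thesis by (simp only: mult_zero_left)
      qed
      then show ?thesis
        by (intro tendsto_eventually) (auto simp: eventually_sequentially)
    qed
    show "AE z in dV n. (\<lambda>k. indicat_real (?A k) z * (cmod (g z))\<^sup>2) \<longlonglongrightarrow> 0"
      using AE_dV_ball by eventually_elim (rule ptw)
    show "AE z in dV n. norm (indicat_real (?A k) z * (cmod (g z))\<^sup>2) \<le> (cmod (g z))\<^sup>2" for k
      by (intro AE_I2) (simp add: indicator_def)
  qed simp
  then have "(\<lambda>k. (hnorm n (\<lambda>z. indicator (?A k) z * g z))\<^sup>2) \<longlonglongrightarrow> 0"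
    by (simp only: L2_indicator(2)[OF g A] Bochner_Integration.integral_zero)
  then have "(\<lambda>k. sqrt ((hnorm n (\<lambda>z. indicator (?A k) z * g z))\<^sup>2)) \<longlonglongrightarrow> sqrt 0"
    by (rule tendsto_real_sqrt)
  then show ?thesis by simp
qed

text \<open>Near \<open>\<zeta>\<close> the fixed function \<open>g\<close> has little mass, away
  from \<open>\<zeta>\<close> the functions \<open>h m\<close> have little mass, and Cauchy-Schwarz
  bounds both contributions.\<close>

lemma weak_null:
  assumes g: "L2 n g"
  shows "(\<lambda>m. ip n g (h m)) \<longlonglongrightarrow> 0"
proof (rule LIMSEQ_I)
  fix \<epsilon> :: real assume \<epsilon>: "\<epsilon> > 0"
  have "\<forall>\<^sub>F k in sequentially. hnorm n (\<lambda>z. indicator {z. norm (z - \<zeta>) < inverse (real (Suc k))} z * g z) < \<epsilon> / 2"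
    using \<epsilon> by (intro order_tendstoD(2)[OF near_null[OF g]]) simp
  then obtain k where k: "hnorm n (\<lambda>z. indicator {z. norm (z - \<zeta>) < inverse (real (Suc k))} z * g z) < \<epsilon> / 2"
    by (auto simp: eventually_sequentially)
  define \<delta> where "\<delta> = inverse (real (Suc k))"
  have \<delta>: "\<delta> > 0" by (simp add: \<delta>_def)
  let ?N = "{z. norm (z - \<zeta>) < \<delta>}" and ?F = "{z. \<delta> \<le> norm (z - \<zeta>)}"
  have [measurable]: "?N \<in> sets borel" "?F \<in> sets borel" by measurable
  have "(\<lambda>m. hnorm n g * sqrt (\<integral>z. indicator ?F z * (cmod (h m z))\<^sup>2 \<partial>dV n)) \<longlonglongrightarrow> hnorm n g * sqrt 0"
    by (intro tendsto_intros tail \<delta>)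
  then have "\<forall>\<^sub>F m in sequentially. hnorm n g * sqrt (\<integral>z. indicator ?F z * (cmod (h m z))\<^sup>2 \<partial>dV n) < \<epsilon> / 2"
    using \<epsilon> by (intro order_tendstoD(2)) auto
  then obtain M where M: "\<And>m. m \<ge> M \<Longrightarrow> hnorm n g * sqrt (\<integral>z. indicator ?F z * (cmod (h m z))\<^sup>2 \<partial>dV n) < \<epsilon> / 2"
    by (auto simp: eventually_sequentially)
  have "norm (ip n g (h m) - 0) < \<epsilon>" if m: "m \<ge> M" for m
  proof -
    let ?G = "\<lambda>z. indicator ?N z * g z" and ?G' = "\<lambda>z. indicator ?F z * g z" and ?H = "\<lambda>z. indicator ?F z * h m z"
    have eq: "g = ?G + ?G'" by (auto simp: fun_eq_iff indicator_def)
    have "ip n g (h m) = ip n ?G (h m) + ip n ?G' (h m)"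
      by (subst eq, rule ip_add_left) (simp_all add: L2_indicator(1)[OF g] hL)
    also have "ip n ?G' (h m) = ip n g ?H"
      unfolding ip_def by (intro Bochner_Integration.integral_cong) (auto simp: indicator_def)
    finally have "cmod (ip n g (h m)) \<le> cmod (ip n ?G (h m)) + cmod (ip n g ?H)"
      by (simp add: norm_triangle_ineq)
    also have "\<dots> \<le> hnorm n ?G * hnorm n (h m) + hnorm n g * hnorm n ?H"
      by (intro add_mono Cauchy_Schwarz) (simp_all add: L2_indicator(1)[OF g] L2_indicator(1)[OF hL] hL g)
    also have "hnorm n ?H = sqrt (\<integral>z. indicator ?F z * (cmod (h m z))\<^sup>2 \<partial>dV n)"
    proof -
      have "(hnorm n ?H)\<^sup>2 = (\<integral>z. indicator ?F z * (cmod (h m z))\<^sup>2 \<partial>dV n)"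
        by (rule L2_indicator(2)[OF hL]) measurable
      then show ?thesis by (rule real_sqrt_unique[OF _ hnorm_nonneg, symmetric])
    qed
    also have "hnorm n ?G * hnorm n (h m) + hnorm n g * \<dots> < \<epsilon> / 2 + \<epsilon> / 2"
      using k M[OF m] by (intro add_strict_mono) (simp_all add: h1 \<delta>_def)
    finally show ?thesis by simp
  qed
  then show "\<exists>no. \<forall>m\<ge>no. norm (ip n g (h m) - 0) < \<epsilon>" by blast
qed

text \<open>The densities \<open>(cmod (h m z))\<^sup>2\<close> have total mass 1 and concentrate at
  \<open>\<zeta>\<close>; near \<open>\<zeta>\<close> continuity of \<open>\<phi>\<close> is used,
  elsewhere its boundedness on the closed ball.\<close>

lemma multiplication_limit:
  assumes \<phi>: "continuous_on (cball 0 1) \<phi>"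
  shows "(\<lambda>m. ip n (\<lambda>z. \<phi> z * h m z) (h m)) \<longlonglongrightarrow> \<phi> \<zeta>"
proof (rule LIMSEQ_I)
  fix \<epsilon> :: real assume \<epsilon>: "\<epsilon> > 0"
  have "compact (\<phi> ` cball 0 1)" by (intro compact_continuous_image \<phi>) simp
  then obtain M where M: "\<And>z. z \<in> cball 0 1 \<Longrightarrow> cmod (\<phi> z) \<le> M"
    by (meson bounded_iff compact_imp_bounded image_eqI)
  have \<zeta>c: "\<zeta> \<in> cball 0 1" using \<zeta> by simp
  have M0: "0 \<le> M" using order_trans[OF norm_ge_zero M[OF \<zeta>c]] .
  obtain \<delta> where \<delta>: "\<delta> > 0" "\<And>z. z \<in> cball 0 1 \<Longrightarrow> dist z \<zeta> < \<delta> \<Longrightarrow> dist (\<phi> z) (\<phi> \<zeta>) < \<epsilon> / 2"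
    using \<phi> \<zeta>c \<epsilon> unfolding continuous_on_iff by (meson half_gt_zero)
  let ?F = "{z. \<delta> \<le> norm (z - \<zeta>)}"
  have [measurable]: "?F \<in> sets borel" by measurable
  have "(\<lambda>m. 2 * M * (\<integral>z. indicator ?F z * (cmod (h m z))\<^sup>2 \<partial>dV n)) \<longlonglongrightarrow> 2 * M * 0"
    by (intro tendsto_intros tail \<delta>)
  then have "\<forall>\<^sub>F m in sequentially. 2 * M * (\<integral>z. indicator ?F z * (cmod (h m z))\<^sup>2 \<partial>dV n) < \<epsilon> / 2"
    using \<epsilon> by (intro order_tendstoD(2)) auto
  then obtain N where N: "\<And>m. m \<ge> N \<Longrightarrow> 2 * M * (\<integral>z. indicator ?F z * (cmod (h m z))\<^sup>2 \<partial>dV n) < \<epsilon> / 2"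
    by (auto simp: eventually_sequentially)
  have "norm (ip n (\<lambda>z. \<phi> z * h m z) (h m) - \<phi> \<zeta>) < \<epsilon>" if m: "m \<ge> N" for m
  proof -
    let ?D = "\<lambda>z. (\<phi> z - \<phi> \<zeta>) * h m z"
    have DL: "L2 n ?D" by (intro L2_mult_continuous h continuous_intros \<phi>)
    have "ip n (\<lambda>z. \<phi> z * h m z) (h m) - ip n (\<lambda>z. \<phi> \<zeta> * h m z) (h m) = ip n ?D (h m)"
    proof -
      have "?D = (\<lambda>z. \<phi> z * h m z) - (\<lambda>z. \<phi> \<zeta> * h m z)" by (simp add: fun_eq_iff left_diff_distrib)
      then show ?thesis
        using ip_diff_left[OF L2_mult_continuous[OF \<phi> h] L2_scale[OF hL] hL] by simp
    qed
    then have "ip n (\<lambda>z. \<phi> z * h m z) (h m) - \<phi> \<zeta> = ip n ?D (h m)"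
      by (simp add: ip_scale_left ip_self_hnorm h1)
    moreover have "cmod (ip n ?D (h m)) \<le> \<epsilon> / 2 + 2 * M * (\<integral>z. indicator ?F z * (cmod (h m z))\<^sup>2 \<partial>dV n)"
    proof -
      have hi: "integrable (dV n) (\<lambda>z. (cmod (h m z))\<^sup>2)" using hL by (simp add: L2_def)
      have Fi: "integrable (dV n) (\<lambda>z. indicator ?F z * (cmod (h m z))\<^sup>2)"
        using integrable_mult_indicator[of ?F "dV n" "\<lambda>z. (cmod (h m z))\<^sup>2"] hi by simp
      have le: "cmod (?D z * cnj (h m z)) \<le> \<epsilon> / 2 * (cmod (h m z))\<^sup>2 + 2 * M * (indicator ?F z * (cmod (h m z))\<^sup>2)" for z
      proof (cases "z \<in> ball 0 1")
        case True
        have eq: "cmod (?D z * cnj (h m z)) = cmod (\<phi> z - \<phi> \<zeta>) * (cmod (h m z))\<^sup>2"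
          by (simp add: norm_mult power2_eq_square)
        have "cmod (\<phi> z - \<phi> \<zeta>) \<le> \<epsilon> / 2 + 2 * M * indicator ?F z"
        proof (cases "z \<in> ?F")
          case True
          have "cmod (\<phi> z - \<phi> \<zeta>) \<le> cmod (\<phi> z) + cmod (\<phi> \<zeta>)" by (rule norm_triangle_ineq4)
          also have "\<dots> \<le> M + M" using \<open>z \<in> ball 0 1\<close> \<zeta>c by (intro add_mono M) auto
          finally show ?thesis using True \<epsilon> by simp
        next
          case False
          then have "dist (\<phi> z) (\<phi> \<zeta>) < \<epsilon> / 2" using True by (intro \<delta>) (auto simp: dist_norm)
          with False show ?thesis by (simp add: dist_norm)
        qed
        from mult_right_mono[OF this, of "(cmod (h m z))\<^sup>2"] show ?thesis
          unfolding eq by (simp add: distrib_right mult.assoc)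
      next
        case False
        then show ?thesis using bergman_outside[OF h] by simp
      qed
      have "cmod (ip n ?D (h m)) \<le> (\<integral>z. cmod (?D z * cnj (h m z)) \<partial>dV n)"
        unfolding ip_def by (rule integral_norm_bound)
      also have "\<dots> \<le> (\<integral>z. \<epsilon> / 2 * (cmod (h m z))\<^sup>2 + 2 * M * (indicator ?F z * (cmod (h m z))\<^sup>2) \<partial>dV n)"
        by (rule integral_mono)
          (use L2_integrable_mult[OF DL hL] hi Fi le in \<open>auto intro!: Bochner_Integration.integrable_add integrable_mult_right integrable_norm\<close>)
      also have "\<dots> = \<epsilon> / 2 * (\<integral>z. (cmod (h m z))\<^sup>2 \<partial>dV n) + 2 * M * (\<integral>z. indicator ?F z * (cmod (h m z))\<^sup>2 \<partial>dV n)"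
        using hi Fi by (simp add: Bochner_Integration.integral_add)
      finally show ?thesis by (simp add: hnorm_sq[symmetric] h1)
    qed
    ultimately show ?thesis using N[OF m] by simp
  qed
  then show "\<exists>no. \<forall>m\<ge>no. norm (ip n (\<lambda>z. \<phi> z * h m z) (h m) - \<phi> \<zeta>) < \<epsilon>" by blast
qed

text \<open>Along a subsequence the images converge in norm to some \<open>g\<close>, and
  \<open>g\<close> pairs to zero with the weakly null sequence in the limit.\<close>

lemma compact_limit:
  assumes K: "K \<in> compact_ops n"
  shows "\<exists>r. strict_mono (r :: nat \<Rightarrow> nat) \<and> (\<lambda>k. ip n (K (h (r k))) (h (r k))) \<longlonglongrightarrow> 0"
proof -
  obtain r g where r: "strict_mono (r :: nat \<Rightarrow> nat)" and g: "g \<in> bergman n"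
    and lim: "(\<lambda>k. hnorm n (K (h (r k)) - g)) \<longlonglongrightarrow> 0"
    using compact_opsD[OF K, of h] h h1 by auto
  have KL: "L2 n (K (h m))" for m by (rule bounded_ops_L2[OF compact_ops_bounded[OF K] h])
  have gL: "L2 n g" by (rule bergman_L2[OF g])
  have le: "cmod (ip n (K (h m)) (h m)) \<le> hnorm n (K (h m) - g) + cmod (ip n g (h m))" for m
  proof -
    have "ip n (K (h m)) (h m) = ip n (K (h m) - g) (h m) + ip n g (h m)"
      by (simp add: ip_diff_left KL gL hL)
    then have "cmod (ip n (K (h m)) (h m)) \<le> cmod (ip n (K (h m) - g) (h m)) + cmod (ip n g (h m))"
      by (simp add: norm_triangle_ineq)
    then show ?thesis using Cauchy_Schwarz[OF L2_diff[OF KL gL] hL, of m m] by (simp add: h1)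
  qed
  have "(\<lambda>k. hnorm n (K (h (r k)) - g) + cmod (ip n g (h (r k)))) \<longlonglongrightarrow> 0 + cmod 0"
    using LIMSEQ_subseq_LIMSEQ[OF weak_null[OF gL] r] by (intro tendsto_intros lim) (simp add: o_def)
  then have null: "(\<lambda>k. hnorm n (K (h (r k)) - g) + cmod (ip n g (h (r k)))) \<longlonglongrightarrow> 0" by simp
  have "(\<lambda>k. ip n (K (h (r k))) (h (r k))) \<longlonglongrightarrow> 0"
    by (rule Lim_null_comparison[OF always_eventually[OF allI[OF le]] null])
  with r show ?thesis by blast
qed

lemma op_id_not_compact: "(op_id n :: 'd hop) \<notin> compact_ops n"
proof
  assume "(op_id n :: 'd hop) \<in> compact_ops n"
  then obtain r where "(\<lambda>k. ip n (op_id n (h (r k))) (h (r k))) \<longlonglongrightarrow> 0"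
    using compact_limit by blast
  then have "(\<lambda>k::nat. 1 :: complex) \<longlonglongrightarrow> 0" by (simp add: ip_op_id[OF h] h1)
  then show False by (simp add: LIMSEQ_const_iff)
qed

end

text \<open>
  The orthogonal projection is a definite description, so a Toeplitz operator could be junk on vectors
  \<open>\<phi> f\<close> without a projection. Linearity of a bounded \<open>T\<^sub>\<phi>\<close> forces the junk value to be \<open>0\<close>, and then
  \<open>T\<^sub>\<phi>\<close> vanishes off a proper subspace, hence everywhere. This replaces completeness of the Bergman space.
\<close>

definition has_projections :: "nat \<Rightarrow> 'd::finite hfun \<Rightarrow> bool" where
  "has_projections n \<phi> \<longleftrightarrow>
    (\<forall>f\<in>bergman n. \<exists>p\<in>bergman n. \<forall>g\<in>bergman n. ip n ((\<lambda>z. \<phi> z * f z) - p) g = 0)"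

lemma ip_toeplitz:
  fixes f :: "'d::finite hfun"
  assumes \<phi>: "continuous_on (cball 0 1) \<phi>" and ok: "has_projections n \<phi>"
    and f: "f \<in> bergman n" and g: "g \<in> bergman n"
  shows "ip n (toeplitz n \<phi> f) g = ip n (\<lambda>z. \<phi> z * f z) g"
proof -
  have L: "L2 n (\<lambda>z. \<phi> z * f z)" by (rule L2_mult_continuous[OF \<phi> f])
  obtain p where p: "p \<in> bergman n" "\<And>g. g \<in> bergman n \<Longrightarrow> ip n ((\<lambda>z. \<phi> z * f z) - p) g = 0"
    using ok f unfolding has_projections_def by blast
  have "bergman_proj n (\<lambda>z. \<phi> z * f z) = p"
    unfolding bergman_proj_def
  proof (rule the_equality)
    fix q assume q: "q \<in> bergman n \<and> (\<forall>g\<in>bergman n. ip n ((\<lambda>z. \<phi> z * f z) - q) g = 0)"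
    have d: "q - p \<in> bergman n" using q p by (simp add: bergman_diff)
    note qL = bergman_L2[of q n] and pL = bergman_L2[OF p(1)]
    have "ip n ((\<lambda>z. \<phi> z * f z) - p) (q - p) - ip n ((\<lambda>z. \<phi> z * f z) - q) (q - p) = ip n (q - p) (q - p)"
      using q pL qL L bergman_L2[OF d] by (simp add: ip_diff_left)
    then have "ip n (q - p) (q - p) = 0" using q p(2)[OF d] d by simp
    then have "q - p = 0" by (intro bergman_definite[OF d]) (simp add: hnorm_def)
    then show "q = p" by simp
  qed (use p in auto)
  then have "toeplitz n \<phi> f = p" using f by (simp add: toeplitz_def)
  moreover have "ip n (\<lambda>z. \<phi> z * f z) g - ip n p g = 0"
    using p(2)[OF g] ip_diff_left[OF L bergman_L2[OF p(1)] bergman_L2[OF g]] by simp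
  ultimately show ?thesis by simp
qed

lemma toeplitz_degenerate:
  fixes \<phi> :: "'d::finite hfun"
  assumes b: "toeplitz n \<phi> \<in> bounded_ops n" and no: "\<not> has_projections n \<phi>"
    and \<phi>: "continuous_on (cball 0 1) \<phi>"
  shows "toeplitz n \<phi> = 0"
proof -
  let ?P = "\<lambda>f p. p \<in> bergman n \<and> (\<forall>g\<in>bergman n. ip n ((\<lambda>z. \<phi> z * f z) - p) g = 0)"
  define J :: "'d hfun" where "J = (THE p. False)"
  have junk: "toeplitz n \<phi> f = J" if "f \<in> bergman n" "\<nexists>p. ?P f p" for f
  proof -
    have "?P f = (\<lambda>p. False)" using that(2) by (auto simp: fun_eq_iff)
    then show ?thesis using that(1) unfolding toeplitz_def bergman_proj_def J_def by simp
  qed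
  obtain f0 where f0: "f0 \<in> bergman n" "\<nexists>p. ?P f0 p"
    using no unfolding has_projections_def by blast
  \<comment> \<open>Half of a projection for \<open>2 * f0\<close> would be one for
    \<open>f0\<close>. So both vectors are sent to \<open>J\<close>, and linearity gives
    \<open>J = 2 * J\<close>.\<close>
  have "\<nexists>p. ?P (\<lambda>z. 2 * f0 z) p"
  proof
    assume "\<exists>p. ?P (\<lambda>z. 2 * f0 z) p"
    then obtain p where p: "p \<in> bergman n" "\<And>g. g \<in> bergman n \<Longrightarrow> ip n ((\<lambda>z. \<phi> z * (2 * f0 z)) - p) g = 0" by blast
    have eq: "(\<lambda>z. \<phi> z * f0 z) - (\<lambda>z. 1 / 2 * p z) = (\<lambda>z. 1 / 2 * ((\<lambda>z. \<phi> z * (2 * f0 z)) - p) z)"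
      by (simp add: fun_eq_iff field_simps)
    have "\<forall>g\<in>bergman n. ip n ((\<lambda>z. \<phi> z * f0 z) - (\<lambda>z. 1 / 2 * p z)) g = 0"
      unfolding eq by (intro ballI) (simp only: ip_scale_left p(2) mult_zero_right)
    with f0(2) bergman_scale[OF p(1), of "1 / 2"] show False by blast
  qed
  then have "toeplitz n \<phi> (\<lambda>z. 2 * f0 z) = J" by (rule junk[OF bergman_scale[OF f0(1)]])
  moreover have "toeplitz n \<phi> (\<lambda>z. 2 * f0 z) = (\<lambda>z. 2 * toeplitz n \<phi> f0 z)"
    by (rule bounded_opsD(4)[OF b f0(1)])
  moreover have T0: "toeplitz n \<phi> f0 = J" by (rule junk[OF f0])
  ultimately have "J z = 2 * J z" for z by metis
  then have J0: "J = 0" by (auto simp: fun_eq_iff)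
  have "toeplitz n \<phi> f = 0" if f: "f \<in> bergman n" for f
  proof (cases "\<exists>p. ?P f p")
    case False
    then show ?thesis using junk[OF f] J0 by simp
  next
    case True
    then obtain p where p: "p \<in> bergman n" "\<And>g. g \<in> bergman n \<Longrightarrow> ip n ((\<lambda>z. \<phi> z * f z) - p) g = 0" by blast
    \<comment> \<open>A projection for \<open>f + f0\<close> minus the one for \<open>f\<close>
      would be a projection for \<open>f0\<close>. So \<open>f + f0\<close> is sent to
      \<open>J = 0\<close>, as is \<open>f0\<close>, and additivity leaves \<open>0\<close> for
      \<open>f\<close>.\<close>
    have "\<nexists>q. ?P (f + f0) q"
    proof
      assume "\<exists>q. ?P (f + f0) q"
      then obtain q where q: "q \<in> bergman n" "\<And>g. g \<in> bergman n \<Longrightarrow> ip n ((\<lambda>z. \<phi> z * (f + f0) z) - q) g = 0" by blast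
      have eq: "(\<lambda>z. \<phi> z * f0 z) - (q - p) = ((\<lambda>z. \<phi> z * (f + f0) z) - q) - ((\<lambda>z. \<phi> z * f z) - p)"
        by (simp add: fun_eq_iff algebra_simps)
      have "ip n ((\<lambda>z. \<phi> z * f0 z) - (q - p)) g = 0" if g: "g \<in> bergman n" for g
      proof -
        have "ip n ((\<lambda>z. \<phi> z * f0 z) - (q - p)) g
            = ip n ((\<lambda>z. \<phi> z * (f + f0) z) - q) g - ip n ((\<lambda>z. \<phi> z * f z) - p) g"
          unfolding eq
          by (intro ip_diff_left L2_diff L2_mult_continuous \<phi> f bergman_add f0(1) bergman_L2[OF p(1)]
              bergman_L2[OF q(1)] bergman_L2[OF g])
        then show ?thesis by (simp only: q(2)[OF g] p(2)[OF g] diff_self)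
      qed
      with bergman_diff[OF q(1) p(1)] f0(2) show False by blast
    qed
    then have "toeplitz n \<phi> (f + f0) = 0" using junk[OF bergman_add[OF f f0(1)]] J0 by simp
    then show ?thesis using bounded_opsD(3)[OF b f f0(1)] T0 J0 by simp
  qed
  then show ?thesis by (auto simp: toeplitz_def fun_eq_iff)
qed

context peaking
begin

text \<open>The Toeplitz part \<open>T - K\<close> is bounded, so either its projections exist and
  the limits of its two summands apply, or it is zero by \<open>toeplitz_degenerate\<close> and
  \<open>T = K\<close> is compact.\<close>

lemma symbol_dichotomy:
  assumes T: "T \<in> bounded_ops n" and sym: "has_symbol n T F"
  shows "T \<in> compact_ops n \<or>
    (\<exists>r. strict_mono (r :: nat \<Rightarrow> nat) \<and> (\<lambda>k. ip n (T (h (r k))) (h (r k))) \<longlonglongrightarrow> F \<zeta>)"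
proof -
  obtain \<phi> K where \<phi>: "continuous_on (cball 0 1) \<phi>" and K: "K \<in> compact_ops n"
    and TK: "T = toeplitz n \<phi> + K" and F: "\<And>z. z \<in> sphere 0 1 \<Longrightarrow> \<phi> z = F z"
    using sym unfolding has_symbol_def by blast
  have "toeplitz n \<phi> = T - K" by (simp add: TK)
  then have b: "toeplitz n \<phi> \<in> bounded_ops n"
    using bounded_ops_minus[OF T compact_ops_bounded[OF K]] by simp
  show ?thesis
  proof (cases "has_projections n \<phi>")
    case False
    then show ?thesis using toeplitz_degenerate[OF b False \<phi>] TK K by simp
  next
    case True
    obtain r where r: "strict_mono (r :: nat \<Rightarrow> nat)" and lim: "(\<lambda>k. ip n (K (h (r k))) (h (r k))) \<longlonglongrightarrow> 0"
      using compact_limit[OF K] by blast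
    have "ip n (T (h m)) (h m) = ip n (\<lambda>z. \<phi> z * h m z) (h m) + ip n (K (h m)) (h m)" for m
      unfolding TK ip_add_op[OF b compact_ops_bounded[OF K] h hL] ip_toeplitz[OF \<phi> True h h] ..
    moreover have "(\<lambda>k. ip n (\<lambda>z. \<phi> z * h (r k) z) (h (r k))) \<longlonglongrightarrow> \<phi> \<zeta>"
      using LIMSEQ_subseq_LIMSEQ[OF multiplication_limit[OF \<phi>] r] by (simp add: o_def)
    ultimately have "(\<lambda>k. ip n (T (h (r k))) (h (r k))) \<longlonglongrightarrow> \<phi> \<zeta> + 0"
      using lim by (simp only:) (intro tendsto_add)
    with r F[OF \<zeta>] show ?thesis by auto
  qed
qed

text \<open>Excludes the compact alternative by a shift. If \<open>T\<close> is compact, then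
  \<open>T + op_id n\<close> is not, since the identity is not compact; the dichotomy for the
  shifted operator gives the limit \<open>F \<zeta> + 1\<close>, and the shift contributes exactly 1
  because the \<open>h m\<close> are unit vectors.\<close>

lemma symbol_limit:
  assumes T: "T \<in> bounded_ops n" and sym: "has_symbol n T F"
    and sym1: "has_symbol n (T + op_id n) (F + indicator (sphere 0 1))"
  shows "\<exists>r. strict_mono (r :: nat \<Rightarrow> nat) \<and> (\<lambda>k. ip n (T (h (r k))) (h (r k))) \<longlonglongrightarrow> F \<zeta>"
proof (cases "T \<in> compact_ops n")
  case False
  then show ?thesis using symbol_dichotomy[OF T sym] by blast
next
  case True
  have "T + op_id n \<notin> compact_ops n"
  proof
    assume "T + op_id n \<in> compact_ops n"
    then have "(T + op_id n) - T \<in> compact_ops n" using True by (rule subspace_diff[OF compact_ops_subspace])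
    then show False using op_id_not_compact by simp
  qed
  then obtain r where r: "strict_mono (r :: nat \<Rightarrow> nat)"
    and lim: "(\<lambda>k. ip n ((T + op_id n) (h (r k))) (h (r k))) \<longlonglongrightarrow> (F + indicator (sphere 0 1)) \<zeta>"
    using symbol_dichotomy[OF bounded_ops_add[OF T bounded_ops_op_id] sym1] by blast
  have "ip n ((T + op_id n) (h m)) (h m) = ip n (T (h m)) (h m) + 1" for m
    by (simp only: ip_add_op[OF T bounded_ops_op_id h hL] ip_op_id[OF h] h1) simp
  then have "(\<lambda>k. ip n (T (h (r k))) (h (r k)) + 1) \<longlonglongrightarrow> F \<zeta> + 1"
    using lim \<zeta> by simp
  then have "(\<lambda>k. ip n (T (h (r k))) (h (r k))) \<longlonglongrightarrow> F \<zeta>"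
    using tendsto_diff[OF _ tendsto_const, of _ "F \<zeta> + 1" sequentially 1] by fastforce
  with r show ?thesis by blast
qed

end

lemma positive_op_symbol_nonneg:
  fixes T :: "'d::finite hop"
  assumes n: "n \<ge> CARD('d)" and T: "positive_op n T" and sym: "has_symbol n T F"
    and sym1: "has_symbol n (T + op_id n) (F + indicator (sphere 0 1))" and \<zeta>: "\<zeta> \<in> sphere 0 1"
  shows "0 \<le> Re (F \<zeta>)"
proof -
  obtain h :: "nat \<Rightarrow> 'd hfun" where h: "\<And>m. h m \<in> bergman n" "\<And>m. hnorm n (h m) = 1"
    "\<And>\<delta>. \<delta> > 0 \<Longrightarrow> (\<lambda>m. \<integral>z. indicator {z. \<delta> \<le> norm (z - \<zeta>)} z * (cmod (h m z))\<^sup>2 \<partial>dV n) \<longlonglongrightarrow> 0"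
    using peaking_sequence[OF n \<zeta>] by blast
  interpret peaking n \<zeta> h by standard (use \<zeta> h in auto)
  obtain r where "(\<lambda>k. ip n (T (h (r k))) (h (r k))) \<longlonglongrightarrow> F \<zeta>"
    using symbol_limit[OF positive_op_bounded[OF T] sym sym1] by blast
  then have "(\<lambda>k. Re (ip n (T (h (r k))) (h (r k)))) \<longlonglongrightarrow> Re (F \<zeta>)" by (rule tendsto_Re)
  then show ?thesis by (rule LIMSEQ_le_const) (use positive_opD(2)[OF T h(1)] in auto)
qed

section \<open>The Lipschitz functions on the sphere\<close>

lemma sphere_space_simps [simp]:
  "ou_carrier sphere_space = Lip_sphere"
  "ou_le sphere_space f g \<longleftrightarrow> (\<forall>z\<in>sphere 0 1. f z \<le> g z)"
  "ou_unit sphere_space = indicator (sphere 0 1)"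
  by (simp_all add: sphere_space_def)

lemma Lip_sphere_outside: "f \<in> Lip_sphere \<Longrightarrow> z \<notin> sphere 0 1 \<Longrightarrow> f z = 0"
  by (simp add: Lip_sphere_def)

text \<open>Every admissible constant bounds each difference quotient, hence so does their
  infimum.\<close>

lemma lipschitz_on_L_sphere:
  assumes f: "f \<in> Lip_sphere"
  shows "(L_sphere f)-lipschitz_on (sphere 0 1) f"
proof -
  obtain C where C: "C-lipschitz_on (sphere 0 1) f" using f by (auto simp: Lip_sphere_def)
  show ?thesis
  proof (rule lipschitz_onI)
    show "0 \<le> L_sphere f"
      unfolding L_sphere_def using C by (intro cInf_greatest) (auto dest: lipschitz_on_nonneg)
    fix x y :: "complex ^ 'a" assume xy: "x \<in> sphere 0 1" "y \<in> sphere 0 1"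
    show "dist (f x) (f y) \<le> L_sphere f * dist x y"
    proof (cases "x = y")
      case False
      then have pos: "dist x y > 0" by simp
      have "dist (f x) (f y) / dist x y \<le> L_sphere f"
        unfolding L_sphere_def
      proof (rule cInf_greatest)
        fix D assume "D \<in> {C. C-lipschitz_on (sphere 0 1) f}"
        then have "dist (f x) (f y) \<le> D * dist x y" using xy by (auto dest: lipschitz_onD)
        then show "dist (f x) (f y) / dist x y \<le> D" using pos by (simp add: pos_divide_le_eq)
      qed (use C in auto)
      then show ?thesis using pos by (simp add: pos_divide_le_eq)
    qed simp
  qed
qed

lemma L_sphere_nonneg: "f \<in> Lip_sphere \<Longrightarrow> 0 \<le> L_sphere f"
  using lipschitz_on_L_sphere lipschitz_on_nonneg by blast

lemma L_sphere_le: "C-lipschitz_on (sphere 0 1) f \<Longrightarrow> L_sphere f \<le> C"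
  unfolding L_sphere_def by (intro cInf_lower bdd_belowI[of _ 0]) (auto dest: lipschitz_on_nonneg)

lemma lipschitz_sphere_add:
  fixes f g :: "complex ^ 'd::finite \<Rightarrow> real"
  assumes "C-lipschitz_on X f" "D-lipschitz_on X g"
  shows "(C + D)-lipschitz_on X (f + g)"
  using lipschitz_on_add[OF assms] by (simp add: plus_fun_def)

lemma lipschitz_sphere_scaleR:
  fixes f :: "complex ^ 'd::finite \<Rightarrow> real"
  assumes "C-lipschitz_on X f"
  shows "(\<bar>r\<bar> * C)-lipschitz_on X (r *\<^sub>R f)"
  using lipschitz_on_cmult_real[OF assms, of r] by (simp add: scaleR_fun_def)

lemma Lip_sphere_subspace: "subspace Lip_sphere"
proof (rule subspaceI)
  have "0-lipschitz_on (sphere 0 1) (0 :: complex ^ 'a \<Rightarrow> real)"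
    by (rule lipschitz_onI) auto
  then show "(0 :: complex ^ 'a \<Rightarrow> real) \<in> Lip_sphere" by (auto simp: Lip_sphere_def)
  show "f + g \<in> Lip_sphere" if "f \<in> Lip_sphere" "g \<in> Lip_sphere" for f g :: "complex ^ 'a \<Rightarrow> real"
    using that lipschitz_sphere_add[of _ "sphere 0 1" f _ g] by (auto simp: Lip_sphere_def)
  show "r *\<^sub>R f \<in> Lip_sphere" if "f \<in> Lip_sphere" for r and f :: "complex ^ 'a \<Rightarrow> real"
    using that lipschitz_sphere_scaleR[of _ "sphere 0 1" f r] by (auto simp: Lip_sphere_def scaleR_fun_def)
qed

lemma indicator_Lip_sphere: "(indicator (sphere 0 1) :: complex ^ 'a::finite \<Rightarrow> real) \<in> Lip_sphere"
  and L_sphere_indicator: "L_sphere (indicator (sphere 0 1) :: complex ^ 'a \<Rightarrow> real) = 0"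
proof -
  have l: "0-lipschitz_on (sphere 0 1) (indicator (sphere 0 1) :: complex ^ 'a \<Rightarrow> real)"
    by (rule lipschitz_onI) auto
  then show i: "(indicator (sphere 0 1) :: complex ^ 'a \<Rightarrow> real) \<in> Lip_sphere"
    unfolding Lip_sphere_def by auto
  show "L_sphere (indicator (sphere 0 1) :: complex ^ 'a \<Rightarrow> real) = 0"
    using L_sphere_le[OF l] L_sphere_nonneg[OF i] by simp
qed

lemma Lip_sphere_bounded:
  assumes f: "f \<in> Lip_sphere"
  obtains M where "\<And>z. z \<in> sphere 0 1 \<Longrightarrow> \<bar>f z\<bar> \<le> M"
proof -
  have "continuous_on (sphere 0 1) f"
    using lipschitz_on_L_sphere[OF f] by (rule lipschitz_on_continuous_on)
  then have "compact (f ` sphere 0 1)" by (rule compact_continuous_image) simp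
  then obtain M where M: "\<And>z. z \<in> sphere 0 1 \<Longrightarrow> norm (f z) \<le> M"
    by (meson bounded_iff compact_imp_bounded image_eqI)
  show ?thesis by (rule that[of M]) (use M in auto)
qed

lemma seminorm_L_sphere: "seminorm_on_ou sphere_space L_sphere"
proof -
  have scale: "L_sphere (r *\<^sub>R f) \<le> \<bar>r\<bar> * L_sphere f" if "f \<in> Lip_sphere" for r and f :: "complex ^ 'a \<Rightarrow> real"
    by (intro L_sphere_le lipschitz_sphere_scaleR lipschitz_on_L_sphere that)
  have "L_sphere (r *\<^sub>R f) = \<bar>r\<bar> * L_sphere f" if f: "f \<in> Lip_sphere" for r and f :: "complex ^ 'a \<Rightarrow> real"
  proof (cases "r = 0")
    case True
    then have "L_sphere (r *\<^sub>R f) \<le> 0" using scale[OF f, of r] by simp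
    then show ?thesis using True L_sphere_nonneg[OF subspace_scale[OF Lip_sphere_subspace f], of r] by simp
  next
    case False
    have "L_sphere ((1 / r) *\<^sub>R (r *\<^sub>R f)) \<le> \<bar>1 / r\<bar> * L_sphere (r *\<^sub>R f)"
      by (intro scale subspace_scale Lip_sphere_subspace f)
    then have "\<bar>r\<bar> * L_sphere f \<le> L_sphere (r *\<^sub>R f)" using False by (simp add: field_simps)
    then show ?thesis using scale[OF f, of r] by simp
  qed
  then show ?thesis
    unfolding seminorm_on_ou_def
    by (auto simp: L_sphere_nonneg intro!: L_sphere_le lipschitz_sphere_add lipschitz_on_L_sphere)
qed

lemma order_unit_space_sphere: "order_unit_space (sphere_space :: (complex ^ 'd::finite \<Rightarrow> real) ou_space)"
proof (rule order_unit_spaceI)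
  show "subspace (ou_carrier (sphere_space :: (complex ^ 'd \<Rightarrow> real) ou_space))"
    by (simp add: Lip_sphere_subspace)
next
  fix a b :: "complex ^ 'd \<Rightarrow> real"
  assume *: "a \<in> ou_carrier sphere_space" "b \<in> ou_carrier sphere_space" "ou_le sphere_space a b" "ou_le sphere_space b a"
  show "a = b"
  proof
    fix z show "a z = b z"
      using * Lip_sphere_outside[of a z] Lip_sphere_outside[of b z]
      by (cases "z \<in> sphere 0 1") (auto intro: order_antisym)
  qed
next
  fix a :: "complex ^ 'd \<Rightarrow> real" assume a: "a \<in> ou_carrier sphere_space"
  then obtain M where M: "\<And>z. z \<in> sphere 0 1 \<Longrightarrow> \<bar>a z\<bar> \<le> M" using Lip_sphere_bounded[of a] by auto
  have "a z \<le> \<bar>M\<bar> + 1" if "z \<in> sphere 0 1" for z using M[OF that] by linarith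
  then show "\<exists>r>0. ou_le sphere_space a (r *\<^sub>R ou_unit sphere_space)"
    by (intro exI[of _ "\<bar>M\<bar> + 1"]) (simp add: scaleR_fun_def)
next
  fix a :: "complex ^ 'd \<Rightarrow> real"
  assume "\<And>r. r > 0 \<Longrightarrow> ou_le sphere_space a (r *\<^sub>R ou_unit sphere_space)"
  then have "a z \<le> r" if "r > 0" "z \<in> sphere 0 1" for r z using that by (fastforce simp: scaleR_fun_def)
  then show "ou_le sphere_space a 0" by (auto intro: field_le_epsilon)
qed (auto simp: indicator_Lip_sphere scaleR_fun_def intro: order_trans mult_left_mono, (meson order_trans)?)

lemma within_sphere: "ou_within sphere_space r f \<longleftrightarrow> (\<forall>z\<in>sphere 0 1. \<bar>f z\<bar> \<le> r)"
  by (auto simp: ou_within_def scaleR_fun_def abs_le_iff minus_le_iff)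

lemma sphere_nonempty: "\<exists>x. x \<in> sphere (0 :: complex ^ 'd::finite) 1"
  using vector_choose_size[of 1, where 'a = "complex ^ 'd"] by auto

text \<open>Arzela-Ascoli modulo constants. Subtracting the value at \<open>x0\<close> bounds the
  values of the 1-Lipschitz functions, so finitely many pieces fix them up to
  \<open>\<epsilon> / 3\<close> on a finite net; the Lipschitz bound adds
  \<open>\<epsilon> / 3\<close> for each of the two functions between net points. The scalar is
  \<open>f x0 - g x0\<close>.\<close>

lemma small_cover_sphere:
  assumes \<epsilon>: "\<epsilon> > 0"
  shows "small_cover {f \<in> ou_carrier (sphere_space :: (complex ^ 'd::finite \<Rightarrow> real) ou_space). L_sphere f \<le> 1}
    (\<lambda>f g. \<exists>c. ou_within sphere_space \<epsilon> (f - g - c *\<^sub>R ou_unit sphere_space))"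
proof -
  obtain x0 :: "complex ^ 'd" where x0: "x0 \<in> sphere 0 1" using sphere_nonempty by blast
  let ?X = "{f \<in> ou_carrier (sphere_space :: (complex ^ 'd \<Rightarrow> real) ou_space). L_sphere f \<le> 1}"
  have lip: "\<bar>f x - f y\<bar> \<le> dist x y" if "f \<in> ?X" "x \<in> sphere 0 1" "y \<in> sphere 0 1" for f x y
  proof -
    have "dist (f x) (f y) \<le> L_sphere f * dist x y"
      using that lipschitz_on_L_sphere[of f] by (auto dest: lipschitz_onD)
    also have "\<dots> \<le> 1 * dist x y" using that by (intro mult_right_mono) auto
    finally show ?thesis by (simp add: dist_real_def)
  qed
  have cover: "sphere 0 1 \<subseteq> (\<Union>x\<in>sphere 0 1. ball (x :: complex ^ 'd) (\<epsilon> / 3))"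
    using \<epsilon> by (intro subsetI UN_I) auto
  obtain X where X: "finite X" "X \<subseteq> sphere 0 1" "sphere 0 1 \<subseteq> (\<Union>x\<in>X. ball (x :: complex ^ 'd) (\<epsilon> / 3))"
    by (rule compactE_image[OF compact_sphere _ cover]) auto
  have "small_cover ?X (\<lambda>f g. \<forall>x\<in>X. \<bar>(f x - f x0) - (g x - g x0)\<bar> \<le> \<epsilon> / 3)"
  proof (rule small_cover_Ball[OF X(1)])
    fix x assume x: "x \<in> X"
    show "small_cover ?X (\<lambda>f g. \<bar>(f x - f x0) - (g x - g x0)\<bar> \<le> \<epsilon> / 3)"
    proof (rule small_cover_bounded)
      show "\<bar>f x - f x0\<bar> \<le> dist x x0" if "f \<in> ?X" for f using x X(2) x0 that by (intro lip) auto
    qed (use \<epsilon> in simp)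
  qed
  then show ?thesis
  proof (rule small_cover_mono)
    fix f g assume fg: "f \<in> ?X" "g \<in> ?X" and *: "\<forall>x\<in>X. \<bar>(f x - f x0) - (g x - g x0)\<bar> \<le> \<epsilon> / 3"
    have "\<bar>f z - g z - (f x0 - g x0)\<bar> \<le> \<epsilon>" if z: "z \<in> sphere 0 1" for z
    proof -
      obtain x where x: "x \<in> X" "z \<in> ball x (\<epsilon> / 3)" using X(3) z by blast
      have "dist z x \<le> \<epsilon> / 3" using x by (simp add: dist_commute)
      then have "\<bar>f z - f x\<bar> \<le> \<epsilon> / 3" "\<bar>g z - g x\<bar> \<le> \<epsilon> / 3"
        using lip[OF fg(1) z] lip[OF fg(2) z] x X(2) by fastforce+
      moreover have "\<bar>(f x - f x0) - (g x - g x0)\<bar> \<le> \<epsilon> / 3" using * x by blast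
      ultimately show ?thesis by linarith
    qed
    then have "ou_within sphere_space \<epsilon> (f - g - (f x0 - g x0) *\<^sub>R ou_unit sphere_space)"
      unfolding within_sphere by (simp add: scaleR_fun_def)
    then show "\<exists>c. ou_within sphere_space \<epsilon> (f - g - c *\<^sub>R ou_unit sphere_space)" by blast
  qed
qed

lemma state_space_sphere_nonempty: "state_space (sphere_space :: (complex ^ 'd::finite \<Rightarrow> real) ou_space) \<noteq> {}"
proof -
  interpret B: ou "sphere_space :: (complex ^ 'd \<Rightarrow> real) ou_space" by standard (rule order_unit_space_sphere)
  obtain x0 :: "complex ^ 'd" where x0: "x0 \<in> sphere 0 1" using sphere_nonempty by blast
  have "restrict (\<lambda>f. f x0) Lip_sphere \<in> state_space (sphere_space :: (complex ^ 'd \<Rightarrow> real) ou_space)"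
    unfolding B.state_space_iff within_sphere
    using x0 B.carrier_intros by (auto simp: scaleR_fun_def indicator_Lip_sphere)
  then show ?thesis by blast
qed

section \<open>The Lip-norm on the compact operators\<close>

text \<open>The exponent \<open>5 / 4\<close> lies between 1, needed for summability, and
  \<open>3 / 2\<close>, half of the smallest power \<open>n + 2 = 3\<close>; the gap
  \<open>1 / 4\<close> is the reserve.\<close>

definition decay :: "nat \<Rightarrow> real" where
  "decay i = real i powr (- (5 / 4))"

lemma summable_decay: "summable decay"
  unfolding decay_def[abs_def] by (simp add: summable_real_powr_iff)

lemma decay_nonneg: "0 \<le> decay i"
  by (simp add: decay_def)

definition decay_sum :: real where
  "decay_sum = (\<Sum>i. decay i)"

lemma sum_decay_le: "(\<Sum>i\<in>{1..N}. decay i) \<le> decay_sum"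
  unfolding decay_sum_def by (intro sum_le_suminf summable_decay) (auto simp: decay_nonneg)

lemma decay_sum_nonneg: "0 \<le> decay_sum"
  using sum_decay_le[of 0] by simp

lemma decay_sum_square: "(\<Sum>i\<in>{1..N}. \<Sum>j\<in>{1..N}. c * (decay i * decay j)) \<le> c * decay_sum\<^sup>2" if "0 \<le> c"
proof -
  have "(\<Sum>i\<in>{1..N}. \<Sum>j\<in>{1..N}. c * (decay i * decay j)) = c * ((\<Sum>i\<in>{1..N}. decay i) * (\<Sum>j\<in>{1..N}. decay j))"
    unfolding sum_product by (simp only: sum_distrib_left)
  also have "\<dots> \<le> c * (decay_sum * decay_sum)"
    using that by (intro mult_left_mono mult_mono sum_decay_le decay_sum_nonneg sum_nonneg decay_nonneg)
  finally show ?thesis by (simp add: power2_eq_square)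
qed

text \<open>By AM-GM, \<open>i + j \<ge> 2 (i j)\<^bsup>1/2\<^esup>\<close>; one quarter power of \<open>i j\<close> is kept in reserve for the compactness argument.\<close>

lemma inverse_power_le_decay:
  assumes ij: "i \<ge> 1" "j \<ge> 1" and n: "n \<ge> 1"
  shows "1 / real (i + j) ^ (n + 2) \<le> (1 / 2) ^ (n + 2) * (real (i * j) powr (- (1 / 4)) * (decay i * decay j))"
proof -
  define x where "x = real (i * j)"
  have x: "x \<ge> 1" unfolding x_def using ij by (metis mult_le_mono nat_mult_1 of_nat_1 of_nat_le_iff)
  have "2 * sqrt x \<le> real (i + j)"
    using arith_geo_mean_sqrt[of "real i" "real j"] by (simp add: x_def)
  then have "(2 * sqrt x) ^ (n + 2) \<le> real (i + j) ^ (n + 2)"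
    using x by (intro power_mono) auto
  then have "1 / real (i + j) ^ (n + 2) \<le> 1 / (2 * sqrt x) ^ (n + 2)"
    using x ij by (intro divide_left_mono mult_pos_pos zero_less_power) auto
  also have "\<dots> = (1 / 2) ^ (n + 2) * (1 / sqrt x ^ (n + 2))"
    by (simp only: power_mult_distrib power_divide power_one times_divide_times_eq mult_1)
  \<comment> \<open>Only the prefactor has to improve with \<open>n\<close>: since
    \<open>sqrt x \<ge> 1\<close>, the remaining power is lowered to 3, its value for
    \<open>n = 1\<close>.\<close>
  also have "1 / sqrt x ^ (n + 2) \<le> 1 / sqrt x ^ 3"
    using x n by (intro divide_left_mono power_increasing mult_pos_pos zero_less_power) auto
  also have "1 / sqrt x ^ 3 = x powr (- (3 / 2))"
  proof -
    have "sqrt x ^ 3 = (x powr (1 / 2)) powr (real 3)"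
      using x by (subst powr_realpow) (simp_all add: powr_half_sqrt)
    also have "\<dots> = x powr (3 / 2)" unfolding powr_powr by simp
    finally show ?thesis by (simp add: powr_minus_divide)
  qed
  also have "x powr (- (3 / 2)) = x powr (- (1 / 4)) * x powr (- (5 / 4))"
    by (simp add: powr_add[symmetric])
  also have "x powr (- (5 / 4)) = decay i * decay j"
    by (simp add: x_def decay_def powr_mult)
  finally show ?thesis by (simp add: x_def mult_left_mono)
qed

lemma inverse_power_le_decay':
  assumes ij: "i \<ge> 1" "j \<ge> 1" and n: "n \<ge> 1"
  shows "1 / real (i + j) ^ (n + 2) \<le> (1 / 2) ^ (n + 2) * (decay i * decay j)"
proof -
  have "real (i * j) \<ge> 1" using ij by (metis mult_le_mono nat_mult_1 of_nat_1 of_nat_le_iff)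
  then have "real (i * j) powr (- (1 / 4)) \<le> 1" using powr_mono[of "- (1 / 4)" 0 "real (i * j)"] ij by auto
  then have "real (i * j) powr (- (1 / 4)) * (decay i * decay j) \<le> decay i * decay j"
    using mult_right_mono[of _ 1 "decay i * decay j"] by (simp add: decay_nonneg)
  from order_trans[OF inverse_power_le_decay[OF assms] mult_left_mono[OF this]] show ?thesis by simp
qed

lemma is_adjoint_self_Im:
  assumes "is_adjoint n T T" "f \<in> bergman n"
  shows "Im (ip n (T f) f) = 0"
proof -
  have "ip n (T f) f = cnj (ip n (T f) f)"
    using assms by (subst ip_cnj[symmetric]) (simp add: is_adjoint_def)
  then have "Im (ip n (T f) f) = Im (cnj (ip n (T f) f))" by (rule arg_cong)
  then show ?thesis by simp
qed

context bergman_basis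
begin

abbreviation "LipK \<equiv> Lip_compact n e"

abbreviation entry :: "'d hop \<Rightarrow> nat \<Rightarrow> nat \<Rightarrow> real" where
  "entry T i j \<equiv> real (i + j) ^ (n + 2) * cmod (ip n (T (e i)) (e j))"

lemma n_pos: "n \<ge> 1"
  using n zero_less_card_finite[where 'a = 'd] by linarith

lemma LipK_D:
  assumes "K \<in> LipK"
  shows "K \<in> compact_ops n" "K \<in> bounded_ops n" "is_adjoint n K K"
    "i \<ge> 1 \<Longrightarrow> j \<ge> 1 \<Longrightarrow> Im (ip n (K (e i)) (e j)) = 0"
    "bdd_above ((\<lambda>(i, j). entry K i j) ` ({1..} \<times> {1..}))"
  using assms unfolding Lip_compact_def by (auto simp: complex_is_Real_iff compact_ops_bounded)

lemma LipK_I: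
  assumes "K \<in> compact_ops n" "is_adjoint n K K"
    "\<And>i j. i \<ge> 1 \<Longrightarrow> j \<ge> 1 \<Longrightarrow> Im (ip n (K (e i)) (e j)) = 0"
    "\<And>i j. i \<ge> 1 \<Longrightarrow> j \<ge> 1 \<Longrightarrow> entry K i j \<le> M"
  shows "K \<in> LipK"
  unfolding Lip_compact_def
  using assms by (auto simp: complex_is_Real_iff intro!: bdd_aboveI[of _ M])

lemma L_compact_def': "L_compact n e K = (SUP x\<in>{1..} \<times> {1..}. (\<lambda>(i, j). entry K i j) x)"
  unfolding L_compact_def by (simp add: case_prod_unfold)

lemma entry_le: "K \<in> LipK \<Longrightarrow> i \<ge> 1 \<Longrightarrow> j \<ge> 1 \<Longrightarrow> entry K i j \<le> L_compact n e K"
  unfolding L_compact_def'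
  using cSUP_upper[of "(i, j)" "{1..} \<times> {1..}" "\<lambda>(i, j). entry K i j"] LipK_D(5)[of K] by auto

lemma L_compact_le: "(\<And>i j. i \<ge> 1 \<Longrightarrow> j \<ge> 1 \<Longrightarrow> entry K i j \<le> M) \<Longrightarrow> L_compact n e K \<le> M"
  unfolding L_compact_def' by (rule cSUP_least) auto

lemma L_compact_nonneg: "K \<in> LipK \<Longrightarrow> 0 \<le> L_compact n e K"
  by (rule order_trans[OF _ entry_le[of K 1 1]]) auto

lemma LipK_add:
  assumes K: "K \<in> LipK" and K': "K' \<in> LipK"
  shows "K + K' \<in> LipK" and L_compact_add: "L_compact n e (K + K') \<le> L_compact n e K + L_compact n e K'"
proof -
  note b = LipK_D(2)[OF K] LipK_D(2)[OF K']
  have ij: "ip n ((K + K') (e i)) (e j) = ip n (K (e i)) (e j) + ip n (K' (e i)) (e j)"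
    if "i \<ge> 1" "j \<ge> 1" for i j
    using that by (intro ip_add_op b e_bergman bergman_L2)
  have le: "entry (K + K') i j \<le> L_compact n e K + L_compact n e K'" if that: "i \<ge> 1" "j \<ge> 1" for i j
  proof -
    have "entry (K + K') i j \<le> real (i + j) ^ (n + 2) * (cmod (ip n (K (e i)) (e j)) + cmod (ip n (K' (e i)) (e j)))"
      unfolding ij[OF that] by (intro mult_left_mono norm_triangle_ineq) simp
    also have "\<dots> = entry K i j + entry K' i j" by (simp add: distrib_left)
    finally show ?thesis using entry_le[OF K that] entry_le[OF K' that] by linarith
  qed
  show "K + K' \<in> LipK"
  proof (rule LipK_I)
    show "K + K' \<in> compact_ops n" by (intro compact_ops_add LipK_D(1) K K')
    have "ip n ((K + K') f) g = ip n f ((K + K') g)" if f: "f \<in> bergman n" and g: "g \<in> bergman n" for f g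
    proof -
      have "ip n ((K + K') f) g = ip n (K f) g + ip n (K' f) g"
        by (rule ip_add_op[OF b f bergman_L2[OF g]])
      also have "\<dots> = ip n f (K g) + ip n f (K' g)"
        using LipK_D(3)[OF K] LipK_D(3)[OF K'] f g by (simp add: is_adjoint_def)
      also have "\<dots> = ip n f (K g + K' g)"
        by (rule ip_add_right[symmetric]) (intro bounded_ops_L2[OF b(1) g] bounded_ops_L2[OF b(2) g] bergman_L2[OF f])+
      finally show ?thesis by simp
    qed
    then show "is_adjoint n (K + K') (K + K')"
      using bounded_ops_add[OF b] by (simp add: is_adjoint_def)
    show "Im (ip n ((K + K') (e i)) (e j)) = 0" if "i \<ge> 1" "j \<ge> 1" for i j
      using LipK_D(4)[OF K that] LipK_D(4)[OF K' that] by (simp only: ij[OF that] plus_complex.simps add_0_right)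
  qed (rule le)
  show "L_compact n e (K + K') \<le> L_compact n e K + L_compact n e K'"
    by (rule L_compact_le) (rule le)
qed

lemma LipK_scaleR:
  assumes K: "K \<in> LipK"
  shows "r *\<^sub>R K \<in> LipK" and L_compact_scaleR_le: "L_compact n e (r *\<^sub>R K) \<le> \<bar>r\<bar> * L_compact n e K"
proof -
  note b = LipK_D(2)[OF K]
  have le: "entry (r *\<^sub>R K) i j \<le> \<bar>r\<bar> * L_compact n e K" if that: "i \<ge> 1" "j \<ge> 1" for i j
  proof -
    have eq: "entry (r *\<^sub>R K) i j = \<bar>r\<bar> * entry K i j"
      unfolding ip_scaleR_op norm_mult norm_of_real by (rule mult.left_commute)
    show ?thesis unfolding eq by (intro mult_left_mono entry_le K that) simp
  qed
  show "r *\<^sub>R K \<in> LipK"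
  proof (rule LipK_I)
    show "r *\<^sub>R K \<in> compact_ops n" by (rule subspace_scale[OF compact_ops_subspace LipK_D(1)[OF K]])
    have "ip n ((r *\<^sub>R K) f) g = ip n f ((r *\<^sub>R K) g)" if f: "f \<in> bergman n" and g: "g \<in> bergman n" for f g
      using LipK_D(3)[OF K] f g unfolding ip_scaleR_op
      by (simp add: is_adjoint_def scaleR_op_conv ip_scale_right)
    then show "is_adjoint n (r *\<^sub>R K) (r *\<^sub>R K)"
      using bounded_ops_scaleR[OF b] by (simp add: is_adjoint_def)
    show "Im (ip n ((r *\<^sub>R K) (e i)) (e j)) = 0" if "i \<ge> 1" "j \<ge> 1" for i j
      using LipK_D(4)[OF K that] by (simp add: ip_scaleR_op)
  qed (rule le)
  show "L_compact n e (r *\<^sub>R K) \<le> \<bar>r\<bar> * L_compact n e K"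
    by (rule L_compact_le) (rule le)
qed

lemma LipK_zero: "0 \<in> LipK" and L_compact_zero: "L_compact n e 0 = 0"
proof -
  have e0: "entry 0 i j = 0" for i j by (simp add: ip_def)
  show z: "0 \<in> LipK"
  proof (rule LipK_I[where M = 0])
    show "is_adjoint n 0 0" by (simp add: is_adjoint_def bounded_ops_zero ip_def)
  qed (simp_all add: compact_ops_zero ip_def)
  show "L_compact n e 0 = 0"
    using L_compact_le[of 0 0] L_compact_nonneg[OF z] e0 by (auto intro: order_antisym)
qed

lemma LipK_subspace: "subspace LipK"
  by (intro subspaceI LipK_zero LipK_add LipK_scaleR)

lemma L_compact_scaleR:
  assumes K: "K \<in> LipK"
  shows "L_compact n e (r *\<^sub>R K) = \<bar>r\<bar> * L_compact n e K"
proof (cases "r = 0")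
  case True
  then show ?thesis by (simp add: L_compact_zero)
next
  case False
  have "L_compact n e ((1 / r) *\<^sub>R (r *\<^sub>R K)) \<le> \<bar>1 / r\<bar> * L_compact n e (r *\<^sub>R K)"
    by (intro L_compact_scaleR_le LipK_scaleR K)
  then have "\<bar>r\<bar> * L_compact n e K \<le> L_compact n e (r *\<^sub>R K)" using False by (simp add: field_simps)
  then show ?thesis using L_compact_scaleR_le[OF K, of r] by simp
qed

lemma matrix_entry_le:
  assumes K: "K \<in> LipK" and L: "L_compact n e K \<le> 1" and ij: "i \<ge> 1" "j \<ge> 1"
  shows "cmod (ip n (K (e i)) (e j)) \<le> 1 / real (i + j) ^ (n + 2)"
proof -
  have "real (i + j) ^ (n + 2) * cmod (ip n (K (e i)) (e j)) \<le> 1"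
    using entry_le[OF K ij] L by linarith
  moreover have "real (i + j) ^ (n + 2) > 0" using ij by simp
  ultimately show ?thesis by (simp add: pos_le_divide_eq mult.commute)
qed

text \<open>As \<open>decay_sum\<close> is a fixed number, the factor
  \<open>(1 / 2) ^ (n + 2)\<close> alone depends on \<open>n\<close>; this is the source of the
  convergence.\<close>

lemma LipK_quadratic_form:
  assumes K: "K \<in> LipK" and L: "L_compact n e K \<le> 1" and f: "f \<in> bergman n"
  shows "cmod (ip n (K f) f) \<le> (1 / 2) ^ (n + 2) * decay_sum\<^sup>2 * (hnorm n f)\<^sup>2"
proof (rule quadratic_form_le_matrix[OF LipK_D(2)[OF K] _ _ f])
  show "cmod (ip n (K (e i)) (e j)) \<le> (1 / 2) ^ (n + 2) * (decay i * decay j)" if "i \<ge> 1" "j \<ge> 1" for i j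
    using matrix_entry_le[OF K L that] inverse_power_le_decay'[OF that n_pos] by (rule order_trans)
  show "(\<Sum>i\<in>{1..N}. \<Sum>j\<in>{1..N}. (1 / 2) ^ (n + 2) * (decay i * decay j)) \<le> (1 / 2) ^ (n + 2) * decay_sum\<^sup>2" for N
    by (rule decay_sum_square) simp
qed

text \<open>The entries with both indices at most \<open>N\<close> are finitely many bounded
  parameters and admit a finite cover. Every other entry has \<open>i * j \<ge> N\<close>, so its
  reserved factor is below \<open>\<eta>\<close>. All entries of a difference are then at most
  \<open>\<eta>\<close> times the summable weights, and \<open>\<eta>\<close> is chosen so that the
  total is at most \<open>\<epsilon>\<close>.\<close>

lemma small_cover_LipK:
  assumes \<epsilon>: "\<epsilon> > 0"
  shows "small_cover {K \<in> LipK. L_compact n e K \<le> 1}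
    (\<lambda>K K'. \<forall>f\<in>bergman n. cmod (ip n ((K - K') f) f) \<le> \<epsilon> * (hnorm n f)\<^sup>2)"
proof -
  define \<eta> where "\<eta> = \<epsilon> / (decay_sum\<^sup>2 + 1)"
  have pos: "decay_sum\<^sup>2 + 1 > 0" by (intro add_nonneg_pos) auto
  then have \<eta>: "\<eta> > 0" using \<epsilon> by (simp add: \<eta>_def)
  have "\<eta> * decay_sum\<^sup>2 \<le> \<eta> * (decay_sum\<^sup>2 + 1)" using \<eta> by (intro mult_left_mono) auto
  also have "\<dots> = \<epsilon>" using less_imp_neq[OF pos] by (simp add: \<eta>_def)
  finally have \<eta>\<epsilon>: "\<eta> * decay_sum\<^sup>2 \<le> \<epsilon>" .
  have "(\<lambda>N. real N powr (- (1 / 4))) \<longlonglongrightarrow> 0"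
    by (rule tendsto_neg_powr) (auto simp: filterlim_real_sequentially)
  then have "\<forall>\<^sub>F N in sequentially. real N powr (- (1 / 4)) < \<eta> \<and> N \<ge> 1"
    using \<eta> by (intro eventually_conj order_tendstoD(2) eventually_ge_at_top) auto
  then obtain N where N: "real N powr (- (1 / 4)) < \<eta>" "N \<ge> 1"
    by (auto simp: eventually_sequentially)
  \<comment> \<open>As \<open>decay\<close> decreases, \<open>decay N\<close> is its least value on
    the block, so closeness up to \<open>\<delta>\<close> implies the weighted bound for every entry
    in it.\<close>
  define \<delta> where "\<delta> = \<eta> * (decay N * decay N)"
  have \<delta>: "\<delta> > 0" using \<eta> N(2) by (simp add: \<delta>_def decay_def)
  let ?X = "{K \<in> LipK. L_compact n e K \<le> 1}"
  let ?I = "{1..N} \<times> {1..N}"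
  \<comment> \<open>The entries of elements of \<open>LipK\<close> are real, so real parts determine
    the moduli of differences.\<close>
  have "small_cover ?X (\<lambda>K K'. \<forall>x\<in>?I. \<bar>Re (ip n (K (e (fst x))) (e (snd x))) - Re (ip n (K' (e (fst x))) (e (snd x)))\<bar> \<le> \<delta>)"
  proof (rule small_cover_Ball)
    fix x assume x: "x \<in> ?I"
    show "small_cover ?X (\<lambda>K K'. \<bar>Re (ip n (K (e (fst x))) (e (snd x))) - Re (ip n (K' (e (fst x))) (e (snd x)))\<bar> \<le> \<delta>)"
    proof (rule small_cover_bounded[OF \<delta>])
      show "\<bar>Re (ip n (K (e (fst x))) (e (snd x)))\<bar> \<le> 1 / real (fst x + snd x) ^ (n + 2)" if "K \<in> ?X" for K
        using that x by (intro order_trans[OF abs_Re_le_cmod matrix_entry_le]) auto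
    qed
  qed simp
  then show ?thesis
  proof (rule small_cover_mono, intro ballI)
    fix K K' :: "'d hop" and f :: "'d hfun" assume KX: "K \<in> ?X" "K' \<in> ?X" and f: "f \<in> bergman n"
      and cl: "\<forall>x\<in>?I. \<bar>Re (ip n (K (e (fst x))) (e (snd x))) - Re (ip n (K' (e (fst x))) (e (snd x)))\<bar> \<le> \<delta>"
    then have K: "K \<in> LipK" "L_compact n e K \<le> 1" and K': "K' \<in> LipK" "L_compact n e K' \<le> 1" by auto
    have D: "K - K' \<in> LipK" by (rule subspace_diff[OF LipK_subspace K(1) K'(1)])
    have entries: "cmod (ip n ((K - K') (e i)) (e j)) \<le> \<eta> * (decay i * decay j)" if ij: "i \<ge> 1" "j \<ge> 1" for i j
    proof -
      have eq: "ip n ((K - K') (e i)) (e j) = ip n (K (e i)) (e j) - ip n (K' (e i)) (e j)"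
        using ij by (simp add: ip_diff_left bounded_ops_L2[OF LipK_D(2)[OF K(1)]]
            bounded_ops_L2[OF LipK_D(2)[OF K'(1)]] e_bergman bergman_L2)
      show ?thesis
      proof (cases "i \<le> N \<and> j \<le> N")
        case True
        have "cmod (ip n ((K - K') (e i)) (e j)) = \<bar>Re (ip n (K (e i)) (e j)) - Re (ip n (K' (e i)) (e j))\<bar>"
          unfolding eq cmod_def using LipK_D(4)[OF K(1) ij] LipK_D(4)[OF K'(1) ij] by simp
        also have "\<dots> \<le> \<delta>" using cl True ij by force
        also have "\<dots> \<le> \<eta> * (decay i * decay j)"
        proof -
          have "decay N \<le> decay i" "decay N \<le> decay j"
            using True ij by (auto simp: decay_def intro!: powr_mono2')
          then show ?thesis unfolding \<delta>_def using \<eta>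
            by (intro mult_left_mono mult_mono) (auto simp: decay_nonneg)
        qed
        finally show ?thesis .
      next
        case False
        have "i \<le> i * j" "j \<le> i * j" using ij by simp_all
        then have "N \<le> i * j" using False by linarith
        then have "real N \<le> real (i * j)" by (simp only: of_nat_le_iff)
        moreover have "real N > 0" using N(2) by simp
        ultimately have "real (i * j) powr (- (1 / 4)) \<le> real N powr (- (1 / 4))"
          by (intro powr_mono2') simp_all
        then have small: "real (i * j) powr (- (1 / 4)) \<le> \<eta>" using N(1) by linarith
        \<comment> \<open>The prefactor, at most one half, pays for estimating \<open>K\<close> and
          \<open>K'\<close> separately.\<close>
        have "(1 / 2 :: real) ^ (n + 2) \<le> (1 / 2) ^ 1" by (rule power_decreasing) auto
        then have half: "(1 / 2 :: real) ^ (n + 2) \<le> 1 / 2" by simp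
        have "1 / real (i + j) ^ (n + 2) \<le> 1 / 2 * (\<eta> * (decay i * decay j))"
          by (rule order_trans[OF inverse_power_le_decay[OF ij n_pos]])
            (intro mult_mono half small order_refl mult_nonneg_nonneg decay_nonneg; use \<eta> in simp)
        then have "cmod (ip n (K (e i)) (e j)) \<le> 1 / 2 * (\<eta> * (decay i * decay j))"
          "cmod (ip n (K' (e i)) (e j)) \<le> 1 / 2 * (\<eta> * (decay i * decay j))"
          using matrix_entry_le[OF K ij] matrix_entry_le[OF K' ij] by linarith+
        then show ?thesis unfolding eq
          using norm_triangle_ineq4[of "ip n (K (e i)) (e j)" "ip n (K' (e i)) (e j)"] by linarith
      qed
    qed
    have "cmod (ip n ((K - K') f) f) \<le> \<eta> * decay_sum\<^sup>2 * (hnorm n f)\<^sup>2"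
      by (rule quadratic_form_le_matrix[OF LipK_D(2)[OF D] entries decay_sum_square f]) (use \<eta> in auto)
    also have "\<dots> \<le> \<epsilon> * (hnorm n f)\<^sup>2" using \<eta>\<epsilon> by (intro mult_right_mono) auto
    finally show "cmod (ip n ((K - K') f) f) \<le> \<epsilon> * (hnorm n f)\<^sup>2" .
  qed
qed

end

section \<open>The Toeplitz spaces\<close>

lemma field_le_scaled_epsilon:
  fixes x a :: real
  assumes a: "0 \<le> a" and le: "\<And>r. r > 0 \<Longrightarrow> x \<le> r * a"
  shows "x \<le> 0"
proof (rule field_le_epsilon)
  fix \<epsilon> :: real assume \<epsilon>: "\<epsilon> > 0"
  have "x \<le> \<epsilon> / (a + 1) * a" using \<epsilon> a by (intro le) simp
  also have "\<dots> \<le> \<epsilon>" using \<epsilon> a by (simp add: field_simps)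
  finally show "x \<le> 0 + \<epsilon>" by simp
qed

lemma positive_op_id_diff:
  fixes K :: "'d::finite hop"
  assumes K: "K \<in> bounded_ops n" and Im: "\<And>f. f \<in> bergman n \<Longrightarrow> Im (ip n (K f) f) = 0"
    and le: "\<And>f. f \<in> bergman n \<Longrightarrow> Re (ip n (K f) f) \<le> r * (hnorm n f)\<^sup>2"
  shows "positive_op n (r *\<^sub>R op_id n - K)"
proof (rule positive_opI)
  have rb: "r *\<^sub>R (op_id n :: 'd hop) \<in> bounded_ops n" by (intro bounded_ops_scaleR bounded_ops_op_id)
  then show "r *\<^sub>R op_id n - K \<in> bounded_ops n" by (intro bounded_ops_minus K)
  have eq: "ip n ((r *\<^sub>R op_id n - K) f) f = of_real (r * (hnorm n f)\<^sup>2) - ip n (K f) f" if f: "f \<in> bergman n" for f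
  proof -
    have "(r *\<^sub>R op_id n - K) f = (r *\<^sub>R op_id n) f - K f" by simp
    then have "ip n ((r *\<^sub>R op_id n - K) f) f = ip n ((r *\<^sub>R op_id n) f) f - ip n (K f) f"
      by (simp only: ip_diff_left[OF bounded_ops_L2[OF rb f] bounded_ops_L2[OF K f] bergman_L2[OF f]])
    then show ?thesis by (simp only: ip_scaleR_op ip_op_id[OF f] of_real_mult)
  qed
  show "Im (ip n ((r *\<^sub>R op_id n - K) f) f) = 0" if f: "f \<in> bergman n" for f
    unfolding eq[OF f] by (simp only: minus_complex.simps Im_complex_of_real Im[OF f] diff_self)
  show "0 \<le> Re (ip n ((r *\<^sub>R op_id n - K) f) f)" if f: "f \<in> bergman n" for f
    unfolding eq[OF f] using le[OF f] by (simp only: minus_complex.simps Re_complex_of_real diff_ge_0_iff_ge)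
qed

lemma has_symbol_add_compact:
  assumes "has_symbol n T F" "K \<in> compact_ops n"
  shows "has_symbol n (T + K) F"
proof -
  obtain \<phi> K' where "F \<in> C_sphere" "continuous_on (cball 0 1) \<phi>" "K' \<in> compact_ops n"
    "T = toeplitz n \<phi> + K'" "\<forall>z\<in>sphere 0 1. \<phi> z = F z"
    using assms(1) unfolding has_symbol_def by blast
  then show ?thesis unfolding has_symbol_def using compact_ops_add[of K' n K] assms(2)
    by (intro conjI exI[of _ \<phi>] exI[of _ "K' + K"]) (simp_all add: add.assoc)
qed

lemma of_real_Lip_sphere: "f \<in> Lip_sphere \<Longrightarrow> complex_of_real \<circ> f \<in> C_sphere"
  using lipschitz_on_continuous_on[OF lipschitz_on_L_sphere, of f]
  by (auto simp: C_sphere_def o_def Lip_sphere_outside intro!: continuous_on_of_real)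

text \<open>Unitality puts the order unit \<open>op_id n\<close> into the carrier with seminorm 0.
  The definition of a Lip-norm forces it: a compact part of the unit would need all its matrix
  entries to vanish.\<close>

locale toeplitz_setup = bergman_basis n e \<kappa>
  for n :: nat and e :: "nat \<Rightarrow> 'd::finite hfun" and \<kappa> +
  fixes \<sigma> :: "'d hfun \<Rightarrow> 'd hop"
  assumes splitting: "positive_splitting n \<sigma>"
    and unital: "\<sigma> (indicator (sphere 0 1)) = op_id n"
begin

definition S :: "(complex ^ 'd \<Rightarrow> real) \<Rightarrow> 'd hop" where
  "S f = \<sigma> (complex_of_real \<circ> f)"

abbreviation "one \<equiv> indicator (sphere 0 1) :: complex ^ 'd \<Rightarrow> real"

lemma of_real_one: "complex_of_real \<circ> one = indicator (sphere 0 1)"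
  by (auto simp: fun_eq_iff indicator_def)

lemma S_unit: "S one = op_id n"
  by (simp only: S_def of_real_one unital)

lemma S_add: "f \<in> Lip_sphere \<Longrightarrow> g \<in> Lip_sphere \<Longrightarrow> S (f + g) = S f + S g"
proof -
  assume fg: "f \<in> Lip_sphere" "g \<in> Lip_sphere"
  have "complex_of_real \<circ> (f + g) = (complex_of_real \<circ> f) + (complex_of_real \<circ> g)"
    by (simp add: fun_eq_iff)
  then show ?thesis
    using splitting of_real_Lip_sphere[OF fg(1)] of_real_Lip_sphere[OF fg(2)]
    unfolding S_def positive_splitting_def by metis
qed

lemma S_scaleR: "f \<in> Lip_sphere \<Longrightarrow> S (r *\<^sub>R f) = r *\<^sub>R S f"
proof -
  assume f: "f \<in> Lip_sphere"
  have "complex_of_real \<circ> (r *\<^sub>R f) = (\<lambda>z. of_real r * (complex_of_real \<circ> f) z)"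
    by (simp add: fun_eq_iff scaleR_fun_def)
  then show ?thesis
    using splitting of_real_Lip_sphere[OF f]
    unfolding S_def positive_splitting_def scaleR_op_conv by metis
qed

lemmas Lip_intros = subspace_add[OF Lip_sphere_subspace] subspace_diff[OF Lip_sphere_subspace]
  subspace_scale[OF Lip_sphere_subspace] subspace_0[OF Lip_sphere_subspace] indicator_Lip_sphere

lemma S_diff: "f \<in> Lip_sphere \<Longrightarrow> g \<in> Lip_sphere \<Longrightarrow> S (f - g) = S f - S g"
  using S_add[of f "(-1) *\<^sub>R g"] S_scaleR[of g "-1"] by (simp add: Lip_intros subspace_neg[OF Lip_sphere_subspace])

lemma S_zero: "S 0 = 0"
  using S_scaleR[of 0 0] by (simp add: Lip_intros)

lemma S_positive:
  assumes f: "f \<in> Lip_sphere" and nn: "\<And>z. z \<in> sphere 0 1 \<Longrightarrow> 0 \<le> f z"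
  shows "positive_op n (S f)"
proof -
  have "0 \<le> f z" for z using nn[of z] Lip_sphere_outside[OF f, of z] by (cases "z \<in> sphere 0 1") auto
  then show ?thesis
    using splitting of_real_Lip_sphere[OF f] unfolding S_def positive_splitting_def by auto
qed

lemma S_symbol: "f \<in> Lip_sphere \<Longrightarrow> has_symbol n (S f) (complex_of_real \<circ> f)"
  using splitting of_real_Lip_sphere[of f] unfolding S_def positive_splitting_def by blast

lemma S_positive_diff:
  assumes f: "f \<in> Lip_sphere" and le: "\<And>z. z \<in> sphere 0 1 \<Longrightarrow> f z \<le> r"
  shows "positive_op n (r *\<^sub>R op_id n - S f)"
proof -
  have "r *\<^sub>R op_id n - S f = S (r *\<^sub>R one - f)"
    using f by (simp add: S_diff S_scaleR S_unit Lip_intros)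
  moreover have "positive_op n (S (r *\<^sub>R one - f))"
    using f le by (intro S_positive Lip_intros) (auto simp: scaleR_fun_def)
  ultimately show ?thesis by simp
qed

text \<open>Because \<open>S one = op_id n\<close>, adding the identity to the operator adds 1 to
  the function; this supplies the shifted symbol required by
  \<open>positive_op_symbol_nonneg\<close>.\<close>

lemma decomposition_nonneg:
  assumes f: "f \<in> Lip_sphere" and K: "K \<in> compact_ops n" and pos: "positive_op n (S f + K)"
    and z: "z \<in> sphere 0 1"
  shows "0 \<le> f z"
proof -
  have 1: "has_symbol n (S f + K) (complex_of_real \<circ> f)"
    by (intro has_symbol_add_compact S_symbol f K)
  have "has_symbol n (S (f + one) + K) (complex_of_real \<circ> (f + one))"
    by (intro has_symbol_add_compact S_symbol Lip_intros f K)
  moreover have "S (f + one) + K = S f + K + op_id n"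
    using f by (simp add: S_add Lip_intros S_unit add_ac)
  moreover have "complex_of_real \<circ> (f + one) = (complex_of_real \<circ> f) + indicator (sphere 0 1)"
    by (simp add: fun_eq_iff indicator_def)
  ultimately have 2: "has_symbol n (S f + K + op_id n) ((complex_of_real \<circ> f) + indicator (sphere 0 1))" by simp
  from positive_op_symbol_nonneg[OF n pos 1 2 z] show ?thesis by simp
qed

text \<open>The difference of two decompositions writes the positive operator \<open>0\<close> as
  \<open>S (v - u) + (Q - P)\<close>, whence \<open>u \<le> v\<close> on the sphere; exchanging the
  roles gives equality.\<close>

lemma decomposition_unique:
  assumes f: "f \<in> Lip_sphere" and g: "g \<in> Lip_sphere" and K: "K \<in> LipK" and K': "K' \<in> LipK"
    and eq: "S f + K = S g + K'"
  shows "f = g" "K = K'"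
proof -
  have le: "u z \<le> v z"
    if u: "u \<in> Lip_sphere" "v \<in> Lip_sphere" "P \<in> LipK" "Q \<in> LipK" "S u + P = S v + Q" "z \<in> sphere 0 1" for u v P Q z
  proof -
    have "S (v - u) + (Q - P) = 0" using u by (simp add: S_diff algebra_simps)
    then have "positive_op n (S (v - u) + (Q - P))" using positive_op_zero by metis
    then have "0 \<le> (v - u) z"
      using u by (intro decomposition_nonneg[of "v - u" "Q - P"] Lip_intros
          subspace_diff[OF compact_ops_subspace] LipK_D(1))
    then show ?thesis by simp
  qed
  show fg: "f = g"
  proof
    fix z show "f z = g z"
      using le[OF f g K K' eq, of z] le[OF g f K' K eq[symmetric], of z]
        Lip_sphere_outside[OF f, of z] Lip_sphere_outside[OF g, of z]
      by (cases "z \<in> sphere 0 1") auto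
  qed
  show "K = K'" using eq fg by simp
qed

abbreviation "TS \<equiv> toeplitz_space n e \<sigma>"
abbreviation "LTS \<equiv> L_toeplitz n e \<sigma>"

text \<open>The symbol is read off the decomposition, not from \<open>has_symbol\<close>, so that
  \<open>decomposition_unique\<close> alone makes it well defined.\<close>

definition symb :: "'d hop \<Rightarrow> complex ^ 'd \<Rightarrow> real" where
  "symb T = (THE f. f \<in> Lip_sphere \<and> (\<exists>K\<in>LipK. T = S f + K))"

lemma TS_simps [simp]:
  "ou_le TS T T' \<longleftrightarrow> positive_op n (T' - T)" "ou_unit TS = op_id n"
  by (simp_all add: toeplitz_space_def)

lemma TS_carrier: "ou_carrier TS = {S f + K | f K. f \<in> Lip_sphere \<and> K \<in> LipK}"
  by (simp add: toeplitz_space_def Lip_toeplitz_def S_def)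

lemma TS_I: "f \<in> Lip_sphere \<Longrightarrow> K \<in> LipK \<Longrightarrow> S f + K \<in> ou_carrier TS"
  unfolding TS_carrier by blast

lemma symb_eq:
  assumes f: "f \<in> Lip_sphere" and K: "K \<in> LipK"
  shows "symb (S f + K) = f"
  unfolding symb_def
proof (rule the_equality)
  show "f \<in> Lip_sphere \<and> (\<exists>K'\<in>LipK. S f + K = S f + K')" using f K by blast
  fix g assume "g \<in> Lip_sphere \<and> (\<exists>K'\<in>LipK. S f + K = S g + K')"
  then show "g = f" using decomposition_unique(1)[OF f _ K] by metis
qed

lemma LT_eq:
  assumes f: "f \<in> Lip_sphere" and K: "K \<in> LipK"
  shows "LTS (S f + K) = L_compact n e K + L_sphere f"
  unfolding L_toeplitz_def
proof (rule the_equality)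
  show "\<exists>g K'. g \<in> Lip_sphere \<and> K' \<in> LipK \<and> S f + K = \<sigma> (complex_of_real \<circ> g) + K' \<and>
      L_compact n e K + L_sphere f = L_compact n e K' + L_sphere g"
    using f K by (intro exI[of _ f] exI[of _ K]) (simp add: S_def)
  fix r assume "\<exists>g K'. g \<in> Lip_sphere \<and> K' \<in> LipK \<and> S f + K = \<sigma> (complex_of_real \<circ> g) + K' \<and>
      r = L_compact n e K' + L_sphere g"
  then obtain g K' where g: "g \<in> Lip_sphere" "K' \<in> LipK" "S f + K = S g + K'"
    and r: "r = L_compact n e K' + L_sphere g" unfolding S_def by blast
  show "r = L_compact n e K + L_sphere f"
    using decomposition_unique[OF f g(1) K g(2,3)] r by simp
qed

lemma TS_E:
  assumes "T \<in> ou_carrier TS"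
  obtains f K where "f \<in> Lip_sphere" "K \<in> LipK" "T = S f + K" "symb T = f" "LTS T = L_compact n e K + L_sphere f"
proof -
  obtain f K where fK: "f \<in> Lip_sphere" "K \<in> LipK" "T = S f + K"
    using assms unfolding TS_carrier by blast
  then show ?thesis using that[OF fK] symb_eq[OF fK(1,2)] LT_eq[OF fK(1,2)] by simp
qed

lemma TS_subspace: "subspace (ou_carrier TS)"
proof (rule subspaceI)
  show "0 \<in> ou_carrier TS" using TS_I[OF Lip_intros(4) LipK_zero] by (simp add: S_zero)
next
  fix a b assume "a \<in> ou_carrier TS" "b \<in> ou_carrier TS"
  then obtain f K g K' where *: "f \<in> Lip_sphere" "K \<in> LipK" "a = S f + K" "g \<in> Lip_sphere" "K' \<in> LipK" "b = S g + K'"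
    by (elim TS_E)
  then have eq: "a + b = S (f + g) + (K + K')" by (simp add: S_add add_ac)
  show "a + b \<in> ou_carrier TS"
    unfolding eq by (intro TS_I LipK_add(1) Lip_intros(1) *)
next
  fix r a assume "a \<in> ou_carrier TS"
  then obtain f K where *: "f \<in> Lip_sphere" "K \<in> LipK" "a = S f + K" by (elim TS_E)
  then have eq: "r *\<^sub>R a = S (r *\<^sub>R f) + r *\<^sub>R K" by (simp add: S_scaleR scaleR_add_right)
  show "r *\<^sub>R a \<in> ou_carrier TS"
    unfolding eq by (intro TS_I LipK_scaleR(1) Lip_intros(3) *)
qed

lemma LipK_positive_diff:
  assumes K: "K \<in> LipK" and le: "\<And>f. f \<in> bergman n \<Longrightarrow> cmod (ip n (K f) f) \<le> r * (hnorm n f)\<^sup>2"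
  shows "positive_op n (r *\<^sub>R op_id n - K)"
  using is_adjoint_self_Im[OF LipK_D(3)[OF K]] order_trans[OF complex_Re_le_cmod le]
  by (intro positive_op_id_diff LipK_D(2)[OF K])

text \<open>Self-adjointness makes the quadratic form real, so a bound on its modulus gives both
  order inequalities, the lower one by passing to \<open>- K\<close>.\<close>

lemma within_LipK:
  assumes K: "K \<in> LipK" and le: "\<And>f. f \<in> bergman n \<Longrightarrow> cmod (ip n (K f) f) \<le> r * (hnorm n f)\<^sup>2"
  shows "ou_within TS r K"
proof -
  have mK: "- K \<in> LipK" by (rule subspace_neg[OF LipK_subspace K])
  have "ip n ((- K) f) f = - ip n (K f) f" for f by (simp add: ip_def)
  then have "positive_op n (r *\<^sub>R op_id n - - K)"
    using le by (intro LipK_positive_diff mK) simp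
  moreover have "r *\<^sub>R op_id n - - K = K - - (r *\<^sub>R op_id n)" by (simp add: algebra_simps)
  ultimately show ?thesis using LipK_positive_diff[OF K le] by (simp add: ou_within_def add.commute)
qed

lemma within_S:
  assumes f: "f \<in> Lip_sphere" and w: "ou_within sphere_space r f"
  shows "ou_within TS r (S f)"
proof -
  have le: "\<bar>f z\<bar> \<le> r" if "z \<in> sphere 0 1" for z using w that by (simp add: within_sphere)
  have "positive_op n (r *\<^sub>R op_id n - S f)"
    using le by (intro S_positive_diff f) (auto simp: abs_le_iff)
  moreover have "positive_op n (r *\<^sub>R op_id n - S (- f))"
    using le by (intro S_positive_diff subspace_neg[OF Lip_sphere_subspace f]) (auto simp: abs_le_iff)
  moreover have "r *\<^sub>R op_id n - S (- f) = S f - - (r *\<^sub>R op_id n)"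
    using S_scaleR[OF f, of "-1"] by (simp add: algebra_simps)
  ultimately show ?thesis by (simp add: ou_within_def)
qed

lemma order_unit_space_TS: "order_unit_space TS"
proof (rule order_unit_spaceI)
  show "subspace (ou_carrier TS)" by (rule TS_subspace)
  show "ou_le TS a a" for a by (simp add: positive_op_zero)
next
  fix a b assume "ou_le TS a b" "ou_le TS b a"
  then have "positive_op n (b - a)" "positive_op n (- (b - a))" by simp_all
  then have "b - a = 0" by (rule positive_op_antisym)
  then show "a = b" by simp
next
  fix a b c assume "ou_le TS a b" "ou_le TS b c"
  then have "positive_op n ((c - b) + (b - a))" by (intro positive_op_add) simp_all
  then show "ou_le TS a c" by simp
next
  fix a b r assume "ou_le TS a b" "0 \<le> (r :: real)"
  then have "positive_op n (r *\<^sub>R (b - a))" by (intro positive_op_scaleR) simp_all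
  then show "ou_le TS (r *\<^sub>R a) (r *\<^sub>R b)" by (simp add: scaleR_diff_right)
next
  show "ou_unit TS \<in> ou_carrier TS"
    using TS_I[OF Lip_intros(5) LipK_zero] by (simp add: S_unit)
next
  fix a assume "a \<in> ou_carrier TS"
  then obtain f K where fK: "f \<in> Lip_sphere" "K \<in> LipK" "a = S f + K" by (elim TS_E)
  obtain M where M: "\<And>z. z \<in> sphere 0 1 \<Longrightarrow> \<bar>f z\<bar> \<le> M" using Lip_sphere_bounded[OF fK(1)] by blast
  obtain C where C: "0 \<le> C" "\<And>h. h \<in> bergman n \<Longrightarrow> hnorm n (K h) \<le> C * hnorm n h"
    using LipK_D(2)[OF fK(2)] by (rule bounded_ops_bound) auto
  define r where "r = \<bar>M\<bar> + 1"
  have r: "r > 0" by (simp add: r_def)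
  have 1: "positive_op n (r *\<^sub>R op_id n - S f)"
    by (rule S_positive_diff[OF fK(1)]) (use M in \<open>fastforce simp: r_def\<close>)
  have 2: "positive_op n (C *\<^sub>R op_id n - K)"
  proof (rule LipK_positive_diff[OF fK(2)])
    fix h :: "'d hfun" assume h: "h \<in> bergman n"
    have "cmod (ip n (K h) h) \<le> hnorm n (K h) * hnorm n h"
      by (rule Cauchy_Schwarz[OF bounded_ops_L2[OF LipK_D(2)[OF fK(2)] h] bergman_L2[OF h]])
    also have "\<dots> \<le> (C * hnorm n h) * hnorm n h" using C(2)[OF h] by (intro mult_right_mono) auto
    finally show "cmod (ip n (K h) h) \<le> C * (hnorm n h)\<^sup>2" by (simp add: power2_eq_square mult.assoc)
  qed
  have "(r *\<^sub>R op_id n - S f) + (C *\<^sub>R op_id n - K) = (r + C) *\<^sub>R op_id n - a"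
    by (simp add: fK(3) scaleR_add_left algebra_simps)
  with positive_op_add[OF 1 2] have "ou_le TS a ((r + C) *\<^sub>R ou_unit TS)" by simp
  then show "\<exists>r>0. ou_le TS a (r *\<^sub>R ou_unit TS)" using r C(1) by (intro exI[of _ "r + C"]) auto
next
  fix a assume le: "\<And>r. r > 0 \<Longrightarrow> ou_le TS a (r *\<^sub>R ou_unit TS)"
  have pos: "positive_op n (r *\<^sub>R op_id n - a)" if "r > 0" for r using le[OF that] by simp
  have ib: "r *\<^sub>R (op_id n :: 'd hop) \<in> bounded_ops n" for r by (intro bounded_ops_scaleR bounded_ops_op_id)
  \<comment> \<open>Boundedness of \<open>a\<close> comes from writing it as
    \<open>1 - (1 - a)\<close>, where \<open>1 - a\<close> is positive by the hypothesis for
    \<open>r = 1\<close>.\<close>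
  have "1 *\<^sub>R op_id n - (1 *\<^sub>R op_id n - a) \<in> bounded_ops n"
    by (intro bounded_ops_minus[OF ib] positive_op_bounded pos) simp
  then have ab: "a \<in> bounded_ops n" by simp
  have eq: "ip n ((r *\<^sub>R op_id n - a) h) h = of_real (r * (hnorm n h)\<^sup>2) - ip n (a h) h" if h: "h \<in> bergman n" for r h
  proof -
    have "(r *\<^sub>R op_id n - a) h = (r *\<^sub>R op_id n) h - a h" by simp
    then have "ip n ((r *\<^sub>R op_id n - a) h) h = ip n ((r *\<^sub>R op_id n) h) h - ip n (a h) h"
      by (simp only: ip_diff_left[OF bounded_ops_L2[OF ib h] bounded_ops_L2[OF ab h] bergman_L2[OF h]])
    then show ?thesis by (simp only: ip_scaleR_op ip_op_id[OF h] of_real_mult)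
  qed
  have "positive_op n (0 *\<^sub>R op_id n - a)"
  proof (rule positive_op_id_diff[OF ab])
    fix h :: "'d hfun" assume h: "h \<in> bergman n"
    show "Im (ip n (a h) h) = 0"
      using positive_opD(1)[OF pos[of 1] h] unfolding eq[OF h] by (simp del: of_real_mult of_real_power)
    have "Re (ip n (a h) h) \<le> r * (hnorm n h)\<^sup>2" if "r > 0" for r
      using positive_opD(2)[OF pos[OF that] h] unfolding eq[OF h] by (simp del: of_real_mult of_real_power)
    then have "Re (ip n (a h) h) \<le> 0" by (rule field_le_scaled_epsilon[rotated]) simp_all
    then show "Re (ip n (a h) h) \<le> 0 * (hnorm n h)\<^sup>2" by simp
  qed
  then show "ou_le TS a 0" by simp
qed auto

text \<open>Adding or subtracting the operator from \<open>r\<close> times the unit turns each order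
  inequality into positivity of a decomposed operator, to which \<open>decomposition_nonneg\<close>
  applies.\<close>

lemma within_symb:
  assumes f: "f \<in> Lip_sphere" and K: "K \<in> LipK" and w: "ou_within TS r (S f + K)"
  shows "ou_within sphere_space r f"
proof -
  have mf: "- f \<in> Lip_sphere" by (rule subspace_neg[OF Lip_sphere_subspace f])
  have "S (r *\<^sub>R one + f) + K = S f + K - - (r *\<^sub>R op_id n)"
    using f by (simp add: S_add S_scaleR S_unit Lip_intros add_ac)
  moreover have "S (r *\<^sub>R one - f) + - K = r *\<^sub>R op_id n - (S f + K)"
    using f by (simp add: S_diff S_scaleR S_unit Lip_intros)
  ultimately have "positive_op n (S (r *\<^sub>R one + f) + K)" "positive_op n (S (r *\<^sub>R one - f) + - K)"
    using w by (simp_all only: ou_within_def TS_simps scaleR_minus_left)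
  then have "0 \<le> (r *\<^sub>R one + f) z" "0 \<le> (r *\<^sub>R one - f) z" if "z \<in> sphere 0 1" for z
    using that by (auto intro!: decomposition_nonneg[of "r *\<^sub>R one + f" K] decomposition_nonneg[of "r *\<^sub>R one - f" "- K"]
        Lip_intros f LipK_D(1) K subspace_neg[OF LipK_subspace] simp del: plus_fun_apply minus_apply)
  then show ?thesis unfolding within_sphere by (fastforce simp: scaleR_fun_def abs_le_iff)
qed

lemma seminorm_LT: "seminorm_on_ou TS LTS"
  unfolding seminorm_on_ou_def
proof (intro conjI ballI allI)
  fix a assume "a \<in> ou_carrier TS"
  then obtain f K where fK: "f \<in> Lip_sphere" "K \<in> LipK" "a = S f + K" "LTS a = L_compact n e K + L_sphere f" by (elim TS_E)
  show "0 \<le> LTS a" using fK by (simp add: L_compact_nonneg L_sphere_nonneg)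
  fix r :: real
  have eq: "r *\<^sub>R a = S (r *\<^sub>R f) + r *\<^sub>R K" using fK by (simp add: S_scaleR scaleR_add_right)
  have "LTS (r *\<^sub>R a) = L_compact n e (r *\<^sub>R K) + L_sphere (r *\<^sub>R f)"
    unfolding eq by (intro LT_eq LipK_scaleR(1) Lip_intros(3) fK)
  also have "\<dots> = \<bar>r\<bar> * L_compact n e K + \<bar>r\<bar> * L_sphere f"
    using fK seminorm_L_sphere[where 'a = 'd] by (simp add: L_compact_scaleR seminorm_on_ou_def)
  finally show "LTS (r *\<^sub>R a) = \<bar>r\<bar> * LTS a" using fK by (simp add: distrib_left)
next
  fix a b assume "a \<in> ou_carrier TS" "b \<in> ou_carrier TS"
  then obtain f K g K' where *: "f \<in> Lip_sphere" "K \<in> LipK" "a = S f + K" "LTS a = L_compact n e K + L_sphere f"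
    "g \<in> Lip_sphere" "K' \<in> LipK" "b = S g + K'" "LTS b = L_compact n e K' + L_sphere g"
    by (elim TS_E)
  have eq: "a + b = S (f + g) + (K + K')" using * by (simp add: S_add add_ac)
  have "LTS (a + b) = L_compact n e (K + K') + L_sphere (f + g)"
    unfolding eq by (intro LT_eq LipK_add(1) Lip_intros(1) *)
  also have "\<dots> \<le> (L_compact n e K + L_compact n e K') + (L_sphere f + L_sphere g)"
    using * seminorm_L_sphere[where 'a = 'd] by (intro add_mono L_compact_add) (auto simp: seminorm_on_ou_def)
  finally show "LTS (a + b) \<le> LTS a + LTS b" using * by simp
qed

text \<open>Both summands of the seminorm are nonnegative, so on its unit ball the symbol and the
  compact part each have seminorm at most 1, and their covers pull back. The scalar comes from the
  symbol alone; it is carried to a multiple of the identity by \<open>S\<close>.\<close>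

lemma small_cover_TS:
  assumes \<epsilon>: "\<epsilon> > 0"
  shows "small_cover {a \<in> ou_carrier TS. LTS a \<le> 1}
    (\<lambda>a b. \<exists>c. ou_within TS \<epsilon> (a - b - c *\<^sub>R ou_unit TS))"
proof -
  interpret A: ou TS by standard (rule order_unit_space_TS)
  let ?X = "{a \<in> ou_carrier TS. LTS a \<le> 1}"
  have X: "symb a \<in> Lip_sphere \<and> L_sphere (symb a) \<le> 1 \<and> a - S (symb a) \<in> LipK \<and> L_compact n e (a - S (symb a)) \<le> 1"
    if "a \<in> ?X" for a
  proof -
    have "a \<in> ou_carrier TS" "LTS a \<le> 1" using that by auto
    then obtain f K where fK: "f \<in> Lip_sphere" "K \<in> LipK" "a = S f + K" "symb a = f" "LTS a = L_compact n e K + L_sphere f"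
      by (elim TS_E)
    then show ?thesis
      using \<open>LTS a \<le> 1\<close> L_compact_nonneg[OF fK(2)] L_sphere_nonneg[OF fK(1)] by simp
  qed
  have 1: "small_cover ?X (\<lambda>a b. \<exists>c. ou_within sphere_space (\<epsilon> / 2) (symb a - symb b - c *\<^sub>R ou_unit sphere_space))"
    using \<epsilon> X by (intro small_cover_pullback[OF small_cover_sphere]) auto
  have 2: "small_cover ?X (\<lambda>a b. \<forall>f\<in>bergman n.
      cmod (ip n (((a - S (symb a)) - (b - S (symb b))) f) f) \<le> \<epsilon> / 2 * (hnorm n f)\<^sup>2)"
    using \<epsilon> X by (intro small_cover_pullback[OF small_cover_LipK, where h = "\<lambda>a. a - S (symb a)"]) auto
  show ?thesis
  proof (rule small_cover_mono[OF small_cover_conj[OF 1 2]])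
    fix a b assume a: "a \<in> ?X" and b: "b \<in> ?X"
      and *: "(\<exists>c. ou_within sphere_space (\<epsilon> / 2) (symb a - symb b - c *\<^sub>R ou_unit sphere_space)) \<and>
        (\<forall>f\<in>bergman n. cmod (ip n (((a - S (symb a)) - (b - S (symb b))) f) f) \<le> \<epsilon> / 2 * (hnorm n f)\<^sup>2)"
    obtain c where c: "ou_within sphere_space (\<epsilon> / 2) (symb a - symb b - c *\<^sub>R ou_unit sphere_space)"
      using * by (elim conjE exE)
    let ?f = "symb a - symb b - c *\<^sub>R one" and ?K = "(a - S (symb a)) - (b - S (symb b))"
    have f: "?f \<in> Lip_sphere" using X[OF a] X[OF b] by (intro Lip_intros) auto
    have K: "?K \<in> LipK" using X[OF a] X[OF b] by (simp only: subspace_diff[OF LipK_subspace])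
    have 1: "ou_within TS (\<epsilon> / 2) (S ?f)" using c by (intro within_S f) simp
    have 2: "ou_within TS (\<epsilon> / 2) ?K" using * by (intro within_LipK K) blast
    have SC: "S ?f \<in> ou_carrier TS" "?K \<in> ou_carrier TS"
      using TS_I[OF f LipK_zero] TS_I[OF Lip_intros(4) K] by (simp_all add: S_zero)
    have "S ?f = S (symb a) - S (symb b) - c *\<^sub>R op_id n"
      using X[OF a] X[OF b] by (simp add: S_diff S_scaleR S_unit Lip_intros)
    then have eq: "S ?f + ?K = a - b - c *\<^sub>R op_id n" by (simp only:) (simp add: algebra_simps)
    have "ou_within TS (\<epsilon> / 2 + \<epsilon> / 2) (S ?f + ?K)"
      by (rule A.within_add[OF SC 1 2])
    then have "ou_within TS \<epsilon> (a - b - c *\<^sub>R ou_unit TS)"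
      by (simp only: eq TS_simps field_sum_of_halves)
    then show "\<exists>c. ou_within TS \<epsilon> (a - b - c *\<^sub>R ou_unit TS)" by (rule exI)
  qed
qed

lemma retraction: "ou_retraction TS sphere_space S symb LTS L_sphere"
proof (intro ou_retraction.intro ou.intro ou_retraction_axioms.intro order_unit_space_TS order_unit_space_sphere)
  show "S f \<in> ou_carrier TS" if "f \<in> ou_carrier sphere_space" for f
    using TS_I[OF _ LipK_zero, of f] that by simp
  show "symb a \<in> ou_carrier sphere_space" if "a \<in> ou_carrier TS" for a
    using that by (elim TS_E) simp
  show "symb (a + b) = symb a + symb b" if ab: "a \<in> ou_carrier TS" "b \<in> ou_carrier TS" for a b
  proof -
    obtain f K where 1: "f \<in> Lip_sphere" "K \<in> LipK" "a = S f + K" "symb a = f" using ab(1) by (elim TS_E)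
    obtain g K' where 2: "g \<in> Lip_sphere" "K' \<in> LipK" "b = S g + K'" "symb b = g" using ab(2) by (elim TS_E)
    have eq: "a + b = S (f + g) + (K + K')" using 1 2 by (simp add: S_add add_ac)
    have "symb (a + b) = f + g" unfolding eq by (intro symb_eq LipK_add(1) Lip_intros(1) 1 2)
    then show ?thesis using 1 2 by simp
  qed
  show "symb (r *\<^sub>R a) = r *\<^sub>R symb a" if a: "a \<in> ou_carrier TS" for a r
  proof -
    obtain f K where 1: "f \<in> Lip_sphere" "K \<in> LipK" "a = S f + K" "symb a = f" using a by (elim TS_E)
    have eq: "r *\<^sub>R a = S (r *\<^sub>R f) + r *\<^sub>R K" using 1 by (simp add: S_scaleR scaleR_add_right)
    have "symb (r *\<^sub>R a) = r *\<^sub>R f" unfolding eq by (intro symb_eq LipK_scaleR(1) Lip_intros(3) 1)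
    then show ?thesis using 1 by simp
  qed
  show "symb (ou_unit TS) = ou_unit sphere_space"
    using symb_eq[OF Lip_intros(5) LipK_zero] by (simp add: S_unit)
  show "ou_within sphere_space r (symb a)" if a: "a \<in> ou_carrier TS" "ou_within TS r a" for a r
  proof -
    obtain f K where 1: "f \<in> Lip_sphere" "K \<in> LipK" "a = S f + K" "symb a = f" using a(1) by (elim TS_E)
    then show ?thesis using within_symb[OF 1(1,2)] a(2) by simp
  qed
  show "symb (S f) = f" if "f \<in> ou_carrier sphere_space" for f
    using symb_eq[OF _ LipK_zero, of f] that by simp
  show "LTS (ou_unit TS) = 0"
    using LT_eq[OF Lip_intros(5) LipK_zero] by (simp add: S_unit L_compact_zero L_sphere_indicator)
  show "L_sphere (symb a) \<le> LTS a" if "a \<in> ou_carrier TS" for a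
    using that by (elim TS_E) (simp add: L_compact_nonneg)
  show "LTS (S f) = L_sphere f" if "f \<in> ou_carrier sphere_space" for f
    using LT_eq[OF _ LipK_zero, of f] that by (simp add: L_compact_zero)
qed (simp_all add: S_add S_scaleR S_unit within_S seminorm_LT seminorm_L_sphere L_sphere_indicator
    small_cover_TS[simplified] small_cover_sphere[simplified] state_space_sphere_nonempty)

lemma conclusion:
  "compact_quantum_metric_space TS LTS"
  "compact_quantum_metric_space (sphere_space :: (complex ^ 'd \<Rightarrow> real) ou_space) L_sphere"
  "dist_q TS LTS (sphere_space :: (complex ^ 'd \<Rightarrow> real) ou_space) L_sphere
    \<le> ennreal ((1 / 2) ^ (n + 2) * decay_sum\<^sup>2)"
proof -
  interpret R: ou_retraction TS sphere_space S symb LTS L_sphere by (rule retraction)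
  show "compact_quantum_metric_space TS LTS"
    "compact_quantum_metric_space (sphere_space :: (complex ^ 'd \<Rightarrow> real) ou_space) L_sphere"
    using R.lip_norms order_unit_space_TS order_unit_space_sphere
    by (simp_all add: compact_quantum_metric_space_def)
  show "dist_q TS LTS (sphere_space :: (complex ^ 'd \<Rightarrow> real) ou_space) L_sphere
    \<le> ennreal ((1 / 2) ^ (n + 2) * decay_sum\<^sup>2)"
  proof (rule R.dist_q_le)
    fix a assume "a \<in> ou_carrier TS" and L: "LTS a \<le> 1"
    then obtain f K where fK: "f \<in> Lip_sphere" "K \<in> LipK" "a = S f + K" "symb a = f" "LTS a = L_compact n e K + L_sphere f"
      by (elim TS_E)
    have "L_compact n e K \<le> 1" using L fK L_sphere_nonneg[OF fK(1)] by simp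
    then have "ou_within TS ((1 / 2) ^ (n + 2) * decay_sum\<^sup>2) K"
      by (intro within_LipK fK LipK_quadratic_form)
    then show "ou_within TS ((1 / 2) ^ (n + 2) * decay_sum\<^sup>2) (a - S (symb a))"
      using fK by simp
  qed simp
qed

end

text \<open>The enumeration may change with \<open>n\<close> arbitrarily: the matrix estimates see
  only the indices, never the monomials behind them, and their constant \<open>decay_sum\<close> is
  common to all \<open>n\<close>.\<close>

theorem theorem3p1:
  fixes \<kappa> :: "nat \<Rightarrow> nat \<Rightarrow> ('d::finite \<Rightarrow> nat)"
    and \<sigma> :: "nat \<Rightarrow> 'd hfun \<Rightarrow> 'd hop"
    and e :: "nat \<Rightarrow> nat \<Rightarrow> 'd hfun"
  assumes enumeration: "\<And>n. n \<ge> CARD('d) \<Longrightarrow> bij_betw (\<kappa> n) {1..} UNIV"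
    and basis: "\<And>n j. n \<ge> CARD('d) \<Longrightarrow> j \<ge> 1 \<Longrightarrow> e n j = monomial_basis n (\<kappa> n j)"
    and splitting: "\<And>n. n \<ge> CARD('d) \<Longrightarrow> positive_splitting n (\<sigma> n)"
    and unital: "\<And>n. n \<ge> CARD('d) \<Longrightarrow> \<sigma> n (indicator (sphere 0 1)) = op_id n"
  shows "(\<forall>n\<ge>CARD('d). compact_quantum_metric_space
            (toeplitz_space n (e n) (\<sigma> n)) (L_toeplitz n (e n) (\<sigma> n))) \<and>
         compact_quantum_metric_space (sphere_space :: (complex ^ 'd \<Rightarrow> real) ou_space) L_sphere \<and>
         (\<lambda>n. dist_q (toeplitz_space n (e n) (\<sigma> n)) (L_toeplitz n (e n) (\<sigma> n))
                (sphere_space :: (complex ^ 'd \<Rightarrow> real) ou_space) L_sphere) \<longlonglongrightarrow> 0"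
proof -
  have ts: "toeplitz_setup n (e n) (\<kappa> n) (\<sigma> n)" if "n \<ge> CARD('d)" for n
    using that assms by unfold_locales auto
  let ?d = "\<lambda>n. dist_q (toeplitz_space n (e n) (\<sigma> n)) (L_toeplitz n (e n) (\<sigma> n))
    (sphere_space :: (complex ^ 'd \<Rightarrow> real) ou_space) L_sphere"
  have "(\<lambda>n. (1 / 2 :: real) ^ (n + 2) * decay_sum\<^sup>2) \<longlonglongrightarrow> 0 * decay_sum\<^sup>2"
    by (intro tendsto_intros LIMSEQ_ignore_initial_segment LIMSEQ_power_zero) simp
  then have "(\<lambda>n. ennreal ((1 / 2) ^ (n + 2) * decay_sum\<^sup>2)) \<longlonglongrightarrow> ennreal 0"
    by (intro tendsto_ennrealI) simp
  then have up: "(\<lambda>n. ennreal ((1 / 2) ^ (n + 2) * decay_sum\<^sup>2)) \<longlonglongrightarrow> 0" by simp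
  have "\<forall>\<^sub>F n in sequentially. ?d n \<le> ennreal ((1 / 2) ^ (n + 2) * decay_sum\<^sup>2)"
    using eventually_ge_at_top[of "CARD('d)"]
    by eventually_elim (rule toeplitz_setup.conclusion(3)[OF ts])
  then have "?d \<longlonglongrightarrow> 0"
    by (rule tendsto_sandwich[OF always_eventually _ tendsto_const up, rotated]) simp
  moreover have "compact_quantum_metric_space (sphere_space :: (complex ^ 'd \<Rightarrow> real) ou_space) L_sphere"
    by (rule toeplitz_setup.conclusion(2)[OF ts[OF order_refl]])
  ultimately show ?thesis
    using toeplitz_setup.conclusion(1)[OF ts] by auto
qed

end
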